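(* Let $H(K)$ be a separable reproducing kernel Hilbert space on $D\subset\mathbb R^d$ whose kernel $K$ is bounded ($\sup_{x\in D}K(x,x)<\infty$) and has finite trace ($\int_DK(x,x)\,d\nu(x)<\infty$). Let $\lambda_k$ and $\eta_k$ ($k\in\mathbb N$) denote the eigenvalues and $L_2$-orthonormal eigenfunctions of $W=\mathrm{Id}^*\circ\mathrm{Id}$, where $\mathrm{Id}\colon H(K)\hookrightarrow L_2=L_2(D,\nu)$ is the embedding. Let $I_{MZ}\subset\mathbb N$ be a finite index set and assume that the points $X_{MZ}=\{x^1,\dots,x^M\}\subset D$ and the weights $\omega_1,\dots,\omega_M\ge0$ with $\sum_{i=1}^M\omega_i=1$ satisfy $A\|f\|_{L_2}^2\le\sum_{i=1}^M\omega_i|f(x^i)|^2\le B\|f\|_{L_2}^2$ for all $f\in V=\operatorname{span}\{\eta_k\}_{k\in I_{MZ}}$, with constants $0<A\le B<\infty$. Let $I\subset I_{MZ}$ with $|I|\ge3$. Let $n\in\mathbb N$, $t>0$, $r\ge1$ be such that $$n=\Big\lceil\frac{36B}A|I|(\log|I|+t)\Big\rceil\le|I|^r,$$ and draw indices $J=(j_1,\dots,j_n)$ i.i.d. from $\{1,\dots,M\}$ according to the probability weights $\varrho_i$ defined in the context. Put $X=(x^i)_{i\in J}$ and $W=\operatorname{diag}(\omega_i/\varrho_i)_{i\in J}$. Then with probability exceeding $1-4\exp(-t)$ the weighted least squares approximation $S_I^X=S_I^X(W)$ is well defined and $$\sup_{\|f\|_{H(K)}\le1}\|f-S_I^Xf\|_{L_2}^2\le\frac{9B}A\sup_{k\notin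 I}\lambda_k+\frac{7r}{|I|}\sum_{k\in I_{MZ}\setminus I}\lambda_k+\frac{12}A\sup_{\|f\|_{H(K)}\le1}\|f-P_{I_{MZ}}f\|_{\ell_\infty(D)}^2 .$$
   Context: $\nu$ is a $\sigma$-finite measure on $D\subset\mathbb R^d$, and $L_2=L_2(D,\nu)$ is the space of complex-valued square-integrable functions with $\langle f,g\rangle_{L_2}=\int_D f\overline g\,d\nu$. $H(K)\subset\mathbb C^D$ is the reproducing kernel Hilbert space of a Hermitian positive definite kernel $K$; the finite trace condition makes $\mathrm{Id}$ Hilbert–Schmidt. The operator $\mathrm{Id}^*\circ\mathrm{Id}\colon H(K)\to H(K)$ maps $f$ to $\sum_k\lambda_k\langle f,e_k\rangle_{H(K)}e_k$ with $(\lambda_k)$ the non-increasingly ordered eigenvalues and $(e_k)$ an orthonormal system in $H(K)$ of eigenfunctions; $\eta_k=\lambda_k^{-1/2}e_k$ is orthonormal in $L_2$. $\log$ is the natural logarithm, $\|g\|_{\ell_\infty(D)}=\sup_{x\in D}|g(x)|$, and $k\notin I$ means $k\in\mathbb N\setminus I$. Projection: for a finite index set $I$, $P_If=\sum_{k\in I}\langle f,\eta_k\rangle_{L_2}\eta_k$. Sampling density: for $i=1,\dots,M$, $$\varrho_i=\frac{\omega_i\sum_{k\in I}|\eta_k(x^i)|^2}{3\sum_{j=1}^M\omega_j\sum_{k\in I}|\eta_k(x^j)|^2}+\frac{\omega_i\sum_{k\in I_{MZ}\setminus I}|e_k(x^i)|^2}{3\sum_{j=1}^M\omega_j\sum_{k\in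 I_{MZ}\setminus I}|e_k(x^j)|^2}+\frac{\omega_i}3 .$$ If $I=I_{MZ}$, the middle term (which would read $0/0$) is replaced by $\omega_i/3$. Thus $\varrho_i\ge0$ and $\sum_i\varrho_i=1$. Repeated indices in $J$ are counted with multiplicity. Weighted least squares: for a finite family of points $X=(x^i)_{i\in J}$, a diagonal matrix $W$ of nonnegative weights indexed by $J$, and $L=(\eta_k(x^i))_{i\in J,\,k\in I}$, put $S_I^X(W)f=\sum_{k\in I}a_k\eta_k$ with $a=(L^*WL)^{-1}L^*W\,(f(x^i))_{i\in J}$; it is well defined when $L^*WL$ is invertible. *)

theory Defs
  imports
    "HOL-Probability.Probability"
    "Jordan_Normal_Form.Gauss_Jordan_Elimination"
    "Jordan_Normal_Form.Schur_Decomposition"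
begin

definition hnorm :: "(('a \<Rightarrow> complex) \<Rightarrow> ('a \<Rightarrow> complex) \<Rightarrow> complex) \<Rightarrow> ('a \<Rightarrow> complex) \<Rightarrow> real" where
  "hnorm ip f = sqrt (Re (ip f f))"

definition kernel_section :: "'a set \<Rightarrow> ('a \<Rightarrow> 'a \<Rightarrow> complex) \<Rightarrow> 'a \<Rightarrow> 'a \<Rightarrow> complex" where
  "kernel_section D K x = (\<lambda>y. if y \<in> D then K y x else 0)"

definition hermitian_pos_def_kernel :: "'a set \<Rightarrow> ('a \<Rightarrow> 'a \<Rightarrow> complex) \<Rightarrow> bool" where
  "hermitian_pos_def_kernel D K \<longleftrightarrow>
     (\<forall>x\<in>D. \<forall>y\<in>D. K y x = cnj (K x y)) \<and>
     (\<forall>F c. finite F \<longrightarrow> F \<subseteq> D \<longrightarrow>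
        0 \<le> Re (\<Sum>x\<in>F. \<Sum>y\<in>F. c x * cnj (c y) * K y x))"

text \<open>
  \<open>rkhs D K H ip\<close>: the set \<open>H\<close> with inner product \<open>ip\<close> (linear in the first argument) is
  the Hilbert space \<open>H(K)\<close> of functions on \<open>D\<close>; by the Moore--Aronszajn theorem \<open>H\<close>, and \<open>ip\<close>
  on \<open>H\<close>, are determined by \<open>D\<close> and \<open>K\<close>.  Functions on \<open>D\<close> are encoded as functions on the
  ambient type that vanish outside \<open>D\<close>.
\<close>

locale rkhs =
  fixes D :: "'a set"
    and K :: "'a \<Rightarrow> 'a \<Rightarrow> complex"
    and H :: "('a \<Rightarrow> complex) set"
    and ip :: "('a \<Rightarrow> complex) \<Rightarrow> ('a \<Rightarrow> complex) \<Rightarrow> complex"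
  assumes kernel: "hermitian_pos_def_kernel D K"
    and vanish: "f \<in> H \<Longrightarrow> x \<notin> D \<Longrightarrow> f x = 0"
    and zero_mem: "(\<lambda>x. 0) \<in> H"
    and add_mem: "f \<in> H \<Longrightarrow> g \<in> H \<Longrightarrow> (\<lambda>x. f x + g x) \<in> H"
    and scale_mem: "f \<in> H \<Longrightarrow> (\<lambda>x. c * f x) \<in> H"
    and ip_add: "f \<in> H \<Longrightarrow> g \<in> H \<Longrightarrow> h \<in> H \<Longrightarrow> ip (\<lambda>x. f x + g x) h = ip f h + ip g h"
    and ip_scale: "f \<in> H \<Longrightarrow> h \<in> H \<Longrightarrow> ip (\<lambda>x. c * f x) h = c * ip f h"
    and ip_cnj: "f \<in> H \<Longrightarrow> g \<in> H \<Longrightarrow> ip g f = cnj (ip f g)"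
    and ip_nonneg: "f \<in> H \<Longrightarrow> 0 \<le> Re (ip f f)"
    and ip_definite: "f \<in> H \<Longrightarrow> ip f f = 0 \<Longrightarrow> f = (\<lambda>x. 0)"
    and complete:
      "(\<forall>n. u n \<in> H) \<Longrightarrow>
       (\<forall>\<epsilon>>0. \<exists>N. \<forall>m\<ge>N. \<forall>n\<ge>N. hnorm ip (\<lambda>x. u m x - u n x) < \<epsilon>) \<Longrightarrow>
       \<exists>f\<in>H. (\<lambda>n. hnorm ip (\<lambda>x. u n x - f x)) \<longlonglongrightarrow> 0"
    and section_mem: "x \<in> D \<Longrightarrow> kernel_section D K x \<in> H"
    and reproducing: "f \<in> H \<Longrightarrow> x \<in> D \<Longrightarrow> ip f (kernel_section D K x) = f x"

definition h_separable ::
    "('a \<Rightarrow> complex) set \<Rightarrow> (('a \<Rightarrow> complex) \<Rightarrow> ('a \<Rightarrow> complex) \<Rightarrow> complex) \<Rightarrow> bool" where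
  "h_separable H ip \<longleftrightarrow>
     (\<exists>S. countable S \<and> S \<subseteq> H \<and> (\<forall>f\<in>H. \<forall>\<epsilon>>0. \<exists>s\<in>S. hnorm ip (\<lambda>x. f x - s x) < \<epsilon>))"

definition unit_ball ::
    "('a \<Rightarrow> complex) set \<Rightarrow> (('a \<Rightarrow> complex) \<Rightarrow> ('a \<Rightarrow> complex) \<Rightarrow> complex) \<Rightarrow> ('a \<Rightarrow> complex) set" where
  "unit_ball H ip = {f \<in> H. hnorm ip f \<le> 1}"

text \<open>
  Elements of \<open>L\<^sub>2\<close> are represented by functions instead of equivalence classes; the inner
  product and the norm do not see the difference.
\<close>

definition square_integrable :: "'a measure \<Rightarrow> ('a \<Rightarrow> complex) set" where
  "square_integrable \<nu> = {f \<in> borel_measurable \<nu>. integrable \<nu> (\<lambda>x. (cmod (f x))\<^sup>2)}"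

definition l2_inner :: "'a measure \<Rightarrow> ('a \<Rightarrow> complex) \<Rightarrow> ('a \<Rightarrow> complex) \<Rightarrow> complex" where
  "l2_inner \<nu> f g = (\<integral>x. f x * cnj (g x) \<partial>\<nu>)"

text \<open>The squared norm of \<open>L\<^sub>2\<close>, with value \<open>\<infinity>\<close> off \<open>L\<^sub>2\<close>.\<close>

definition l2_norm_sq :: "'a measure \<Rightarrow> ('a \<Rightarrow> complex) \<Rightarrow> ennreal" where
  "l2_norm_sq \<nu> f = (\<integral>\<^sup>+x. ennreal ((cmod (f x))\<^sup>2) \<partial>\<nu>)"

definition sup_norm :: "'a set \<Rightarrow> ('a \<Rightarrow> complex) \<Rightarrow> ennreal" where
  "sup_norm D g = (SUP x\<in>D. ennreal (cmod (g x)))"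

text \<open>
  \<open>S\<close> is the Hilbert space adjoint of the embedding of \<open>H\<close> into \<open>L\<^sub>2\<close>.  As the embedding does
  not change the function, the operator \<open>W\<close> (the adjoint after the embedding) is \<open>S\<close>
  restricted to \<open>H\<close>.
\<close>

definition embedding_adjoint ::
    "'a measure \<Rightarrow> ('a \<Rightarrow> complex) set \<Rightarrow> (('a \<Rightarrow> complex) \<Rightarrow> ('a \<Rightarrow> complex) \<Rightarrow> complex) \<Rightarrow>
     (('a \<Rightarrow> complex) \<Rightarrow> ('a \<Rightarrow> complex)) \<Rightarrow> bool" where
  "embedding_adjoint \<nu> H ip S \<longleftrightarrow>
     (\<forall>g\<in>square_integrable \<nu>. S g \<in> H \<and> (\<forall>h\<in>H. ip (S g) h = l2_inner \<nu> g h))"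

text \<open>
  Spectral decomposition \<open>T f = (\<Sum>k. \<lambda>\<^sub>k \<langle>f, e\<^sub>k\<rangle> e\<^sub>k)\<close> with convergence in the norm of \<open>H\<close>.
  An operator of finite rank is covered by \<open>\<lambda>\<^sub>k = 0\<close> for all large \<open>k\<close>; the vectors \<open>e\<^sub>k\<close> with
  \<open>\<lambda>\<^sub>k = 0\<close> are then irrelevant and need not be orthonormal (\<open>H\<close> may have finite dimension).
\<close>

definition eigensystem ::
    "('a \<Rightarrow> complex) set \<Rightarrow> (('a \<Rightarrow> complex) \<Rightarrow> ('a \<Rightarrow> complex) \<Rightarrow> complex) \<Rightarrow>
     (('a \<Rightarrow> complex) \<Rightarrow> ('a \<Rightarrow> complex)) \<Rightarrow> (nat \<Rightarrow> real) \<Rightarrow> (nat \<Rightarrow> 'a \<Rightarrow> complex) \<Rightarrow> bool" where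
  "eigensystem H ip T lam e \<longleftrightarrow>
     decseq lam \<and> (\<forall>k. 0 \<le> lam k) \<and> (\<forall>k. e k \<in> H) \<and>
     (\<forall>j k. 0 < lam j \<longrightarrow> 0 < lam k \<longrightarrow> ip (e j) (e k) = (if j = k then 1 else 0)) \<and>
     (\<forall>f\<in>H. (\<lambda>N. hnorm ip (\<lambda>x. T f x - (\<Sum>k<N. of_real (lam k) * ip f (e k) * e k x))) \<longlonglongrightarrow> 0)"

definition eta :: "(nat \<Rightarrow> real) \<Rightarrow> (nat \<Rightarrow> 'a \<Rightarrow> complex) \<Rightarrow> nat \<Rightarrow> 'a \<Rightarrow> complex" where
  "eta lam e k = (\<lambda>x. e k x / of_real (sqrt (lam k)))"

definition fun_span :: "nat set \<Rightarrow> (nat \<Rightarrow> 'a \<Rightarrow> complex) \<Rightarrow> ('a \<Rightarrow> complex) set" where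
  "fun_span I b = {\<lambda>x. \<Sum>k\<in>I. c k * b k x | c. True}"

definition l2_projection ::
    "'a measure \<Rightarrow> nat set \<Rightarrow> (nat \<Rightarrow> 'a \<Rightarrow> complex) \<Rightarrow> ('a \<Rightarrow> complex) \<Rightarrow> 'a \<Rightarrow> complex" where
  "l2_projection \<nu> I b f = (\<lambda>x. \<Sum>k\<in>I. l2_inner \<nu> f (b k) * b k x)"

definition sampling_density ::
    "nat \<Rightarrow> (nat \<Rightarrow> 'a) \<Rightarrow> (nat \<Rightarrow> real) \<Rightarrow> (nat \<Rightarrow> real) \<Rightarrow> (nat \<Rightarrow> 'a \<Rightarrow> complex) \<Rightarrow>
     nat set \<Rightarrow> nat set \<Rightarrow> nat \<Rightarrow> real" where
  "sampling_density M x \<omega> lam e I IMZ i =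
     (\<omega> i * (\<Sum>k\<in>I. (cmod (eta lam e k (x i)))\<^sup>2))
       / (3 * (\<Sum>j=1..M. \<omega> j * (\<Sum>k\<in>I. (cmod (eta lam e k (x j)))\<^sup>2)))
     + (if I = IMZ then \<omega> i / 3
        else (\<omega> i * (\<Sum>k\<in>IMZ - I. (cmod (e k (x i)))\<^sup>2))
               / (3 * (\<Sum>j=1..M. \<omega> j * (\<Sum>k\<in>IMZ - I. (cmod (e k (x j)))\<^sup>2))))
     + \<omega> i / 3"

text \<open>
  The sample is a family of \<open>n\<close> points \<open>xs 0, \<dots>, xs (n - 1)\<close> with weights \<open>w\<close>, so repetitions
  count with multiplicity.  Column \<open>j\<close> of the system matrix belongs to the \<open>j\<close>-th element of
  \<open>I\<close> in increasing order.
\<close>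

definition system_matrix ::
    "nat set \<Rightarrow> (nat \<Rightarrow> 'a \<Rightarrow> complex) \<Rightarrow> nat \<Rightarrow> (nat \<Rightarrow> 'a) \<Rightarrow> complex mat" where
  "system_matrix I b n xs =
     Matrix.mat n (card I) (\<lambda>(i, j). b (sorted_list_of_set I ! j) (xs i))"

definition weight_matrix :: "nat \<Rightarrow> (nat \<Rightarrow> real) \<Rightarrow> complex mat" where
  "weight_matrix n w = mat_diag n (\<lambda>i. of_real (w i))"

definition normal_matrix ::
    "nat set \<Rightarrow> (nat \<Rightarrow> 'a \<Rightarrow> complex) \<Rightarrow> nat \<Rightarrow> (nat \<Rightarrow> 'a) \<Rightarrow> (nat \<Rightarrow> real) \<Rightarrow> complex mat" where
  "normal_matrix I b n xs w =
     mat_adjoint (system_matrix I b n xs) * weight_matrix n w * system_matrix I b n xs"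

definition wls_well_defined ::
    "nat set \<Rightarrow> (nat \<Rightarrow> 'a \<Rightarrow> complex) \<Rightarrow> nat \<Rightarrow> (nat \<Rightarrow> 'a) \<Rightarrow> (nat \<Rightarrow> real) \<Rightarrow> bool" where
  "wls_well_defined I b n xs w \<longleftrightarrow> invertible_mat (normal_matrix I b n xs w)"

text \<open>Meaningful only under \<open>wls_well_defined\<close>, since otherwise \<open>mat_inverse\<close> is \<open>None\<close>.\<close>

definition wls_coeffs ::
    "nat set \<Rightarrow> (nat \<Rightarrow> 'a \<Rightarrow> complex) \<Rightarrow> nat \<Rightarrow> (nat \<Rightarrow> 'a) \<Rightarrow> (nat \<Rightarrow> real) \<Rightarrow>
     ('a \<Rightarrow> complex) \<Rightarrow> complex Matrix.vec" where
  "wls_coeffs I b n xs w f =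
     (the (mat_inverse (normal_matrix I b n xs w)) * mat_adjoint (system_matrix I b n xs)
        * weight_matrix n w) *\<^sub>v Matrix.vec n (\<lambda>i. f (xs i))"

definition wls ::
    "nat set \<Rightarrow> (nat \<Rightarrow> 'a \<Rightarrow> complex) \<Rightarrow> nat \<Rightarrow> (nat \<Rightarrow> 'a) \<Rightarrow> (nat \<Rightarrow> real) \<Rightarrow>
     ('a \<Rightarrow> complex) \<Rightarrow> 'a \<Rightarrow> complex" where
  "wls I b n xs w f =
     (\<lambda>y. \<Sum>j<card I. vec_index (wls_coeffs I b n xs w f) j * b (sorted_list_of_set I ! j) y)"

end

theory Submission
  imports Defs
begin

text \<open>
Let \<open>f\<close> be in the unit ball and \<open>g = f - P\<^sub>I f\<close>.  Weighted least squares reproduces the span of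
the \<open>\<eta>\<^sub>k\<close> with \<open>k \<in> I\<close>, so the coefficients of \<open>S f - P\<^sub>I f\<close> solve the normal equations with
data \<open>g\<close>; their size is at most the empirical energy of \<open>g\<close> divided by the smallest eigenvalue
of the normal matrix (\<open>wls_stable\<close>).  Split \<open>g\<close> into its part \<open>g\<^sub>1\<close> with frequencies in
\<open>I\<^sub>M\<^sub>Z - I\<close> and the remainder \<open>g\<^sub>2 = f - P f\<close>, where \<open>P\<close> projects onto all frequencies in
\<open>I\<^sub>M\<^sub>Z\<close>.  The last summand of the sampling density keeps every weight below \<open>3\<close>, so \<open>g\<^sub>2\<close>
enters only through its supremum.  It remains to bound the normal matrix from below by \<open>A / 2\<close>
per sample, and the empirical energy of \<open>g\<^sub>1\<close> from above.

Both are statements about a sum of independent rank-one operators \<open>v v\<^sup>*\<close>.  Its mean is controlled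
by the Marcinkiewicz--Zygmund inequality, and the other two summands of the density bound each
\<open>|v|\<^sup>2\<close> by three times its total mean.  This is the setting of the matrix Chernoff inequalities
(\<open>sampled_frame_lower_tail\<close>, \<open>sampled_frame_upper_tail\<close>).

They are proved here with powers instead of exponentials.  For \<open>T = 1 \<plusminus> (\<Sum>l. v\<^sub>l v\<^sub>l\<^sup>*)\<close> one has
\<open>tr T\<^sup>p\<^sup>+\<^sup>1 - tr T\<^sup>p = \<plusminus> (\<Sum>l. \<langle>T\<^sup>p v\<^sub>l, v\<^sub>l\<rangle>)\<close>, and each summand could be averaged over \<open>v\<^sub>l\<close> if \<open>T\<close> did
not depend on \<open>v\<^sub>l\<close>.  Removing the \<open>l\<close>-th sample changes \<open>T\<close> by \<open>\<kappa> e e\<^sup>*\<close>, where \<open>e\<close> is the unit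
vector along \<open>v\<^sub>l\<close>.  The moments \<open>\<langle>T\<^sup>k e, e\<rangle>\<close> satisfy a renewal equation: decompose a power
according to its last passage through \<open>e\<close>.  For positive \<open>T\<close> the first-return coefficients are
nonnegative, and the rank-one update changes only the one of lag zero, by \<open>\<kappa>\<close>.  Hence the
update multiplies the \<open>k\<close>-th moment by at most \<open>(1 + \<kappa>)\<^sup>k\<close> when \<open>\<kappa> \<ge> 0\<close> and \<open>T \<ge> 1\<close>, and by at least
\<open>(1 - c / t\<^sub>0)\<^sup>k\<close> when \<open>\<kappa> = - c\<close> and \<open>T \<ge> t\<^sub>0 \<ge> c \<ge> 0\<close>.  The same decomposition shows that the trace of a power is monotone
in the samples, so the mean trace obeys a scalar recursion in \<open>p\<close>.  Its solution has the form of
the Chernoff bound, and Markov's inequality finishes the argument.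

For the upper bound the identity is subtracted from \<open>T\<^sup>p\<close>.  The trace of the mean then takes
the place of the dimension \<open>|I\<^sub>M\<^sub>Z - I|\<close>, which may be arbitrarily large; divided by the bound
on \<open>|v|\<^sup>2\<close> it is of order \<open>n \<le> |I|\<^sup>r\<close>, which is where the factor \<open>r\<close> in the error bound comes from.
\<close>

section \<open>Moments of a positive operator under a rank-one update\<close>

definition lin :: "(('i \<Rightarrow> complex) \<Rightarrow> 'i \<Rightarrow> complex) \<Rightarrow> bool" where
  "lin T \<longleftrightarrow> (\<forall>u v c. T (\<lambda>k. u k + c * v k) = (\<lambda>k. T u k + c * T v k))"

lemma linD: "lin T \<Longrightarrow> T (\<lambda>k. u k + c * v k) = (\<lambda>k. T u k + c * T v k)"
  by (simp add: lin_def)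

lemma lin_funpow: "lin T \<Longrightarrow> lin (T ^^ n)"
  by (induction n) (auto simp: lin_def)

lemma lin_zero: assumes "lin T" shows "T (\<lambda>k. 0) = (\<lambda>k. 0)"
  using linD[OF assms, of "\<lambda>k. 0" "-1" "\<lambda>k. 0"] by (simp add: fun_eq_iff)

lemma lin_scale: assumes "lin T" shows "T (\<lambda>k. c * v k) = (\<lambda>k. c * T v k)"
  using linD[OF assms, of "\<lambda>k. 0" c v] lin_zero[OF assms] by simp

lemma lin_add: "lin T \<Longrightarrow> T (\<lambda>k. u k + v k) = (\<lambda>k. T u k + T v k)"
  using linD[of T u 1 v] by simp

lemma lin_sum:
  assumes "lin T"
  shows "T (\<lambda>k. \<Sum>x\<in>F. c x * w x k) = (\<lambda>k. \<Sum>x\<in>F. c x * T (w x) k)"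
proof (induction F rule: infinite_finite_induct)
  case (insert x F)
  have "T (\<lambda>k. (\<Sum>x\<in>F. c x * w x k) + c x * w x k)
      = (\<lambda>k. T (\<lambda>k. \<Sum>x\<in>F. c x * w x k) k + c x * T (w x) k)"
    by (rule linD[OF assms])
  then show ?case using insert by (simp add: add.commute)
qed (simp_all add: lin_zero[OF assms])

definition unit_vec_fun :: "'i \<Rightarrow> 'i \<Rightarrow> complex" where
  "unit_vec_fun k = (\<lambda>i. if i = k then 1 else 0)"

locale coordinates =
  fixes I :: "'i set"
  assumes finite_I: "finite I"
begin

definition dot :: "('i \<Rightarrow> complex) \<Rightarrow> ('i \<Rightarrow> complex) \<Rightarrow> complex" where
  "dot u v = (\<Sum>k\<in>I. u k * cnj (v k))"

definition sqn :: "('i \<Rightarrow> complex) \<Rightarrow> real" where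
  "sqn u = (\<Sum>k\<in>I. (cmod (u k))\<^sup>2)"

lemma dot_add: "dot (\<lambda>k. u k + v k) w = dot u w + dot v w"
  by (simp add: dot_def distrib_right sum.distrib)

lemma dot_diff: "dot (\<lambda>k. u k - v k) w = dot u w - dot v w"
  by (simp add: dot_def left_diff_distrib sum_subtractf)

lemma dot_scale: "dot (\<lambda>k. c * u k) w = c * dot u w"
  by (simp add: dot_def sum_distrib_left mult.assoc)

lemma dot_scale_right: "dot w (\<lambda>k. c * u k) = cnj c * dot w u"
  by (simp add: dot_def sum_distrib_left mult_ac)

lemma dot_sum: "dot (\<lambda>k. \<Sum>x\<in>F. c x * w x k) v = (\<Sum>x\<in>F. c x * dot (w x) v)"
  by (simp add: dot_def sum_distrib_left sum_distrib_right mult.assoc)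
     (rule sum.swap)

lemma cnj_dot: "cnj (dot u v) = dot v u"
  by (simp add: dot_def mult.commute)

lemma dot_sum_right: "dot v (\<lambda>k. \<Sum>x\<in>F. c x * w x k) = (\<Sum>x\<in>F. cnj (c x) * dot v (w x))"
  by (subst cnj_dot[symmetric]) (simp add: dot_sum cnj_dot)

lemma dot_self: "dot u u = of_real (sqn u)"
  by (simp add: dot_def sqn_def complex_norm_square[symmetric])

lemma sqn_nonneg [simp]: "0 \<le> sqn u"
  by (simp add: sqn_def sum_nonneg)

lemma dot_self_nonneg: "0 \<le> dot u u"
  by (simp add: dot_self less_eq_complex_def)

lemma cmod_dot_commute: "cmod (dot u v) = cmod (dot v u)"
  by (metis cnj_dot complex_mod_cnj)

lemma dot_Cauchy_Schwarz: "(cmod (dot u v))\<^sup>2 \<le> sqn u * sqn v"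
proof -
  have "cmod (dot u v) \<le> (\<Sum>k\<in>I. cmod (u k) * cmod (v k))"
    unfolding dot_def by (rule order_trans[OF norm_sum]) (simp add: norm_mult)
  then have "(cmod (dot u v))\<^sup>2 \<le> (\<Sum>k\<in>I. cmod (u k) * cmod (v k))\<^sup>2"
    by (rule power_mono) simp
  also have "\<dots> \<le> sqn u * sqn v"
    unfolding sqn_def by (rule Cauchy_Schwarz_ineq_sum)
  finally show ?thesis .
qed

lemma dot_unit_vec: "k \<in> I \<Longrightarrow> dot u (unit_vec_fun k) = u k"
  by (simp add: dot_def unit_vec_fun_def if_distrib finite_I sum.delta cong: if_cong)

lemma dot_unit_vec_left: "k \<in> I \<Longrightarrow> dot (unit_vec_fun k) u = cnj (u k)"
  using dot_unit_vec[of k u] cnj_dot by metis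

lemma dot_unit_vec_self:
  assumes "k \<in> I"
  shows "dot (unit_vec_fun k) (unit_vec_fun k) = 1"
  using dot_unit_vec[OF assms, of "unit_vec_fun k"] by (simp add: unit_vec_fun_def)

lemma Parseval: "(\<Sum>k\<in>I. dot u (unit_vec_fun k) * dot (unit_vec_fun k) v) = dot u v"
  by (simp add: dot_unit_vec dot_unit_vec_left) (simp add: dot_def)

definition herm :: "(('i \<Rightarrow> complex) \<Rightarrow> 'i \<Rightarrow> complex) \<Rightarrow> bool" where
  "herm T \<longleftrightarrow> lin T \<and> (\<forall>u v. dot (T u) v = dot u (T v))"

lemma herm_lin: "herm T \<Longrightarrow> lin T" and herm_swap: "herm T \<Longrightarrow> dot (T u) v = dot u (T v)"
  by (auto simp: herm_def)

lemma herm_funpow_swap: "herm T \<Longrightarrow> dot ((T ^^ n) u) v = dot u ((T ^^ n) v)"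
  by (induction n arbitrary: u v) (auto simp: herm_def funpow_swap1)

lemma herm_funpow: "herm T \<Longrightarrow> herm (T ^^ n)"
  by (simp add: herm_def lin_funpow) (use herm_funpow_swap herm_def in blast)

definition trace_of :: "(('i \<Rightarrow> complex) \<Rightarrow> 'i \<Rightarrow> complex) \<Rightarrow> real" where
  "trace_of T = (\<Sum>k\<in>I. Re (dot (T (unit_vec_fun k)) (unit_vec_fun k)))"

text \<open>
With \<open>Q = 1 - e e\<^sup>*\<close> this is \<open>Q T\<close>: apply \<open>T\<close>, then delete the component along \<open>e\<close>.  Its powers
describe paths that do not come back to \<open>e\<close>.
\<close>

definition compress where
  "compress e T u = (\<lambda>k. T u k - dot (T u) e * e k)"

definition moment where
  "moment T e k = dot ((T ^^ k) e) e"

text \<open>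
The coefficient for a return to \<open>e\<close> after \<open>k + 1\<close> applications of \<open>T\<close> without an earlier visit.
\<close>

definition first_return where
  "first_return T e k = dot (T ((compress e T ^^ k) e)) e"

lemma lin_compress: "lin T \<Longrightarrow> lin (compress e T)"
  unfolding lin_def compress_def
  by (simp add: dot_add dot_scale) (simp add: fun_eq_iff algebra_simps)

text \<open>
The power is sorted by the last step \<open>i\<close> at which the component along \<open>e\<close> was kept; from then on
only \<open>compress e T\<close> acts.
\<close>

lemma funpow_last_visit:
  assumes "lin T" "dot e e = 1"
  shows "(T ^^ k) e = (\<lambda>x. \<Sum>i\<le>k. moment T e i * (compress e T ^^ (k - i)) e x)"
proof (induction k)
  case 0
  then show ?case by (simp add: moment_def assms)
next
  case (Suc k)
  let ?Q = "compress e T"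
  have "(T ^^ Suc k) e = (\<lambda>x. ?Q ((T ^^ k) e) x + moment T e (Suc k) * e x)"
    by (simp add: compress_def moment_def)
  also have "?Q ((T ^^ k) e) = (\<lambda>x. \<Sum>i\<le>k. moment T e i * (?Q ^^ (Suc k - i)) e x)"
    by (subst Suc.IH, subst lin_sum[OF lin_compress[OF assms(1)]])
       (auto simp: fun_eq_iff Suc_diff_le intro!: sum.cong)
  finally show ?case by simp
qed

lemma moment_renewal:
  assumes "lin T" "dot e e = 1"
  shows "moment T e (Suc k) = (\<Sum>i\<le>k. moment T e i * first_return T e (k - i))"
proof -
  have "moment T e (Suc k) = dot (T ((T ^^ k) e)) e" by (simp add: moment_def)
  also have "\<dots> = (\<Sum>i\<le>k. moment T e i * first_return T e (k - i))"
    by (subst funpow_last_visit[OF assms])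
       (simp add: lin_sum[OF assms(1)] dot_sum first_return_def)
  finally show ?thesis .
qed

lemma compress_orthogonal: "dot e e = 1 \<Longrightarrow> dot (compress e T u) e = 0"
  by (simp add: compress_def dot_diff dot_scale)

lemma dot_compress:
  "dot w e = 0 \<Longrightarrow> dot (compress e T u) w = dot (T u) w"
  using cnj_dot[of w e] by (simp add: compress_def dot_diff dot_scale)

text \<open>
Both vectors are orthogonal to \<open>e\<close>, and there the compression of a Hermitian operator is
Hermitian, so one factor can be moved across the inner product.
\<close>

lemma dot_compress_shift:
  assumes "herm T" "dot e e = 1"
  shows "dot ((compress e T ^^ Suc (Suc a)) e) ((compress e T ^^ Suc b) e)
       = dot ((compress e T ^^ Suc a) e) ((compress e T ^^ Suc (Suc b)) e)"
proof -
  let ?Q = "compress e T"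
  define p q where "p = (?Q ^^ Suc a) e" and "q = (?Q ^^ Suc b) e"
  have o: "dot p e = 0" "dot q e = 0"
    unfolding p_def q_def by (simp_all add: compress_orthogonal assms)
  have "dot (?Q p) q = dot (T p) q" using o by (simp add: dot_compress)
  also have "\<dots> = dot p (T q)" using assms(1) by (rule herm_swap)
  also have "\<dots> = cnj (dot (T q) p)" by (simp add: cnj_dot)
  also have "\<dots> = cnj (dot (?Q q) p)" using o by (simp add: dot_compress)
  also have "\<dots> = dot p (?Q q)" by (simp add: cnj_dot)
  finally show ?thesis by (simp add: p_def q_def)
qed

text \<open>
Shifting factors across until the exponents differ by at most one leaves either \<open>\<langle>z, z\<rangle>\<close> or
\<open>\<langle>T z, z\<rangle>\<close>.
\<close>

lemma dot_compress_powers_nonneg: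
  assumes "herm T" "\<And>u. 0 \<le> dot (T u) u" "dot e e = 1"
  shows "0 \<le> dot ((compress e T ^^ a) e) ((compress e T ^^ b) e)"
proof -
  let ?z = "\<lambda>a. (compress e T ^^ a) e"
  have *: "0 \<le> dot (?z (Suc (b + d))) (?z (Suc b))" for b d
  proof (induction d arbitrary: b rule: less_induct)
    case (less d)
    consider "d = 0" | "d = 1" | d' where "d = Suc (Suc d')"
      by (metis One_nat_def not0_implies_Suc)
    then show ?case
    proof cases
      case 1 then show ?thesis using dot_self_nonneg by simp
    next
      case 2
      have "dot (?z (Suc (b + 1))) (?z (Suc b)) = dot (T (?z (Suc b))) (?z (Suc b))"
        using assms(3) by (simp add: dot_compress compress_orthogonal)
      then show ?thesis using 2 assms(2) by simp
    next
      case 3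
      have "dot (?z (Suc (b + d))) (?z (Suc b)) = dot (?z (Suc (Suc b + d'))) (?z (Suc (Suc b)))"
        using dot_compress_shift[OF assms(1,3), of "Suc (b + d')" b] 3 by simp
      then show ?thesis using less(1)[of d' "Suc b"] 3 by simp
    qed
  qed
  have sym: "0 \<le> dot u v \<Longrightarrow> 0 \<le> dot v u" for u v
    by (subst cnj_dot[symmetric]) (simp add: less_eq_complex_def)
  show ?thesis
  proof (cases a; cases b)
    fix a' b' assume ab: "a = Suc a'" "b = Suc b'"
    show ?thesis
    proof (cases "b' \<le> a'")
      case True then show ?thesis using *[of b' "a' - b'"] ab by simp
    next
      case False then show ?thesis using sym[OF *[of a' "b' - a'"]] ab by simp
    qed
  next
    fix b' assume "a = 0" "b = Suc b'"
    then show ?thesis using compress_orthogonal[OF assms(3), of T "?z b'"] cnj_dot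
      by (metis complex_cnj_zero comp_apply funpow.simps(1,2) id_apply order_refl)
  next
    fix a' assume "a = Suc a'" "b = 0"
    then show ?thesis using compress_orthogonal[OF assms(3), of T "?z a'"] by simp
  qed (simp add: dot_self_nonneg)
qed

lemma first_return_nonneg:
  assumes "herm T" "\<And>u. 0 \<le> dot (T u) u" "dot e e = 1"
  shows "0 \<le> first_return T e k"
proof (cases k)
  case 0 then show ?thesis using assms(2) by (simp add: first_return_def)
next
  case (Suc k')
  let ?z = "(compress e T ^^ k) e"
  have o: "dot ?z e = 0" using Suc by (simp add: compress_orthogonal assms(3))
  have "first_return T e k = dot ?z (T e)"
    using herm_swap[OF assms(1)] by (simp add: first_return_def)
  also have "\<dots> = cnj (dot (T e) ?z)" by (simp add: cnj_dot)
  also have "\<dots> = cnj (dot (compress e T e) ?z)" using o by (simp add: dot_compress)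
  also have "\<dots> = dot ?z ((compress e T ^^ 1) e)" by (simp add: cnj_dot)
  finally show ?thesis using dot_compress_powers_nonneg[OF assms, of k 1] by simp
qed

lemma moment_nonneg:
  assumes "herm T" "\<And>u. 0 \<le> dot (T u) u" "dot e e = 1"
  shows "0 \<le> moment T e k"
proof (induction k rule: less_induct)
  case (less k)
  show ?case
  proof (cases k)
    case 0 then show ?thesis using assms(3) by (simp add: moment_def less_eq_complex_def)
  next
    case (Suc j)
    then show ?thesis
      using less first_return_nonneg[OF assms] herm_lin[OF assms(1)]
      by (auto simp: moment_renewal assms(3) intro!: sum_nonneg mult_nonneg_nonneg)
  qed
qed

text \<open>
A form of Jensen's inequality: in the renewal equation keep only the path that returns in every
step.
\<close>

lemma moment_ge_power:
  assumes "herm T" "\<And>u. 0 \<le> dot (T u) u" "dot e e = 1"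
  shows "(Re (dot (T e) e)) ^ k \<le> Re (moment T e k)"
proof (induction k)
  case 0 then show ?case using assms(3) by (simp add: moment_def)
next
  case (Suc k)
  let ?a = "dot (T e) e"
  have a: "0 \<le> Re ?a" "Im ?a = 0" using assms(2)[of e] by (auto simp: less_eq_complex_def)
  have m: "0 \<le> Re (moment T e i)" "Im (moment T e i) = 0" for i
    using moment_nonneg[OF assms, of i] by (auto simp: less_eq_complex_def)
  have "moment T e k * first_return T e (k - k) \<le> (\<Sum>i\<le>k. moment T e i * first_return T e (k - i))"
    by (rule member_le_sum)
       (auto intro!: mult_nonneg_nonneg moment_nonneg[OF assms] first_return_nonneg[OF assms])
  then have "moment T e k * ?a \<le> moment T e (Suc k)"
    using moment_renewal[OF herm_lin[OF assms(1)] assms(3), of k] by (simp add: first_return_def)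
  then have "Re (moment T e k) * Re ?a \<le> Re (moment T e (Suc k))"
    using a m by (simp add: less_eq_complex_def)
  moreover have "Re ?a ^ k * Re ?a \<le> Re (moment T e k) * Re ?a"
    using Suc a by (intro mult_right_mono) auto
  ultimately show ?case by (simp add: mult.commute)
qed

definition rank_one_update where
  "rank_one_update \<kappa> e T u = (\<lambda>k. T u k + complex_of_real \<kappa> * dot u e * e k)"

text \<open>
The update adds a multiple of \<open>e\<close>, which the compression deletes.  All excursions away from \<open>e\<close>
are therefore unchanged.
\<close>

lemma compress_rank_one_update:
  assumes "dot e e = 1"
  shows "compress e (rank_one_update \<kappa> e T) = compress e T"
  unfolding compress_def rank_one_update_def dot_add dot_scale
  by (simp add: assms algebra_simps)

lemma herm_rank_one_update:
  assumes "herm T"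
  shows "herm (rank_one_update \<kappa> e T)"
proof -
  have "lin (rank_one_update \<kappa> e T)"
    using herm_lin[OF assms] unfolding lin_def rank_one_update_def
    by (auto simp: dot_add dot_scale algebra_simps fun_eq_iff)
  moreover have "dot (rank_one_update \<kappa> e T u) v = dot u (rank_one_update \<kappa> e T v)" for u v
  proof -
    have "dot u (\<lambda>k. complex_of_real \<kappa> * dot v e * e k) = cnj (complex_of_real \<kappa> * dot v e) * dot u e"
      by (rule dot_scale_right)
    moreover have "dot u (\<lambda>k. T v k + w k) = dot u (T v) + dot u w" for w
      by (metis cnj_dot complex_cnj_add dot_add)
    ultimately show ?thesis using herm_swap[OF assms, of u v]
      by (simp add: rank_one_update_def dot_add dot_scale cnj_dot)
  qed
  ultimately show ?thesis by (simp add: herm_def)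
qed

lemma first_return_rank_one_update:
  assumes "dot e e = 1"
  shows "first_return (rank_one_update \<kappa> e T) e k
       = first_return T e k + (if k = 0 then complex_of_real \<kappa> else 0)"
  using assms unfolding first_return_def compress_rank_one_update[OF assms]
  by (cases k) (simp_all add: rank_one_update_def dot_add dot_scale compress_orthogonal)

text \<open>
Replacing the factors one by one telescopes the difference of the traces into terms
\<open>\<kappa> \<langle>U\<^sup>i e, T\<^sup>j e\<rangle>\<close>, where \<open>U\<close> is the updated operator.  Both vectors have last-visit expansions in
the same vectors with nonnegative coefficients, so these inner products are nonnegative.
\<close>

lemma trace_rank_one_update:
  assumes T: "herm T" "\<And>u. 0 \<le> dot (T u) u" and e: "dot e e = 1"
      and T': "\<And>u. 0 \<le> dot (rank_one_update \<kappa> e T u) u"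
  shows "\<exists>d\<ge>0. trace_of (rank_one_update \<kappa> e T ^^ p) - trace_of (T ^^ p) = \<kappa> * d"
proof -
  let ?U = "rank_one_update \<kappa> e T"
  have U: "herm ?U" by (rule herm_rank_one_update[OF T(1)])
  have cross: "0 \<le> dot ((?U ^^ i) e) ((T ^^ j) e)" for i j
  proof -
    have "dot ((?U ^^ i) e) ((T ^^ j) e)
      = (\<Sum>a\<le>i. moment ?U e a * (\<Sum>b\<le>j. cnj (moment T e b) *
           dot ((compress e T ^^ (i - a)) e) ((compress e T ^^ (j - b)) e)))"
      by (subst funpow_last_visit[OF herm_lin[OF U] e], subst funpow_last_visit[OF herm_lin[OF T(1)] e])
         (simp add: dot_sum dot_sum_right compress_rank_one_update[OF e])
    moreover have "0 \<le> cnj (moment T e b)" for b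
      using moment_nonneg[OF T e] by (simp add: less_eq_complex_def)
    ultimately show ?thesis
      by (auto intro!: sum_nonneg mult_nonneg_nonneg moment_nonneg[OF U T' e]
            dot_compress_powers_nonneg[OF T e])
  qed
  have "\<exists>d\<ge>0. trace_of ((?U ^^ q) \<circ> (T ^^ r)) - trace_of (T ^^ (q + r)) = \<kappa> * d" for q r
  proof (induction q arbitrary: r)
    case 0 then show ?case by (auto simp: comp_def intro: exI[of _ 0])
  next
    case (Suc q)
    let ?c = "Re (dot ((?U ^^ q) e) ((T ^^ r) e))"
    have "trace_of ((?U ^^ Suc q) \<circ> (T ^^ r)) - trace_of ((?U ^^ q) \<circ> (T ^^ Suc r)) = \<kappa> * ?c"
    proof -
      have 1: "(?U ^^ Suc q) ((T ^^ r) w) =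
         (\<lambda>k. (?U ^^ q) ((T ^^ Suc r) w) k + (complex_of_real \<kappa> * dot w ((T ^^ r) e)) * (?U ^^ q) e k)" for w
      proof -
        have "(?U ^^ Suc q) ((T ^^ r) w) = (?U ^^ q) (?U ((T ^^ r) w))" by (simp add: funpow_swap1)
        \<comment> \<open>moving \<open>T ^^ r\<close> to the other side of the inner product exposes the rank-one difference\<close>
      also have "?U ((T ^^ r) w) = (\<lambda>k. (T ^^ Suc r) w k + (complex_of_real \<kappa> * dot w ((T ^^ r) e)) * e k)"
          using herm_funpow_swap[OF T(1), of r w e] by (simp add: rank_one_update_def)
        finally show ?thesis using linD[OF lin_funpow[OF herm_lin[OF U]]] by simp
      qed
      have "trace_of ((?U ^^ Suc q) \<circ> (T ^^ r)) - trace_of ((?U ^^ q) \<circ> (T ^^ Suc r))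
         = (\<Sum>k\<in>I. Re (complex_of_real \<kappa> * (dot ((?U ^^ q) e) (unit_vec_fun k) * dot (unit_vec_fun k) ((T ^^ r) e))))"
        unfolding trace_of_def sum_subtractf[symmetric] o_apply 1
        by (rule sum.cong) (simp_all add: dot_add dot_scale mult_ac)
      also have "\<dots> = Re (complex_of_real \<kappa> * (\<Sum>k\<in>I. dot ((?U ^^ q) e) (unit_vec_fun k) * dot (unit_vec_fun k) ((T ^^ r) e)))"
        by (simp only: sum_distrib_left Re_sum)
      also have "\<dots> = \<kappa> * ?c" by (simp add: Parseval)
      finally show ?thesis .
    qed
    moreover obtain d where "d \<ge> 0" "trace_of ((?U ^^ q) \<circ> (T ^^ Suc r)) - trace_of (T ^^ (q + Suc r)) = \<kappa> * d"
      using Suc by blast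
    moreover have "0 \<le> ?c" using cross[of q r] by (simp add: less_eq_complex_def)
    ultimately show ?case by (intro exI[of _ "?c + d"]) (simp add: algebra_simps comp_def)
  qed
  from this[of p 0] show ?thesis by (simp add: comp_def)
qed

end

text \<open>
Each step of a renewal path of lag zero costs at most a factor \<open>1 + \<kappa>\<close>, because \<open>\<phi> 0 \<ge> 1\<close>, and a
path of total length \<open>k\<close> has at most \<open>k\<close> steps.
\<close>

lemma renewal_comparison_upper:
  fixes u h \<phi> :: "nat \<Rightarrow> real"
  assumes "u 0 = 1" "h 0 = 1" "\<And>k. 0 \<le> \<phi> k" "1 \<le> \<phi> 0" "0 \<le> \<kappa>" 
    and u: "\<And>k. u (Suc k) = (\<Sum>i\<le>k. u i * \<phi> (k - i))"
    and h: "\<And>k. h (Suc k) = (\<Sum>i\<le>k. h i * (\<phi> (k - i) + (if k - i = 0 then \<kappa> else 0)))"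
    and "\<And>k. 0 \<le> u k"
  shows "h k \<le> (1 + \<kappa>) ^ k * u k"
proof (induction k rule: less_induct)
  case (less k)
  show ?case
  proof (cases k)
    case 0 then show ?thesis using assms by simp
  next
    case (Suc j)
    have "h i * (\<phi> (j - i) + (if j - i = 0 then \<kappa> else 0)) \<le> (1 + \<kappa>) ^ Suc j * (u i * \<phi> (j - i))"
      if "i \<le> j" for i
    proof -
      have "\<phi> (j - i) + (if j - i = 0 then \<kappa> else 0) \<le> (1 + \<kappa>) ^ (if i = j then 1 else 0) * \<phi> (j - i)"
        using that assms(4,5) mult_left_mono[of 1 "\<phi> 0" \<kappa>] by (auto simp: algebra_simps)
      then have "h i * (\<phi> (j - i) + (if j - i = 0 then \<kappa> else 0))
            \<le> ((1 + \<kappa>) ^ i * u i) * ((1 + \<kappa>) ^ (if i = j then 1 else 0) * \<phi> (j - i))"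
        using less[of i] that Suc assms(3,5,8)
        by (intro mult_mono) (auto intro!: mult_nonneg_nonneg add_nonneg_nonneg)
      also have "\<dots> = (1 + \<kappa>) ^ (i + (if i = j then 1 else 0)) * (u i * \<phi> (j - i))"
        by (simp add: power_add mult_ac)
      also have "\<dots> \<le> (1 + \<kappa>) ^ Suc j * (u i * \<phi> (j - i))"
        using that assms(3,5,8) by (intro mult_right_mono power_increasing) auto
      finally show ?thesis .
    qed
    then have "h (Suc j) \<le> (\<Sum>i\<le>j. (1 + \<kappa>) ^ Suc j * (u i * \<phi> (j - i)))"
      unfolding h by (intro sum_mono) auto
    then show ?thesis using Suc by (simp add: u sum_distrib_left)
  qed
qed

lemma renewal_comparison_lower:
  fixes u h \<phi> :: "nat \<Rightarrow> real"
  assumes "u 0 = 1" "h 0 = 1" "\<And>k. 0 \<le> \<phi> k" "\<rho> * \<phi> 0 \<le> \<phi> 0 - c" "0 \<le> \<rho>" "\<rho> \<le> 1"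
    and u: "\<And>k. u (Suc k) = (\<Sum>i\<le>k. u i * \<phi> (k - i))"
    and h: "\<And>k. h (Suc k) = (\<Sum>i\<le>k. h i * (\<phi> (k - i) + (if k - i = 0 then - c else 0)))"
    and "\<And>k. 0 \<le> u k"
  shows "\<rho> ^ k * u k \<le> h k"
proof (induction k rule: less_induct)
  case (less k)
  show ?case
  proof (cases k)
    case 0 then show ?thesis using assms by simp
  next
    case (Suc j)
    have "\<rho> ^ Suc j * (u i * \<phi> (j - i)) \<le> h i * (\<phi> (j - i) + (if j - i = 0 then - c else 0))"
      if "i \<le> j" for i
    proof -
      have "\<rho> ^ Suc j * (u i * \<phi> (j - i)) \<le> \<rho> ^ (i + (if i = j then 1 else 0)) * (u i * \<phi> (j - i))"
        using that assms(3,5,6,9) by (intro mult_right_mono power_decreasing) auto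
      also have "\<dots> = (\<rho> ^ i * u i) * (\<rho> ^ (if i = j then 1 else 0) * \<phi> (j - i))"
        by (simp add: power_add mult_ac)
      also have "\<dots> \<le> h i * (\<phi> (j - i) + (if j - i = 0 then - c else 0))"
      proof (rule mult_mono)
        show "\<rho> ^ i * u i \<le> h i" using less[of i] that Suc by simp
        then show "0 \<le> h i" using assms(5,9) by (meson mult_nonneg_nonneg order_trans zero_le_power)
        show "\<rho> ^ (if i = j then 1 else 0) * \<phi> (j - i) \<le> \<phi> (j - i) + (if j - i = 0 then - c else 0)"
          using that assms(4) by auto
        show "0 \<le> \<rho> ^ (if i = j then 1 else 0) * \<phi> (j - i)"
          using assms(3,5) by simp
      qed
      finally show ?thesis .
    qed
    then have "(\<Sum>i\<le>j. \<rho> ^ Suc j * (u i * \<phi> (j - i))) \<le> h (Suc j)"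
      unfolding h by (intro sum_mono) auto
    then show ?thesis using Suc by (simp add: u sum_distrib_left)
  qed
qed

section \<open>Identity plus or minus a sum of rank-one operators\<close>

context coordinates
begin

definition rank_one_total :: "'l set \<Rightarrow> ('l \<Rightarrow> 'i \<Rightarrow> complex) \<Rightarrow> ('i \<Rightarrow> complex) \<Rightarrow> 'i \<Rightarrow> complex" where
  "rank_one_total F v u = (\<lambda>k. \<Sum>l\<in>F. dot u (v l) * v l k)"

definition perturbed_id :: "real \<Rightarrow> 'l set \<Rightarrow> ('l \<Rightarrow> 'i \<Rightarrow> complex) \<Rightarrow> ('i \<Rightarrow> complex) \<Rightarrow> 'i \<Rightarrow> complex" where
  "perturbed_id \<sigma> F v u = (\<lambda>k. u k + complex_of_real \<sigma> * rank_one_total F v u k)"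

lemma dot_rank_one_total: "dot (rank_one_total F v u) w = (\<Sum>l\<in>F. dot u (v l) * dot (v l) w)"
  unfolding rank_one_total_def by (rule dot_sum)

lemma dot_rank_one_total_self:
  "dot (rank_one_total F v u) u = of_real (\<Sum>l\<in>F. (cmod (dot u (v l)))\<^sup>2)"
proof -
  have "dot u (v l) * dot (v l) u = of_real ((cmod (dot u (v l)))\<^sup>2)" for l
    using complex_norm_square[of "dot u (v l)"] by (simp add: cnj_dot)
  then show ?thesis by (simp add: dot_rank_one_total)
qed

lemma herm_rank_one_total: "herm (rank_one_total F v)"
proof -
  have "lin (rank_one_total F v)"
    unfolding lin_def rank_one_total_def dot_add dot_scale
    by (simp add: distrib_right sum.distrib sum_distrib_left mult.assoc)
  moreover have "dot (rank_one_total F v u) w = dot u (rank_one_total F v w)" for u w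
  proof -
    have "dot u (rank_one_total F v w) = cnj (dot (rank_one_total F v w) u)" by (simp add: cnj_dot)
    also have "\<dots> = dot (rank_one_total F v u) w" 
      by (simp add: dot_rank_one_total cnj_dot mult.commute)
    finally show ?thesis by simp
  qed
  ultimately show ?thesis by (simp add: herm_def)
qed

lemma herm_perturbed_id: "herm (perturbed_id \<sigma> F v)"
proof -
  let ?S = "rank_one_total F v"
  have "lin (perturbed_id \<sigma> F v)"
    unfolding lin_def perturbed_id_def linD[OF herm_lin[OF herm_rank_one_total]]
    by (simp add: algebra_simps)
  moreover have "dot (perturbed_id \<sigma> F v u) w = dot u (perturbed_id \<sigma> F v w)" for u w
  proof -
    have "dot u (perturbed_id \<sigma> F v w) = cnj (dot (perturbed_id \<sigma> F v w) u)" by (simp add: cnj_dot)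
    also have "\<dots> = dot u w + complex_of_real \<sigma> * dot u (?S w)"
      unfolding perturbed_id_def dot_add dot_scale by (simp add: cnj_dot)
    also have "\<dots> = dot (perturbed_id \<sigma> F v u) w"
      unfolding perturbed_id_def dot_add dot_scale herm_swap[OF herm_rank_one_total] by simp
    finally show ?thesis by simp
  qed
  ultimately show ?thesis by (simp add: herm_def)
qed

lemma dot_perturbed_id_self:
  "dot (perturbed_id \<sigma> F v u) u = of_real (sqn u + \<sigma> * (\<Sum>l\<in>F. (cmod (dot u (v l)))\<^sup>2))"
  unfolding perturbed_id_def dot_add dot_scale dot_rank_one_total_self dot_self by simp

lemma sum_dot_sq_le: "(\<Sum>l\<in>F. (cmod (dot u (v l)))\<^sup>2) \<le> (\<Sum>l\<in>F. sqn (v l)) * sqn u"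
  unfolding sum_distrib_right by (rule sum_mono) (metis dot_Cauchy_Schwarz mult.commute)

lemma perturbed_id_cong:
  "(\<And>l. l \<in> F \<Longrightarrow> v l = w l) \<Longrightarrow> perturbed_id \<sigma> F v = perturbed_id \<sigma> F w"
  by (rule ext) (simp add: perturbed_id_def rank_one_total_def)

text \<open>
A sample vector of norm zero need not vanish outside the index set, but it has no effect.
\<close>

lemma perturbed_id_insert_null:
  assumes "finite F" "l \<notin> F" "sqn (v l) = 0"
  shows "perturbed_id \<sigma> (insert l F) v = perturbed_id \<sigma> F v"
proof -
  have "dot u (v l) = 0" for u
    using dot_Cauchy_Schwarz[of u "v l"] assms(3) by simp
  then show ?thesis
    using assms by (intro ext) (simp add: perturbed_id_def rank_one_total_def)
qed

definition direction :: "('i \<Rightarrow> complex) \<Rightarrow> 'i \<Rightarrow> complex" where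
  "direction w = (\<lambda>k. complex_of_real (1 / sqrt (sqn w)) * w k)"

lemma inverse_sqrt_square:
  "0 < x \<Longrightarrow> complex_of_real (1 / sqrt x) * complex_of_real (1 / sqrt x) = complex_of_real (1 / x)"
  by (simp flip: of_real_mult)

lemma direction_normalized:
  assumes "sqn w \<noteq> 0"
  shows "dot (direction w) (direction w) = 1"
proof -
  have p: "0 < sqn w" using assms sqn_nonneg[of w] by linarith
  show ?thesis
    unfolding direction_def dot_scale dot_scale_right dot_self complex_cnj_complex_of_real
      mult.assoc[symmetric] inverse_sqrt_square[OF p]
    using p by (simp flip: of_real_mult)
qed

lemma perturbed_id_insert:
  assumes "finite F" "l \<notin> F" "sqn (v l) \<noteq> 0"
  shows "perturbed_id \<sigma> (insert l F) v
       = rank_one_update (\<sigma> * sqn (v l)) (direction (v l)) (perturbed_id \<sigma> F v)"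
proof (intro ext)
  fix u k
  have p: "0 < sqn (v l)" using assms sqn_nonneg[of "v l"] by linarith
  let ?c = "complex_of_real (1 / sqrt (sqn (v l)))"
  have "complex_of_real (\<sigma> * sqn (v l)) * dot u (direction (v l)) * direction (v l) k
     = complex_of_real (\<sigma> * sqn (v l)) * (?c * ?c) * (dot u (v l) * v l k)"
    unfolding direction_def dot_scale_right complex_cnj_complex_of_real by (simp only: mult_ac)
  also have "\<dots> = complex_of_real \<sigma> * (dot u (v l) * v l k)"
    unfolding inverse_sqrt_square[OF p] of_real_mult[symmetric] using p by simp
  finally have eq: "complex_of_real (\<sigma> * sqn (v l)) * dot u (direction (v l)) * direction (v l) k
     = complex_of_real \<sigma> * (dot u (v l) * v l k)" .
  show "perturbed_id \<sigma> (insert l F) v u k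
       = rank_one_update (\<sigma> * sqn (v l)) (direction (v l)) (perturbed_id \<sigma> F v) u k"
    unfolding rank_one_update_def eq
    using assms by (simp add: perturbed_id_def rank_one_total_def distrib_left)
qed

lemma moment_direction:
  assumes "lin T"
  shows "Re (dot ((T ^^ p) w) w) = sqn w * Re (moment T (direction w) p)"
proof (cases "sqn w = 0")
  case True
  then show ?thesis using dot_Cauchy_Schwarz[of "(T ^^ p) w" w] by simp
next
  case False
  then have p: "0 < sqn w" using sqn_nonneg[of w] by linarith
  have "moment T (direction w) p = complex_of_real (1 / sqn w) * dot ((T ^^ p) w) w"
    unfolding moment_def direction_def lin_scale[OF lin_funpow[OF assms]] dot_scale dot_scale_right
      complex_cnj_complex_of_real mult.assoc[symmetric] inverse_sqrt_square[OF p] ..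
  then have "Re (moment T (direction w) p) = 1 / sqn w * Re (dot ((T ^^ p) w) w)" by simp
  then show ?thesis using p by simp
qed

lemma nonneg_of_ge: "complex_of_real a \<le> z \<Longrightarrow> 0 \<le> a \<Longrightarrow> 0 \<le> z"
  by (auto simp: less_eq_complex_def)

lemma real_renewal:
  assumes "herm T" "\<And>u. 0 \<le> dot (T u) u" "dot e e = 1"
  shows "Re (moment T e (Suc k)) = (\<Sum>i\<le>k. Re (moment T e i) * Re (first_return T e (k - i)))"
  using moment_nonneg[OF assms] 
  by (simp add: moment_renewal[OF herm_lin[OF assms(1)] assms(3)] less_eq_complex_def)

lemma rank_one_update_moment_upper:
  assumes T: "herm T" "\<And>u. complex_of_real (sqn u) \<le> dot (T u) u" and e: "dot e e = 1"
    and "0 \<le> \<kappa>"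
  shows "Re (moment (rank_one_update \<kappa> e T) e k) \<le> (1 + \<kappa>) ^ k * Re (moment T e k)"
proof -
  let ?U = "rank_one_update \<kappa> e T"
  have T0: "0 \<le> dot (T u) u" for u by (rule nonneg_of_ge[OF T(2) sqn_nonneg])
  have U: "herm ?U" by (rule herm_rank_one_update[OF T(1)])
  have "dot (?U u) u = dot (T u) u + of_real (\<kappa> * (cmod (dot u e))\<^sup>2)" for u
    using complex_norm_square[of "dot u e"]
    by (simp add: rank_one_update_def dot_add dot_scale cnj_dot mult.assoc)
  then have U0: "0 \<le> dot (?U u) u" for u
    using T0[of u] assms(4) by (simp add: less_eq_complex_def)
  have sqe: "sqn e = 1" using e by (simp add: dot_self)
  show ?thesis
  proof (rule renewal_comparison_upper[where \<phi> = "\<lambda>k. Re (first_return T e k)"])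
    show "1 \<le> Re (first_return T e 0)"
      using T(2)[of e] sqe by (simp add: first_return_def less_eq_complex_def)
    show "0 \<le> Re (first_return T e k)" for k
      using first_return_nonneg[OF T(1) T0 e] by (simp add: less_eq_complex_def)
    show "0 \<le> Re (moment T e k)" for k
      using moment_nonneg[OF T(1) T0 e] by (simp add: less_eq_complex_def)
    show "Re (moment ?U e (Suc k)) = (\<Sum>i\<le>k. Re (moment ?U e i) *
             (Re (first_return T e (k - i)) + (if k - i = 0 then \<kappa> else 0)))" for k
      unfolding real_renewal[OF U U0 e] first_return_rank_one_update[OF e]
      by (intro sum.cong) auto
  qed (use e assms(4) real_renewal[OF T(1) T0 e] in \<open>simp_all add: moment_def\<close>)
qed

text \<open>
The first-return coefficient of lag zero is \<open>\<langle>T e, e\<rangle> \<ge> t0\<close>; lowering it by at most \<open>c0\<close> therefore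
costs at most the factor \<open>1 - c0 / t0\<close>.
\<close>

lemma rank_one_update_moment_lower:
  assumes T: "herm T" "\<And>u. complex_of_real (t0 * sqn u) \<le> dot (T u) u" and e: "dot e e = 1"
    and U0: "\<And>u. 0 \<le> dot (rank_one_update (- c) e T u) u"
    and c: "0 \<le> c" "c \<le> c0" "c0 \<le> t0" "0 < t0"
  shows "(1 - c0 / t0) ^ k * Re (moment T e k) \<le> Re (moment (rank_one_update (- c) e T) e k)"
proof -
  let ?U = "rank_one_update (- c) e T"
  have T0: "0 \<le> dot (T u) u" for u 
    using nonneg_of_ge[OF T(2)[of u]] c(4) by simp
  have U: "herm ?U" by (rule herm_rank_one_update[OF T(1)])
  have sqe: "sqn e = 1" using e by (simp add: dot_self)
  show ?thesis
  proof (rule renewal_comparison_lower[where \<phi> = "\<lambda>k. Re (first_return T e k)" and c = c])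
    have "t0 \<le> Re (first_return T e 0)"
      using T(2)[of e] sqe by (simp add: first_return_def less_eq_complex_def)
    then have "c0 / t0 * t0 \<le> c0 / t0 * Re (first_return T e 0)"
      using c by (intro mult_left_mono) auto
    then show "(1 - c0 / t0) * Re (first_return T e 0) \<le> Re (first_return T e 0) - c"
      using c by (simp add: algebra_simps)
    show "0 \<le> Re (first_return T e k)" for k
      using first_return_nonneg[OF T(1) T0 e] by (simp add: less_eq_complex_def)
    show "0 \<le> Re (moment T e k)" for k
      using moment_nonneg[OF T(1) T0 e] by (simp add: less_eq_complex_def)
    show "Re (moment ?U e (Suc k)) = (\<Sum>i\<le>k. Re (moment ?U e i) *
             (Re (first_return T e (k - i)) + (if k - i = 0 then - c else 0)))" for k
      unfolding real_renewal[OF U U0 e] first_return_rank_one_update[OF e]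
      by (intro sum.cong) auto
  qed (use e c real_renewal[OF T(1) T0 e] in \<open>simp_all add: moment_def\<close>)
qed

lemma perturbed_id_plus_ge: "complex_of_real (sqn u) \<le> dot (perturbed_id 1 F v u) u"
  by (simp add: dot_perturbed_id_self less_eq_complex_def sum_nonneg)

lemma perturbed_id_minus_ge:
  assumes "(\<Sum>l\<in>F. sqn (v l)) \<le> 1 - t0"
  shows "complex_of_real (t0 * sqn u) \<le> dot (perturbed_id (- 1) F v u) u"
proof -
  have "(\<Sum>l\<in>F. (cmod (dot u (v l)))\<^sup>2) \<le> (1 - t0) * sqn u"
    using order_trans[OF sum_dot_sq_le mult_right_mono[OF assms sqn_nonneg]] .
  then show ?thesis by (simp add: dot_perturbed_id_self less_eq_complex_def algebra_simps)
qed

lemma added_sample_upper: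
  assumes "finite F" "l \<notin> F" "sqn (v l) \<le> c"
  shows "Re (dot ((perturbed_id 1 (insert l F) v ^^ p) (v l)) (v l))
       \<le> (1 + c) ^ p * Re (dot ((perturbed_id 1 F v ^^ p) (v l)) (v l))"
proof (cases "sqn (v l) = 0")
  case True
  then have "Re (dot w (v l)) = 0" for w using dot_Cauchy_Schwarz[of w "v l"] by simp
  then show ?thesis by simp
next
  case False
  let ?T = "perturbed_id 1 F v" and ?e = "direction (v l)"
  have T0: "0 \<le> dot (?T u) u" for u
    by (rule nonneg_of_ge[OF perturbed_id_plus_ge sqn_nonneg])
  have "Re (moment (perturbed_id 1 (insert l F) v) ?e p) \<le> (1 + sqn (v l)) ^ p * Re (moment ?T ?e p)"
    using rank_one_update_moment_upper[OF herm_perturbed_id perturbed_id_plus_ge direction_normalized[OF False],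
        of "sqn (v l)"] assms
    by (simp add: perturbed_id_insert[where v = v, OF assms(1,2) False])
  also have "\<dots> \<le> (1 + c) ^ p * Re (moment ?T ?e p)"
    using moment_nonneg[OF herm_perturbed_id T0 direction_normalized[OF False]] assms(3)
    by (intro mult_right_mono power_mono) (auto simp: less_eq_complex_def)
  finally show ?thesis
    unfolding moment_direction[OF herm_lin[OF herm_perturbed_id]]
    using mult_left_mono[OF _ sqn_nonneg[of "v l"]] by (simp add: mult.left_commute)
qed

lemma added_sample_lower:
  assumes "finite F" "l \<notin> F" "sqn (v l) \<le> c" "(\<Sum>i\<in>insert l F. sqn (v i)) \<le> 1 - t0" "0 < t0" "c \<le> t0"
  shows "(1 - c / t0) ^ p * Re (dot ((perturbed_id (- 1) F v ^^ p) (v l)) (v l))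
       \<le> Re (dot ((perturbed_id (- 1) (insert l F) v ^^ p) (v l)) (v l))"
proof (cases "sqn (v l) = 0")
  case True
  then have "Re (dot w (v l)) = 0" for w using dot_Cauchy_Schwarz[of w "v l"] by simp
  then show ?thesis by simp
next
  case False
  let ?T = "perturbed_id (- 1) F v" and ?e = "direction (v l)"
  have sum: "(\<Sum>i\<in>F. sqn (v i)) \<le> 1 - t0" 
  proof -
    have "(\<Sum>i\<in>insert l F. sqn (v i)) = sqn (v l) + (\<Sum>i\<in>F. sqn (v i))" using assms(1,2) by simp
    then show ?thesis using assms(4) sqn_nonneg[of "v l"] by linarith
  qed
  have "0 \<le> dot (perturbed_id (- 1) (insert l F) v u) u" for u
    using nonneg_of_ge[OF perturbed_id_minus_ge[OF assms(4)]] assms(5) by simp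
  then have "(1 - c / t0) ^ p * Re (moment ?T ?e p) \<le> Re (moment (perturbed_id (- 1) (insert l F) v) ?e p)"
    using rank_one_update_moment_lower[OF herm_perturbed_id perturbed_id_minus_ge[OF sum] direction_normalized[OF False],
        of "sqn (v l)" c] assms
    by (simp add: perturbed_id_insert[where v = v, OF assms(1,2) False])
  then show ?thesis
    unfolding moment_direction[OF herm_lin[OF herm_perturbed_id]]
    using mult_left_mono[OF _ sqn_nonneg[of "v l"]] by (simp add: mult.left_commute)
qed

lemma trace_added_sample:
  assumes "finite F" "l \<notin> F"
     and "\<And>u. 0 \<le> dot (perturbed_id \<sigma> F v u) u" "\<And>u. 0 \<le> dot (perturbed_id \<sigma> (insert l F) v u) u"
  shows "\<exists>d\<ge>0. trace_of (perturbed_id \<sigma> (insert l F) v ^^ p) - trace_of (perturbed_id \<sigma> F v ^^ p) = \<sigma> * d"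
proof (cases "sqn (v l) = 0")
  case True
  then show ?thesis using perturbed_id_insert_null[where v = v, OF assms(1,2)] by (auto intro: exI[of _ 0])
next
  case False
  from trace_rank_one_update[OF herm_perturbed_id assms(3) direction_normalized[OF False]
      assms(4)[unfolded perturbed_id_insert[where v = v, OF assms(1,2) False]], of p]
  obtain d where "d \<ge> 0" 
    "trace_of (perturbed_id \<sigma> (insert l F) v ^^ p) - trace_of (perturbed_id \<sigma> F v ^^ p) = \<sigma> * sqn (v l) * d"
    unfolding perturbed_id_insert[where v = v, OF assms(1,2) False] by blast
  then show ?thesis by (intro exI[of _ "sqn (v l) * d"]) simp
qed

lemma trace_Suc:
  "trace_of (perturbed_id \<sigma> F v ^^ Suc p)
     = trace_of (perturbed_id \<sigma> F v ^^ p) + \<sigma> * (\<Sum>l\<in>F. Re (dot ((perturbed_id \<sigma> F v ^^ p) (v l)) (v l)))"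
proof -
  let ?T = "perturbed_id \<sigma> F v"
  have L: "lin (?T ^^ p)" using herm_lin[OF herm_perturbed_id] by (rule lin_funpow)
  have "(?T ^^ Suc p) w = (\<lambda>k. (?T ^^ p) w k + complex_of_real \<sigma> * (\<Sum>l\<in>F. dot w (v l) * (?T ^^ p) (v l) k))" for w
  proof -
    have "(?T ^^ Suc p) w = (?T ^^ p) (\<lambda>k. w k + complex_of_real \<sigma> * rank_one_total F v w k)"
      by (simp only: funpow_Suc_right o_apply perturbed_id_def[symmetric])
    then show ?thesis unfolding linD[OF L] rank_one_total_def lin_sum[OF L] .
  qed
  then have "trace_of (?T ^^ Suc p) = trace_of (?T ^^ p) + (\<Sum>k\<in>I. \<Sum>l\<in>F. 
       \<sigma> * Re (dot ((?T ^^ p) (v l)) (unit_vec_fun k) * dot (unit_vec_fun k) (v l)))"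
    by (simp add: trace_of_def dot_add dot_scale dot_sum sum.distrib sum_distrib_left mult.commute)
  also have "(\<Sum>k\<in>I. \<Sum>l\<in>F. \<sigma> * Re (dot ((?T ^^ p) (v l)) (unit_vec_fun k) * dot (unit_vec_fun k) (v l)))
     = (\<Sum>l\<in>F. \<sigma> * Re (\<Sum>k\<in>I. dot ((?T ^^ p) (v l)) (unit_vec_fun k) * dot (unit_vec_fun k) (v l)))"
    by (subst sum.swap) (simp only: sum_distrib_left Re_sum)
  finally show ?thesis by (simp only: Parseval sum_distrib_left)
qed

text \<open>
The positive operators for which averaging is possible term by term.  A list is used because
repeated vectors must count.
\<close>

definition rank_one_sum :: "(('i \<Rightarrow> complex) \<Rightarrow> 'i \<Rightarrow> complex) \<Rightarrow> bool" where
  "rank_one_sum B \<longleftrightarrow> (\<exists>ws. \<forall>u. dot (B u) u = of_real (\<Sum>w\<leftarrow>ws. (cmod (dot u w))\<^sup>2))"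

lemma trace_rank_one_sum:
  assumes "\<And>u. dot (B u) u = of_real (\<Sum>w\<leftarrow>ws. (cmod (dot u w))\<^sup>2)"
  shows "trace_of B = (\<Sum>w\<leftarrow>ws. sqn w)"
proof -
  have "trace_of B = (\<Sum>k\<in>I. \<Sum>w\<leftarrow>ws. (cmod (w k))\<^sup>2)"
    by (simp add: trace_of_def assms dot_unit_vec_left)
  also have "\<dots> = (\<Sum>w\<leftarrow>ws. sqn w)"
    by (induction ws) (simp_all add: sum.distrib sqn_def)
  finally show ?thesis .
qed

lemma rank_one_sum_le_trace:
  assumes "rank_one_sum B"
  shows "Re (dot (B u) u) \<le> trace_of B * sqn u"
proof -
  obtain ws where ws: "\<And>u. dot (B u) u = of_real (\<Sum>w\<leftarrow>ws. (cmod (dot u w))\<^sup>2)"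
    using assms by (auto simp: rank_one_sum_def)
  have "(\<Sum>w\<leftarrow>ws. (cmod (dot u w))\<^sup>2) \<le> (\<Sum>w\<leftarrow>ws. sqn w * sqn u)"
    by (rule sum_list_mono) (metis dot_Cauchy_Schwarz mult.commute)
  then show ?thesis by (simp add: ws trace_rank_one_sum[OF ws] sum_list_mult_const)
qed

text \<open>
The roles of the sample vector and of the vectors that build \<open>B\<close> are exchanged.
\<close>

lemma mean_rank_one_sum:
  assumes "\<And>u. dot (B u) u = of_real (\<Sum>w\<leftarrow>ws. (cmod (dot u w))\<^sup>2)"
  shows "(\<Sum>a\<in>E. \<rho> a * Re (dot (B (v a)) (v a))) = (\<Sum>w\<leftarrow>ws. \<Sum>a\<in>E. \<rho> a * (cmod (dot w (v a)))\<^sup>2)"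
proof -
  have "(\<Sum>a\<in>E. \<rho> a * Re (dot (B (v a)) (v a))) = (\<Sum>a\<in>E. \<Sum>w\<leftarrow>ws. \<rho> a * (cmod (dot w (v a)))\<^sup>2)"
    by (simp add: assms sum_list_const_mult cmod_dot_commute[of "v _"])
  also have "\<dots> = (\<Sum>w\<leftarrow>ws. \<Sum>a\<in>E. \<rho> a * (cmod (dot w (v a)))\<^sup>2)"
    by (induction ws) (simp_all add: sum.distrib)
  finally show ?thesis .
qed

lemma mean_rank_one_sum_le:
  assumes "rank_one_sum B" "\<And>u. (\<Sum>a\<in>E. \<rho> a * (cmod (dot u (v a)))\<^sup>2) \<le> \<mu> * sqn u"
  shows "(\<Sum>a\<in>E. \<rho> a * Re (dot (B (v a)) (v a))) \<le> \<mu> * trace_of B"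
proof -
  obtain ws where ws: "\<And>u. dot (B u) u = of_real (\<Sum>w\<leftarrow>ws. (cmod (dot u w))\<^sup>2)"
    using assms by (auto simp: rank_one_sum_def)
  show ?thesis
    unfolding mean_rank_one_sum[OF ws] trace_rank_one_sum[OF ws] sum_list_const_mult[symmetric]
    by (rule sum_list_mono) (rule assms(2))
qed

lemma mean_rank_one_sum_ge:
  assumes "rank_one_sum B" "\<And>u. \<mu> * sqn u \<le> (\<Sum>a\<in>E. \<rho> a * (cmod (dot u (v a)))\<^sup>2)"
  shows "\<mu> * trace_of B \<le> (\<Sum>a\<in>E. \<rho> a * Re (dot (B (v a)) (v a)))"
proof -
  obtain ws where ws: "\<And>u. dot (B u) u = of_real (\<Sum>w\<leftarrow>ws. (cmod (dot u w))\<^sup>2)"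
    using assms by (auto simp: rank_one_sum_def)
  show ?thesis
    unfolding mean_rank_one_sum[OF ws] trace_rank_one_sum[OF ws] sum_list_const_mult[symmetric]
    by (rule sum_list_mono) (rule assms(2))
qed

lemma rank_one_sum_add:
  assumes "rank_one_sum B" "rank_one_sum C"
  shows "rank_one_sum (\<lambda>u k. B u k + C u k)"
proof -
  obtain ws ws' where ws: "\<And>u. dot (B u) u = of_real (\<Sum>w\<leftarrow>ws. (cmod (dot u w))\<^sup>2)"
      "\<And>u. dot (C u) u = of_real (\<Sum>w\<leftarrow>ws'. (cmod (dot u w))\<^sup>2)"
    using assms by (auto simp: rank_one_sum_def)
  then show ?thesis unfolding rank_one_sum_def by (intro exI[of _ "ws @ ws'"]) (simp add: dot_add)
qed

lemma rank_one_sum_conjugate: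
  assumes "rank_one_sum B" "herm T"
  shows "rank_one_sum (\<lambda>u. T (B (T u)))"
proof -
  obtain ws where ws: "\<And>u. dot (B u) u = of_real (\<Sum>w\<leftarrow>ws. (cmod (dot u w))\<^sup>2)"
    using assms by (auto simp: rank_one_sum_def)
  then show ?thesis unfolding rank_one_sum_def
    by (intro exI[of _ "map T ws"]) (simp add: herm_swap[OF assms(2)] o_def)
qed

lemma rank_one_sum_family:
  assumes "finite F" "\<And>u. dot (B u) u = of_real (\<Sum>l\<in>F. (cmod (dot u (w l)))\<^sup>2)"
  shows "rank_one_sum B"
proof -
  obtain xs where "set xs = F" "distinct xs" using finite_distinct_list[OF assms(1)] by blast
  then show ?thesis unfolding rank_one_sum_def
    using assms(2) by (intro exI[of _ "map w xs"]) (simp add: o_def sum_list_distinct_conv_sum_set)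
qed

lemma rank_one_sum_id: "rank_one_sum (\<lambda>u. u)"
  by (rule rank_one_sum_family[OF finite_I, of _ unit_vec_fun]) (simp add: dot_self sqn_def dot_unit_vec)

lemma rank_one_sum_rank_one_total: "finite F \<Longrightarrow> rank_one_sum (rank_one_total F v)"
  by (rule rank_one_sum_family[of F _ v]) (simp_all add: dot_rank_one_total_self)

lemma rank_one_sum_even_power:
  assumes "herm T"
  shows "rank_one_sum (T ^^ (2 * q))"
proof -
  have "rank_one_sum (\<lambda>u. (T ^^ q) ((T ^^ q) u))"
    using rank_one_sum_conjugate[OF rank_one_sum_id herm_funpow[OF assms]] .
  then show ?thesis by (simp add: mult_2 funpow_add o_def)
qed

lemma rank_one_sum_power_rank_one_total:
  assumes "finite F"
  shows "rank_one_sum (rank_one_total F v ^^ j)"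
proof (induction j rule: less_induct)
  case (less j)
  consider "j = 0" | "j = 1" | i where "j = Suc (Suc i)"
    by (metis One_nat_def not0_implies_Suc)
  then show ?case
  proof cases
    case 3
    let ?S = "rank_one_total F v"
    have "rank_one_sum (\<lambda>u. ?S ((?S ^^ i) (?S u)))"
      using rank_one_sum_conjugate[OF less[of i] herm_rank_one_total[of F v]] 3 by simp
    moreover have "?S ^^ j = (\<lambda>u. ?S ((?S ^^ i) (?S u)))"
      unfolding 3 funpow.simps(2)[of "Suc i"] funpow_Suc_right[of i] by (simp add: o_def)
    ultimately show ?thesis by simp
  qed (simp_all add: rank_one_sum_id id_def rank_one_sum_rank_one_total[OF assms])
qed

text \<open>
Expanding one factor \<open>1 + S\<close> at a time, with \<open>S\<close> the sum of the rank-one operators, gives a sum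
of powers of \<open>S\<close>.
\<close>

lemma rank_one_sum_mixed_power:
  assumes "finite F"
  shows "rank_one_sum (\<lambda>u. (perturbed_id 1 F v ^^ p) ((rank_one_total F v ^^ j) u))"
proof (induction p arbitrary: j)
  case 0 then show ?case using rank_one_sum_power_rank_one_total[OF assms, where v = v and j = j] by simp
next
  case (Suc p)
  let ?T = "perturbed_id 1 F v" and ?S = "rank_one_total F v"
  have "(?T ^^ Suc p) ((?S ^^ j) u) = (\<lambda>k. (?T ^^ p) ((?S ^^ j) u) k + (?T ^^ p) ((?S ^^ Suc j) u) k)" for u
  proof -
    have "(?T ^^ Suc p) ((?S ^^ j) u) = (?T ^^ p) (?T ((?S ^^ j) u))"
      by (simp only: funpow_Suc_right o_apply)
    also have "?T ((?S ^^ j) u) = (\<lambda>k. (?S ^^ j) u k + (?S ^^ Suc j) u k)"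
      by (simp add: perturbed_id_def)
    finally have "(?T ^^ Suc p) ((?S ^^ j) u) = (?T ^^ p) (\<lambda>k. (?S ^^ j) u k + (?S ^^ Suc j) u k)" .
    then show ?thesis unfolding lin_add[OF lin_funpow[OF herm_lin[OF herm_perturbed_id]]] .
  qed
  then show ?case using rank_one_sum_add[OF Suc[of j] Suc[of "Suc j"]] by (simp only:)
qed

text \<open>
Subtracting the identity removes the dimension from the trace.
\<close>

definition power_minus_id where
  "power_minus_id F v p u = (\<lambda>k. (perturbed_id 1 F v ^^ p) u k - u k)"

lemma rank_one_sum_power_minus_id:
  assumes "finite F"
  shows "rank_one_sum (power_minus_id F v p)"
proof (induction p)
  case 0 
  have "dot (\<lambda>k. 0) u = 0" for u by (simp add: dot_def)
  then show ?case unfolding rank_one_sum_def power_minus_id_def by (intro exI[of _ "[]"]) simp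
next
  case (Suc p)
  let ?T = "perturbed_id 1 F v" and ?S = "rank_one_total F v"
  have *: "(?T ^^ Suc p) u = (\<lambda>k. (?T ^^ p) u k + (?T ^^ p) ((?S ^^ 1) u) k)" for u
  proof -
    have "(?T ^^ Suc p) u = (?T ^^ p) (?T u)"
      by (simp only: funpow_Suc_right o_apply)
    also have "?T u = (\<lambda>k. u k + (?S ^^ 1) u k)"
      by (simp add: perturbed_id_def)
    finally have "(?T ^^ Suc p) u = (?T ^^ p) (\<lambda>k. u k + (?S ^^ 1) u k)" .
    then show ?thesis unfolding lin_add[OF lin_funpow[OF herm_lin[OF herm_perturbed_id]]] .
  qed
  have "power_minus_id F v (Suc p) u = (\<lambda>k. power_minus_id F v p u k + (?T ^^ p) ((?S ^^ 1) u) k)" for u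
    unfolding power_minus_id_def * by (simp add: fun_eq_iff)
  then have eq: "power_minus_id F v (Suc p)
      = (\<lambda>u k. power_minus_id F v p u k + (?T ^^ p) ((?S ^^ 1) u) k)"
    by (rule ext)
  show ?case unfolding eq by (rule rank_one_sum_add[OF Suc rank_one_sum_mixed_power[OF assms]])
qed

lemma trace_power_minus_id: "trace_of (power_minus_id F v p) = trace_of (perturbed_id 1 F v ^^ p) - card I"
  by (simp add: trace_of_def power_minus_id_def dot_diff sum_subtractf dot_unit_vec_self)

end

section \<open>Mean traces of powers over independent samples\<close>

definition sample_mean :: "nat \<Rightarrow> 'a set \<Rightarrow> ('a \<Rightarrow> real) \<Rightarrow> ((nat \<Rightarrow> 'a) \<Rightarrow> real) \<Rightarrow> real" where
  "sample_mean n E \<rho> f = (\<Sum>j\<in>PiE {..<n} (\<lambda>_. E). (\<Prod>l<n. \<rho> (j l)) * f j)"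

lemma sample_mean_mono:
  assumes "\<And>a. a \<in> E \<Longrightarrow> 0 \<le> \<rho> a" "\<And>j. j \<in> PiE {..<n} (\<lambda>_. E) \<Longrightarrow> f j \<le> g j"
  shows "sample_mean n E \<rho> f \<le> sample_mean n E \<rho> g"
  unfolding sample_mean_def
  using assms by (intro sum_mono mult_left_mono prod_nonneg) (auto simp: PiE_iff)

lemma sample_mean_cong:
  assumes "\<And>j. j \<in> PiE {..<n} (\<lambda>_. E) \<Longrightarrow> f j = g j"
  shows "sample_mean n E \<rho> f = sample_mean n E \<rho> g"
  unfolding sample_mean_def using assms by (intro sum.cong) auto

lemma sample_mean_add: "sample_mean n E \<rho> (\<lambda>j. f j + g j) = sample_mean n E \<rho> f + sample_mean n E \<rho> g"
  by (simp add: sample_mean_def distrib_left sum.distrib)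

lemma sample_mean_scale: "sample_mean n E \<rho> (\<lambda>j. c * f j) = c * sample_mean n E \<rho> f"
  by (simp add: sample_mean_def sum_distrib_left mult_ac)

lemma sample_mean_sum: "sample_mean n E \<rho> (\<lambda>j. \<Sum>x\<in>F. f x j) = (\<Sum>x\<in>F. sample_mean n E \<rho> (f x))"
  by (simp add: sample_mean_def sum_distrib_left) (rule sum.swap)

lemma sample_mean_const:
  assumes "finite E" "sum \<rho> E = 1"
  shows "sample_mean n E \<rho> (\<lambda>j. c) = c"
proof -
  have "(\<Sum>j\<in>PiE {..<n} (\<lambda>_. E). \<Prod>l<n. \<rho> (j l)) = (\<Prod>l<n. sum \<rho> E)"
    using assms by (subst prod_sum_PiE) auto
  then show ?thesis by (simp add: sample_mean_def sum_distrib_right[symmetric] assms)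
qed

text \<open>
If the remaining dependence on the sample does not involve the coordinate \<open>l\<close>, that coordinate
may be averaged separately.
\<close>

lemma sample_mean_resample:
  assumes E: "finite E" "sum \<rho> E = 1" and l: "l < n"
    and f: "\<And>a j b. f a (j(l := b)) = f a j"
  shows "sample_mean n E \<rho> (\<lambda>j. f (j l) j) = sample_mean n E \<rho> (\<lambda>j. \<Sum>a\<in>E. \<rho> a * f a j)"
proof -
  let ?A = "{..<n} - {l}"
  let ?P = "PiE ?A (\<lambda>_. E)"
  have A: "{..<n} = insert l ?A" "l \<notin> ?A" "finite ?A" using l by auto
  have *: "sample_mean n E \<rho> h = (\<Sum>a\<in>E. \<Sum>j\<in>?P. \<rho> a * (\<Prod>i\<in>?A. \<rho> (j i)) * h (j(l := a)))" for h
  proof -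
    have "sample_mean n E \<rho> h = (\<Sum>j\<in>(\<lambda>(a, j). j(l := a)) ` (E \<times> ?P). (\<Prod>i<n. \<rho> (j i)) * h j)"
      unfolding sample_mean_def by (subst A(1), subst PiE_insert_eq) simp
    also have "\<dots> = (\<Sum>(a, j)\<in>E \<times> ?P. (\<Prod>i<n. \<rho> ((j(l := a)) i)) * h (j(l := a)))"
      using inj_combinator[OF A(2), of "\<lambda>_. E"]
      by (subst sum.reindex) (auto simp: case_prod_unfold)
    also have "\<dots> = (\<Sum>(a, j)\<in>E \<times> ?P. \<rho> a * (\<Prod>i\<in>?A. \<rho> (j i)) * h (j(l := a)))"
    proof (rule sum.cong, simp, clarify)
      fix a j
      have "(\<Prod>i<n. \<rho> ((j(l := a)) i)) = \<rho> a * (\<Prod>i\<in>?A. \<rho> ((j(l := a)) i))"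
        by (subst A(1), subst prod.insert) (use A in auto)
      also have "(\<Prod>i\<in>?A. \<rho> ((j(l := a)) i)) = (\<Prod>i\<in>?A. \<rho> (j i))"
        by (rule prod.cong) auto
      finally show "(\<Prod>i<n. \<rho> ((j(l := a)) i)) * h (j(l := a)) = \<rho> a * (\<Prod>i\<in>?A. \<rho> (j i)) * h (j(l := a))"
        by simp
    qed
    finally show ?thesis by (simp add: sum.cartesian_product)
  qed
  have "sample_mean n E \<rho> (\<lambda>j. f (j l) j) = (\<Sum>a\<in>E. \<Sum>j\<in>?P. \<rho> a * (\<Prod>i\<in>?A. \<rho> (j i)) * f a j)"
    unfolding * by (simp add: f)
  also have "\<dots> = (\<Sum>j\<in>?P. (\<Prod>i\<in>?A. \<rho> (j i)) * (\<Sum>a\<in>E. \<rho> a * f a j))"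
    by (subst sum.swap) (simp add: sum_distrib_left sum_distrib_right mult_ac)
  also have "\<dots> = (\<Sum>b\<in>E. \<rho> b * (\<Sum>j\<in>?P. (\<Prod>i\<in>?A. \<rho> (j i)) * (\<Sum>a\<in>E. \<rho> a * f a j)))"
    by (simp add: sum_distrib_right[symmetric] E)
  also have "\<dots> = sample_mean n E \<rho> (\<lambda>j. \<Sum>a\<in>E. \<rho> a * f a j)"
    unfolding * by (simp add: f sum_distrib_left mult_ac)
  finally show ?thesis .
qed

lemma sample_mean_Markov:
  assumes "finite E" "\<And>a. a \<in> E \<Longrightarrow> 0 \<le> \<rho> a" "0 < s"
    and "\<And>j. j \<in> PiE {..<n} (\<lambda>_. E) \<Longrightarrow> 0 \<le> f j"
    and "\<And>j. j \<in> PiE {..<n} (\<lambda>_. E) \<Longrightarrow> bad j \<Longrightarrow> s \<le> f j"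
  shows "sample_mean n E \<rho> (\<lambda>j. of_bool (bad j)) \<le> sample_mean n E \<rho> f / s"
proof -
  have "sample_mean n E \<rho> (\<lambda>j. of_bool (bad j)) \<le> sample_mean n E \<rho> (\<lambda>j. 1 / s * f j)"
    using assms by (intro sample_mean_mono) (auto simp: field_simps)
  then show ?thesis unfolding sample_mean_scale by simp
qed

context coordinates
begin

context
  fixes n :: nat and E :: "'a set" and \<rho> :: "'a \<Rightarrow> real" and v :: "'a \<Rightarrow> 'i \<Rightarrow> complex" and c :: real
  assumes finite_E: "finite E" and \<rho>_nonneg: "\<And>a. a \<in> E \<Longrightarrow> 0 \<le> \<rho> a" and sum_\<rho>: "sum \<rho> E = 1"
    and v_bound: "\<And>a. a \<in> E \<Longrightarrow> sqn (v a) \<le> c"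
begin

abbreviation "sampled_op \<sigma> F j \<equiv> perturbed_id \<sigma> F (\<lambda>l. v (j l))"

lemma sampled_op_fun_upd: "l \<notin> F \<Longrightarrow> sampled_op \<sigma> F (j(l := b)) = sampled_op \<sigma> F j"
  by (rule perturbed_id_cong) auto

lemma insert_removed: "l < n \<Longrightarrow> insert l {..<n} = {..<n}" by auto

lemma mean_moment_resample:
  assumes "l < n"
  shows "sample_mean n E \<rho> (\<lambda>j. Re (dot ((sampled_op \<sigma> ({..<n} - {l}) j ^^ p) (v (j l))) (v (j l))))
       = sample_mean n E \<rho> (\<lambda>j. \<Sum>a\<in>E. \<rho> a * Re (dot ((sampled_op \<sigma> ({..<n} - {l}) j ^^ p) (v a)) (v a)))"
proof (rule sample_mean_resample[OF finite_E sum_\<rho> assms])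
  show "Re (dot ((sampled_op \<sigma> ({..<n} - {l}) (j(l := b)) ^^ p) (v a)) (v a))
      = Re (dot ((sampled_op \<sigma> ({..<n} - {l}) j ^^ p) (v a)) (v a))" for a j b
    by (subst sampled_op_fun_upd) simp_all
qed

text \<open>
The sample \<open>l\<close> is removed from the operator at the cost of a factor \<open>(1 + c) ^ p\<close>, averaged, and
put back by monotonicity of the trace.
\<close>

lemma mean_trace_upper_step:
  fixes \<mu> \<tau> :: real
  assumes "\<And>u. (\<Sum>a\<in>E. \<rho> a * (cmod (dot u (v a)))\<^sup>2) \<le> \<mu> * sqn u" "0 \<le> \<mu>" "0 \<le> c"
    and \<tau>: "(\<Sum>a\<in>E. \<rho> a * sqn (v a)) \<le> \<tau>"
  shows "sample_mean n E \<rho> (\<lambda>j. trace_of (sampled_op 1 {..<n} j ^^ Suc p) - card I)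
       \<le> sample_mean n E \<rho> (\<lambda>j. trace_of (sampled_op 1 {..<n} j ^^ p) - card I)
         + (1 + c) ^ p * n * (\<mu> * sample_mean n E \<rho> (\<lambda>j. trace_of (sampled_op 1 {..<n} j ^^ p) - card I) + \<tau>)"
proof -
  let ?F = "\<lambda>l. {..<n} - {l}"
  let ?m = "sample_mean n E \<rho> (\<lambda>j. trace_of (sampled_op 1 {..<n} j ^^ p) - card I)"
  have T0: "0 \<le> dot (sampled_op 1 F j u) u" for F and j :: "nat \<Rightarrow> 'a" and u
    by (rule nonneg_of_ge[OF perturbed_id_plus_ge sqn_nonneg])
  have *: "sample_mean n E \<rho> (\<lambda>j. Re (dot ((sampled_op 1 {..<n} j ^^ p) (v (j l))) (v (j l))))
      \<le> (1 + c) ^ p * (\<mu> * ?m + \<tau>)" if l: "l < n" for l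
  proof -
    have "sample_mean n E \<rho> (\<lambda>j. Re (dot ((sampled_op 1 {..<n} j ^^ p) (v (j l))) (v (j l))))
       \<le> sample_mean n E \<rho> (\<lambda>j. (1 + c) ^ p * Re (dot ((sampled_op 1 (?F l) j ^^ p) (v (j l))) (v (j l))))"
    proof (rule sample_mean_mono[OF \<rho>_nonneg])
      fix j assume "j \<in> PiE {..<n} (\<lambda>_. E)"
      then have "sqn (v (j l)) \<le> c" using l by (intro v_bound) auto
      then show "Re (dot ((sampled_op 1 {..<n} j ^^ p) (v (j l))) (v (j l)))
           \<le> (1 + c) ^ p * Re (dot ((sampled_op 1 (?F l) j ^^ p) (v (j l))) (v (j l)))"
        using added_sample_upper[of "?F l" l "\<lambda>l. v (j l)" c p] by (simp add: insert_removed l)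
    qed
    also have "\<dots> = (1 + c) ^ p * sample_mean n E \<rho>
         (\<lambda>j. \<Sum>a\<in>E. \<rho> a * Re (dot ((sampled_op 1 (?F l) j ^^ p) (v a)) (v a)))"
      unfolding sample_mean_scale mean_moment_resample[OF l] ..
    also have "\<dots> \<le> (1 + c) ^ p * sample_mean n E \<rho> (\<lambda>j. \<mu> * (trace_of (sampled_op 1 {..<n} j ^^ p) - card I) + \<tau>)"
    proof (intro mult_left_mono sample_mean_mono[OF \<rho>_nonneg])
      fix j assume "j \<in> PiE {..<n} (\<lambda>_. E)"
      have "(\<Sum>a\<in>E. \<rho> a * Re (dot ((sampled_op 1 (?F l) j ^^ p) (v a)) (v a)))
         = (\<Sum>a\<in>E. \<rho> a * Re (dot (power_minus_id (?F l) (\<lambda>l. v (j l)) p (v a)) (v a))) + (\<Sum>a\<in>E. \<rho> a * sqn (v a))"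
        by (simp add: power_minus_id_def dot_diff dot_self algebra_simps sum_subtractf)
      also have "\<dots> \<le> \<mu> * (trace_of (sampled_op 1 (?F l) j ^^ p) - card I) + \<tau>"
        using mean_rank_one_sum_le[OF rank_one_sum_power_minus_id[of "?F l" "\<lambda>l. v (j l)" p] assms(1)] \<tau>
        by (simp add: trace_power_minus_id)
      also have "\<dots> \<le> \<mu> * (trace_of (sampled_op 1 {..<n} j ^^ p) - card I) + \<tau>"
      proof -
        obtain d where "d \<ge> 0" "trace_of (sampled_op 1 {..<n} j ^^ p) - trace_of (sampled_op 1 (?F l) j ^^ p) = d"
          using trace_added_sample[of "?F l" l 1 "\<lambda>l. v (j l)" p] T0
          by (auto simp: insert_removed l)
        then show ?thesis using assms(2) by (intro add_right_mono mult_left_mono) auto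
      qed
      finally show "(\<Sum>a\<in>E. \<rho> a * Re (dot ((sampled_op 1 (?F l) j ^^ p) (v a)) (v a)))
         \<le> \<mu> * (trace_of (sampled_op 1 {..<n} j ^^ p) - card I) + \<tau>" .
    qed (use assms in auto)
    also have "\<dots> = (1 + c) ^ p * (\<mu> * ?m + \<tau>)"
      by (simp add: sample_mean_add sample_mean_scale sample_mean_const[OF finite_E sum_\<rho>])
    finally show ?thesis .
  qed
  have "sample_mean n E \<rho> (\<lambda>j. trace_of (sampled_op 1 {..<n} j ^^ Suc p) - card I)
      = ?m + (\<Sum>l<n. sample_mean n E \<rho> (\<lambda>j. Re (dot ((sampled_op 1 {..<n} j ^^ p) (v (j l))) (v (j l)))))"
    unfolding trace_Suc sample_mean_sum[symmetric] sample_mean_add[symmetric] by (simp add: algebra_simps)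
  also have "\<dots> \<le> ?m + (\<Sum>l<n. (1 + c) ^ p * (\<mu> * ?m + \<tau>))"
    using * by (intro add_left_mono sum_mono) auto
  finally show ?thesis by (simp add: mult_ac)
qed

text \<open>
The scheme is that of the upper bound.  An odd power is not visibly a sum of rank-one operators,
so one factor of \<open>T\<close> is first estimated from below by \<open>t0\<close>; the loss is a single factor \<open>t0\<close>,
whatever the power.
\<close>

lemma mean_trace_lower_step:
  fixes \<mu> t0 :: real
  assumes "\<And>u. \<mu> * sqn u \<le> (\<Sum>a\<in>E. \<rho> a * (cmod (dot u (v a)))\<^sup>2)" "0 \<le> \<mu>" "0 \<le> c"
    and t0: "n * c \<le> 1 - t0" "0 < t0" "c \<le> t0"
  shows "sample_mean n E \<rho> (\<lambda>j. trace_of (sampled_op (- 1) {..<n} j ^^ Suc p))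
       \<le> (1 - n * \<mu> * t0 * (1 - c / t0) ^ p) * sample_mean n E \<rho> (\<lambda>j. trace_of (sampled_op (- 1) {..<n} j ^^ p))"
proof -
  let ?F = "\<lambda>l. {..<n} - {l}"
  let ?\<sigma> = "- 1 :: real"
  let ?m = "sample_mean n E \<rho> (\<lambda>j. trace_of (sampled_op ?\<sigma> {..<n} j ^^ p))"
  have t01: "t0 \<le> 1" using t0(1) assms(3) mult_nonneg_nonneg[of "real n" c] by linarith
  have budget: "(\<Sum>i\<in>F. sqn (v (j i))) \<le> 1 - t0" if j: "j \<in> PiE {..<n} (\<lambda>_. E)" and F: "F \<subseteq> {..<n}" for F j
  proof -
    have "(\<Sum>i\<in>F. sqn (v (j i))) \<le> (\<Sum>i\<in>{..<n}. sqn (v (j i)))"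
      using F by (intro sum_mono2) auto
    also have "\<dots> \<le> (\<Sum>i\<in>{..<n}. c)" using j by (intro sum_mono v_bound) auto
    finally show ?thesis using t0 by simp
  qed
  have Tge: "complex_of_real (t0 * sqn u) \<le> dot (sampled_op ?\<sigma> F j u) u"
    if "j \<in> PiE {..<n} (\<lambda>_. E)" "F \<subseteq> {..<n}" for F j u
    by (rule perturbed_id_minus_ge[OF budget[OF that]])
  have T0: "0 \<le> dot (sampled_op ?\<sigma> F j u) u"
    if "j \<in> PiE {..<n} (\<lambda>_. E)" "F \<subseteq> {..<n}" for F j u
    using nonneg_of_ge[OF Tge[OF that]] t0 by simp
  have *: "(1 - c / t0) ^ p * (\<mu> * t0 * ?m)
      \<le> sample_mean n E \<rho> (\<lambda>j. Re (dot ((sampled_op ?\<sigma> {..<n} j ^^ p) (v (j l))) (v (j l))))" if l: "l < n" for l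
  proof -
    have "(1 - c / t0) ^ p * (\<mu> * t0 * ?m) = (1 - c / t0) ^ p * sample_mean n E \<rho> (\<lambda>j. \<mu> * t0 * trace_of (sampled_op ?\<sigma> {..<n} j ^^ p))"
      by (simp add: sample_mean_scale)
    also have "\<dots> \<le> (1 - c / t0) ^ p * sample_mean n E \<rho> (\<lambda>j. \<Sum>a\<in>E. \<rho> a * Re (dot ((sampled_op ?\<sigma> (?F l) j ^^ p) (v a)) (v a)))"
    proof (intro mult_left_mono sample_mean_mono[OF \<rho>_nonneg])
      fix j assume j: "j \<in> PiE {..<n} (\<lambda>_. E)"
      let ?T = "sampled_op ?\<sigma> (?F l) j"
      obtain d where "d \<ge> 0" "trace_of (sampled_op ?\<sigma> {..<n} j ^^ p) - trace_of (?T ^^ p) = ?\<sigma> * d"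
        using trace_added_sample[of "?F l" l ?\<sigma> "\<lambda>l. v (j l)" p] T0[OF j]
        by (auto simp: insert_removed l)
      then have "\<mu> * t0 * trace_of (sampled_op ?\<sigma> {..<n} j ^^ p) \<le> \<mu> * t0 * trace_of (?T ^^ p)"
        using assms(2) t0 by (intro mult_left_mono) auto
      also have "\<dots> \<le> (\<Sum>a\<in>E. \<rho> a * Re (dot ((?T ^^ p) (v a)) (v a)))"
      proof -
        define q where "q = p div 2"
        have even: "\<mu> * trace_of (?T ^^ (2 * q)) \<le> (\<Sum>a\<in>E. \<rho> a * Re (dot ((?T ^^ (2 * q)) (v a)) (v a)))"
          by (rule mean_rank_one_sum_ge[OF rank_one_sum_even_power[OF herm_perturbed_id] assms(1)])
        have nn: "0 \<le> Re (dot ((?T ^^ (2 * q)) u) u)" for u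
          by (simp add: mult_2 funpow_add herm_funpow_swap[OF herm_perturbed_id] dot_self)
        have tr_nn: "0 \<le> trace_of (?T ^^ (2 * q))"
          unfolding trace_of_def by (intro sum_nonneg nn)
        consider "p = 2 * q" | "p = Suc (2 * q)" unfolding q_def by linarith
        then show ?thesis
        proof cases
          case 1
          have "\<mu> * t0 * trace_of (?T ^^ (2 * q)) \<le> \<mu> * 1 * trace_of (?T ^^ (2 * q))"
            using assms(2) tr_nn t01 by (intro mult_right_mono mult_left_mono) auto
          then show ?thesis using even 1 by simp
        next
          case 2
          have "trace_of (?T ^^ p) \<le> trace_of (?T ^^ (2 * q))"
          proof -
            have "0 \<le> (\<Sum>i\<in>?F l. Re (dot ((?T ^^ (2 * q)) (v (j i))) (v (j i))))"
              by (intro sum_nonneg nn)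
            then show ?thesis unfolding 2 trace_Suc by simp
          qed
          \<comment> \<open>here \<open>?T\<close> is at most the identity, so the trace decreases with the exponent\<close>
          then have "\<mu> * t0 * trace_of (?T ^^ p) \<le> \<mu> * t0 * trace_of (?T ^^ (2 * q))"
            using assms(2) t0 by (intro mult_left_mono) auto
          also have "\<dots> = t0 * (\<mu> * trace_of (?T ^^ (2 * q)))" by simp
          also have "\<dots> \<le> t0 * (\<Sum>a\<in>E. \<rho> a * Re (dot ((?T ^^ (2 * q)) (v a)) (v a)))"
            using even t0 by (intro mult_left_mono) auto
          also have "\<dots> = (\<Sum>a\<in>E. \<rho> a * (t0 * Re (dot ((?T ^^ (2 * q)) (v a)) (v a))))"
            by (simp add: sum_distrib_left mult_ac)
          also have "\<dots> \<le> (\<Sum>a\<in>E. \<rho> a * Re (dot ((?T ^^ p) (v a)) (v a)))"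
          proof (intro sum_mono mult_left_mono \<rho>_nonneg)
            fix a
            let ?w = "(?T ^^ q) (v a)"
            have "dot ((?T ^^ (2 * q)) (v a)) (v a) = of_real (sqn ?w)"
              by (simp add: mult_2 funpow_add herm_funpow_swap[OF herm_perturbed_id] dot_self)
            moreover have "dot ((?T ^^ p) (v a)) (v a) = dot (?T ?w) ?w"
            proof -
              have "(?T ^^ p) (v a) = (?T ^^ q) (?T ?w)"
                unfolding 2 by (simp add: mult_2 funpow_add funpow_swap1)
              then show ?thesis by (simp add: herm_funpow_swap[OF herm_perturbed_id])
            qed
            moreover have "t0 * sqn ?w \<le> Re (dot (?T ?w) ?w)"
              using Tge[OF j, of "?F l" ?w] by (auto simp: less_eq_complex_def)
            ultimately show "t0 * Re (dot ((?T ^^ (2 * q)) (v a)) (v a)) \<le> Re (dot ((?T ^^ p) (v a)) (v a))"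
              by simp
          qed
          finally show ?thesis .
        qed
      qed
      finally show "\<mu> * t0 * trace_of (sampled_op ?\<sigma> {..<n} j ^^ p) \<le> (\<Sum>a\<in>E. \<rho> a * Re (dot ((?T ^^ p) (v a)) (v a)))" .
    qed (use assms t0 in auto)
    also have "\<dots> = (1 - c / t0) ^ p * sample_mean n E \<rho> (\<lambda>j. Re (dot ((sampled_op ?\<sigma> (?F l) j ^^ p) (v (j l))) (v (j l))))"
      unfolding mean_moment_resample[OF l] ..
    also have "\<dots> \<le> sample_mean n E \<rho> (\<lambda>j. Re (dot ((sampled_op ?\<sigma> {..<n} j ^^ p) (v (j l))) (v (j l))))"
      unfolding sample_mean_scale[symmetric]
    proof (rule sample_mean_mono[OF \<rho>_nonneg])
      fix j assume j: "j \<in> PiE {..<n} (\<lambda>_. E)"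
      then have "sqn (v (j l)) \<le> c" using l by (intro v_bound) auto
      then show "(1 - c / t0) ^ p * Re (dot ((sampled_op ?\<sigma> (?F l) j ^^ p) (v (j l))) (v (j l)))
           \<le> Re (dot ((sampled_op ?\<sigma> {..<n} j ^^ p) (v (j l))) (v (j l)))"
        using added_sample_lower[of "?F l" l "\<lambda>l. v (j l)" c t0 p] budget[OF j, of "{..<n}"] t0
        by (simp add: insert_removed l)
    qed
    finally show ?thesis .
  qed
  have "sample_mean n E \<rho> (\<lambda>j. trace_of (sampled_op ?\<sigma> {..<n} j ^^ Suc p))
      = ?m + (- 1) * (\<Sum>l<n. sample_mean n E \<rho> (\<lambda>j. Re (dot ((sampled_op ?\<sigma> {..<n} j ^^ p) (v (j l))) (v (j l)))))"
    unfolding trace_Suc sample_mean_sum[symmetric] sample_mean_add[symmetric] sample_mean_scale[symmetric] by simp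
  also have "\<dots> \<le> ?m + (- 1) * (\<Sum>l<n. (1 - c / t0) ^ p * (\<mu> * t0 * ?m))"
    using sum_mono[of "{..<n}", OF *] by simp
  finally show ?thesis by (simp add: algebra_simps)
qed

lemma sum_dot_direction:
  assumes "0 < sqn u"
  shows "(\<Sum>l\<in>F. (cmod (dot (direction u) (w l)))\<^sup>2) = (\<Sum>l\<in>F. (cmod (dot u (w l)))\<^sup>2) / sqn u"
proof -
  have "(cmod (dot (direction u) (w l)))\<^sup>2 = (cmod (dot u (w l)))\<^sup>2 / sqn u" for l
    unfolding direction_def dot_scale using assms by (simp add: norm_mult norm_divide power_divide)
  then show ?thesis by (simp add: sum_divide_distrib)
qed

lemma bad_direction_above:
  assumes "s * sqn u < (\<Sum>l\<in>F. (cmod (dot u (w l)))\<^sup>2)" "0 \<le> s"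
  shows "\<exists>e. dot e e = 1 \<and> s < (\<Sum>l\<in>F. (cmod (dot e (w l)))\<^sup>2)"
proof -
  have "sqn u \<noteq> 0"
  proof
    assume "sqn u = 0"
    then have "dot u (w l) = 0" for l using dot_Cauchy_Schwarz[of u "w l"] by simp
    then show False using assms mult_nonneg_nonneg[OF assms(2) sqn_nonneg[of u]] by simp
  qed
  then have p: "0 < sqn u" using sqn_nonneg[of u] by linarith
  have "s < (\<Sum>l\<in>F. (cmod (dot u (w l)))\<^sup>2) / sqn u"
    using assms(1) p by (simp add: pos_less_divide_eq)
  then show ?thesis
    using direction_normalized[OF \<open>sqn u \<noteq> 0\<close>] sum_dot_direction[OF p, of w F]
    by (intro exI[of _ "direction u"]) simp
qed

lemma bad_direction_below:
  assumes "(\<Sum>l\<in>F. (cmod (dot u (w l)))\<^sup>2) < s * sqn u"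
  shows "\<exists>e. dot e e = 1 \<and> (\<Sum>l\<in>F. (cmod (dot e (w l)))\<^sup>2) < s"
proof -
  have "sqn u \<noteq> 0"
    using assms sum_nonneg[of F "\<lambda>l. (cmod (dot u (w l)))\<^sup>2"] by auto
  then have p: "0 < sqn u" using sqn_nonneg[of u] by linarith
  have "(\<Sum>l\<in>F. (cmod (dot u (w l)))\<^sup>2) / sqn u < s"
    using assms(1) p by (simp add: pos_divide_less_eq)
  then show ?thesis
    using direction_normalized[OF \<open>sqn u \<noteq> 0\<close>] sum_dot_direction[OF p, of w F]
    by (intro exI[of _ "direction u"]) simp
qed

text \<open>
The moment of the unit vector in the bad direction is a lower bound for the trace.
\<close>

lemma trace_ge_of_bad_upper:
  assumes "s * sqn u < (\<Sum>l\<in>F. (cmod (dot u (w l)))\<^sup>2)" "0 \<le> s" "finite F"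
  shows "(1 + s) ^ p - 1 \<le> trace_of (perturbed_id 1 F w ^^ p) - card I"
proof -
  let ?T = "perturbed_id 1 F w"
  obtain e where e: "dot e e = 1" "s < (\<Sum>l\<in>F. (cmod (dot e (w l)))\<^sup>2)"
    using bad_direction_above[OF assms(1,2)] by blast
  have sqe: "sqn e = 1" using e by (simp add: dot_self)
  have T0: "0 \<le> dot (?T u) u" for u
    by (rule nonneg_of_ge[OF perturbed_id_plus_ge sqn_nonneg])
  have "(1 + s) ^ p \<le> (Re (dot (?T e) e)) ^ p"
    using e sqe assms(2) by (intro power_mono) (simp_all add: dot_perturbed_id_self)
  also have "\<dots> \<le> Re (moment ?T e p)"
    by (rule moment_ge_power[OF herm_perturbed_id T0 e(1)])
  finally have "(1 + s) ^ p - 1 \<le> Re (dot (power_minus_id F w p e) e)"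
    by (simp add: power_minus_id_def dot_diff moment_def e(1))
  also have "\<dots> \<le> trace_of (power_minus_id F w p)"
    using rank_one_sum_le_trace[OF rank_one_sum_power_minus_id[OF assms(3)], of w p e] sqe by simp
  finally show ?thesis by (simp add: trace_power_minus_id)
qed

lemma trace_ge_of_bad_lower:
  assumes "(\<Sum>l\<in>F. (cmod (dot u (w l)))\<^sup>2) < s * sqn u" "s \<le> 1" "\<And>u. 0 \<le> dot (perturbed_id (- 1) F w u) u"
  shows "(1 - s) ^ (2 * q) \<le> trace_of (perturbed_id (- 1) F w ^^ (2 * q))"
proof -
  let ?T = "perturbed_id (- 1) F w"
  obtain e where e: "dot e e = 1" "(\<Sum>l\<in>F. (cmod (dot e (w l)))\<^sup>2) < s"
    using bad_direction_below[OF assms(1)] by blast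
  have sqe: "sqn e = 1" using e by (simp add: dot_self)
  have "(1 - s) ^ (2 * q) \<le> (Re (dot (?T e) e)) ^ (2 * q)"
    using e sqe assms(2) by (intro power_mono) (simp_all add: dot_perturbed_id_self)
  also have "\<dots> \<le> Re (moment ?T e (2 * q))"
    by (rule moment_ge_power[OF herm_perturbed_id assms(3) e(1)])
  also have "\<dots> \<le> trace_of (?T ^^ (2 * q))"
    using rank_one_sum_le_trace[OF rank_one_sum_even_power[OF herm_perturbed_id], of q "- 1" F w e] sqe
    by (simp add: moment_def)
  finally show ?thesis .
qed

lemma trace_id: "trace_of (perturbed_id \<sigma> F w ^^ 0) = card I"
  by (simp add: trace_of_def dot_unit_vec_self)

text \<open>
With \<open>S q\<close> the partial sums of \<open>(1 + c) ^ i\<close>, the recursion for the mean trace is solved by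
\<open>n * \<tau> * S q * exp (n * \<mu> * S q)\<close>.
\<close>

lemma scaled_upper_tail:
  fixes \<mu> \<tau> :: real
  assumes "\<And>u. (\<Sum>a\<in>E. \<rho> a * (cmod (dot u (v a)))\<^sup>2) \<le> \<mu> * sqn u" "0 \<le> \<mu>" "0 < c"
    and \<tau>: "(\<Sum>a\<in>E. \<rho> a * sqn (v a)) \<le> \<tau>" and "0 \<le> \<tau>" "0 < s" "0 < p"
    and G: "((1 + c) ^ p - 1) / c \<le> G"
  shows "sample_mean n E \<rho> (\<lambda>j. of_bool (\<exists>u. s * sqn u < (\<Sum>l<n. (cmod (dot u (v (j l))))\<^sup>2)))
       \<le> n * \<tau> * G * exp (n * \<mu> * G) / ((1 + s) ^ p - 1)"
proof -
  define m where "m q = sample_mean n E \<rho> (\<lambda>j. trace_of (sampled_op 1 {..<n} j ^^ q) - card I)" for q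
  define S where "S q = (\<Sum>i<q. (1 + c) ^ i)" for q
  have S0: "0 \<le> S q" for q unfolding S_def using assms(3) by (intro sum_nonneg) auto
  have m: "m q \<le> n * \<tau> * S q * exp (n * \<mu> * S q)" for q
  proof (induction q)
    case 0
    have "m 0 = sample_mean n E \<rho> (\<lambda>j. 0)" unfolding m_def trace_id by simp
    then show ?case by (simp add: sample_mean_def S_def)
  next
    case (Suc q)
    let ?b = "(1 + c) ^ q"
    have b: "0 \<le> ?b" using assms(3) by simp
    have "m (Suc q) \<le> m q + ?b * n * (\<mu> * m q + \<tau>)"
      unfolding m_def by (rule mean_trace_upper_step[OF assms(1,2) less_imp_le[OF assms(3)] \<tau>])
    also have "\<dots> = (1 + n * \<mu> * ?b) * m q + n * \<tau> * ?b" by (simp add: algebra_simps)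
    also have "\<dots> \<le> exp (n * \<mu> * ?b) * (n * \<tau> * S q * exp (n * \<mu> * S q))
        + n * \<tau> * ?b * exp (n * \<mu> * (S q + ?b))"
    proof (rule add_mono)
      have "(1 + n * \<mu> * ?b) * m q \<le> (1 + n * \<mu> * ?b) * (n * \<tau> * S q * exp (n * \<mu> * S q))"
        using Suc assms(2) b by (intro mult_left_mono) auto
      also have "\<dots> \<le> exp (n * \<mu> * ?b) * (n * \<tau> * S q * exp (n * \<mu> * S q))"
        using assms(5) S0[of q] by (intro mult_right_mono exp_ge_add_one_self) auto
      finally show "(1 + n * \<mu> * ?b) * m q \<le> exp (n * \<mu> * ?b) * (n * \<tau> * S q * exp (n * \<mu> * S q))" .
      have "1 \<le> exp (n * \<mu> * (S q + ?b))" using assms(2) b S0[of q] by simp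
      then show "n * \<tau> * ?b \<le> n * \<tau> * ?b * exp (n * \<mu> * (S q + ?b))"
        using assms(5) b mult_left_mono[of 1 "exp (n * \<mu> * (S q + ?b))" "n * \<tau> * ?b"] by simp
    qed
    also have "\<dots> = n * \<tau> * S (Suc q) * exp (n * \<mu> * S (Suc q))"
      by (simp add: S_def exp_add distrib_left algebra_simps)
    finally show ?case .
  qed
  have "S p = ((1 + c) ^ p - 1) / c"
    unfolding S_def using assms(3) by (subst geometric_sum) auto
  then have SG: "S p \<le> G" using G by simp
  have "m p \<le> n * \<tau> * G * exp (n * \<mu> * G)"
    using S0[of p] SG assms(2,5) 
    by (intro order_trans[OF m[of p]] mult_mono) (auto intro!: mult_left_mono mult_nonneg_nonneg)
  moreover have pos: "0 < (1 + s) ^ p - 1" using assms(6,7) by simp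
  moreover have "sample_mean n E \<rho> (\<lambda>j. of_bool (\<exists>u. s * sqn u < (\<Sum>l<n. (cmod (dot u (v (j l))))\<^sup>2)))
     \<le> m p / ((1 + s) ^ p - 1)"
    unfolding m_def
  proof (rule sample_mean_Markov[OF finite_E \<rho>_nonneg pos])
    show "0 \<le> trace_of (sampled_op 1 {..<n} j ^^ p) - card I" for j
    proof -
      obtain ws where ws: "\<And>u. dot (power_minus_id {..<n} (\<lambda>l. v (j l)) p u) u = of_real (\<Sum>w\<leftarrow>ws. (cmod (dot u w))\<^sup>2)"
        using rank_one_sum_power_minus_id[of "{..<n}" "\<lambda>l. v (j l)" p] by (auto simp: rank_one_sum_def)
      have "0 \<le> trace_of (power_minus_id {..<n} (\<lambda>l. v (j l)) p)"
        unfolding trace_rank_one_sum[OF ws] by (rule sum_list_nonneg) auto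
      then show ?thesis by (simp add: trace_power_minus_id)
    qed
    show "(1 + s) ^ p - 1 \<le> trace_of (sampled_op 1 {..<n} j ^^ p) - card I"
      if "\<exists>u. s * sqn u < (\<Sum>l<n. (cmod (dot u (v (j l))))\<^sup>2)" for j
      using that trace_ge_of_bad_upper[where s = s and F = "{..<n}" and w = "\<lambda>l. v (j l)" and p = p] assms(6) by auto
  qed
  ultimately show ?thesis
    by (meson divide_right_mono less_imp_le order_trans)
qed

lemma scaled_lower_tail:
  fixes \<mu> t0 :: real
  assumes "\<And>u. \<mu> * sqn u \<le> (\<Sum>a\<in>E. \<rho> a * (cmod (dot u (v a)))\<^sup>2)" "0 \<le> \<mu>" "0 < c"
    and t0: "n * c \<le> 1 - t0" "0 < t0" "c \<le> t0" and "s < 1"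
  shows "sample_mean n E \<rho> (\<lambda>j. of_bool (\<exists>u. (\<Sum>l<n. (cmod (dot u (v (j l))))\<^sup>2) < s * sqn u))
       \<le> card I * exp (- (n * \<mu> * t0 * (t0 / c * (1 - (1 - c / t0) ^ (2 * q))))) / (1 - s) ^ (2 * q)"
proof -
  let ?\<rho>' = "1 - c / t0"
  define m where "m q = sample_mean n E \<rho> (\<lambda>j. trace_of (sampled_op (- 1) {..<n} j ^^ q))" for q
  have T0: "0 \<le> dot (sampled_op (- 1) {..<n} j u) u" if "j \<in> PiE {..<n} (\<lambda>_. E)" for j u
  proof (rule nonneg_of_ge[OF perturbed_id_minus_ge])
    have "(\<Sum>i\<in>{..<n}. sqn (v (j i))) \<le> (\<Sum>i\<in>{..<n}. c)" using that by (intro sum_mono v_bound) auto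
    then show "(\<Sum>i\<in>{..<n}. sqn (v (j i))) \<le> 1 - t0" using t0 by simp
    show "0 \<le> t0 * sqn u" using t0 by simp
  qed
  have tr0: "0 \<le> trace_of (sampled_op (- 1) {..<n} j ^^ q)" if "j \<in> PiE {..<n} (\<lambda>_. E)" for j q
  proof -
    let ?T = "sampled_op (- 1) {..<n} j"
    have "0 \<le> dot ((?T ^^ q) u) u" for u
    proof (cases "even q")
      case True
      then obtain r where q: "q = 2 * r" by auto
      show ?thesis
        unfolding q mult_2 funpow_add o_apply
        by (subst herm_funpow_swap[OF herm_perturbed_id]) (rule dot_self_nonneg)
    next
      case False
      then obtain r where q: "q = Suc (2 * r)" using oddE by fastforce
      have "(?T ^^ q) u = (?T ^^ r) (?T ((?T ^^ r) u))"
        unfolding q by (simp add: mult_2 funpow_add funpow_swap1)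
      then show ?thesis by (simp add: herm_funpow_swap[OF herm_perturbed_id] T0[OF that])
    qed
    then show ?thesis unfolding trace_of_def by (intro sum_nonneg) (simp add: less_eq_complex_def)
  qed
  have m0: "0 \<le> m q" for q
  proof -
    have "sample_mean n E \<rho> (\<lambda>j. 0) \<le> m q"
      unfolding m_def by (rule sample_mean_mono[OF \<rho>_nonneg tr0])
    then show ?thesis by (simp add: sample_mean_def)
  qed
  have m: "m q \<le> card I * exp (- (n * \<mu> * t0 * (\<Sum>i<q. ?\<rho>' ^ i)))" for q
  proof (induction q)
    case 0
    show ?case unfolding m_def trace_id by (simp add: sample_mean_const[OF finite_E sum_\<rho>])
  next
    case (Suc q)
    have "m (Suc q) \<le> (1 - n * \<mu> * t0 * ?\<rho>' ^ q) * m q"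
      unfolding m_def by (rule mean_trace_lower_step[OF assms(1,2) less_imp_le[OF assms(3)] t0])
    also have "\<dots> \<le> exp (- (n * \<mu> * t0 * ?\<rho>' ^ q)) * m q"
      using exp_ge_add_one_self[of "- (n * \<mu> * t0 * ?\<rho>' ^ q)"] m0 by (intro mult_right_mono) auto
    also have "\<dots> \<le> exp (- (n * \<mu> * t0 * ?\<rho>' ^ q)) * (card I * exp (- (n * \<mu> * t0 * (\<Sum>i<q. ?\<rho>' ^ i))))"
      using Suc by (intro mult_left_mono) auto
    also have "\<dots> = card I * exp (- (n * \<mu> * t0 * (\<Sum>i<Suc q. ?\<rho>' ^ i)))"
      by (simp add: exp_add[symmetric] algebra_simps)
    finally show ?case .
  qed
  have geo: "(\<Sum>i<2*q. ?\<rho>' ^ i) = t0 / c * (1 - ?\<rho>' ^ (2 * q))"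
    using assms(3) t0 by (subst geometric_sum) (auto simp: field_simps)
  have pos: "0 < (1 - s) ^ (2 * q)" using assms(7) by simp
  have "sample_mean n E \<rho> (\<lambda>j. of_bool (\<exists>u. (\<Sum>l<n. (cmod (dot u (v (j l))))\<^sup>2) < s * sqn u))
     \<le> m (2 * q) / (1 - s) ^ (2 * q)"
    unfolding m_def
  proof (rule sample_mean_Markov[OF finite_E \<rho>_nonneg pos tr0])
    show "(1 - s) ^ (2 * q) \<le> trace_of (sampled_op (- 1) {..<n} j ^^ (2 * q))"
      if "j \<in> PiE {..<n} (\<lambda>_. E)" "\<exists>u. (\<Sum>l<n. (cmod (dot u (v (j l))))\<^sup>2) < s * sqn u" for j
      using that trace_ge_of_bad_lower[where s = s and F = "{..<n}" and w = "\<lambda>l. v (j l)" and q = q] T0[OF that(1)] assms(7) by auto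
  qed
  then show ?thesis
    using divide_right_mono[OF m[of "2 * q"] less_imp_le[OF pos]] unfolding geo by linarith
qed

end

end

section \<open>Chernoff bounds for sampled frames\<close>

lemma exp_le_one_plus:
  assumes "0 < (q::real)"
  shows "exp (q / (1 + q)) \<le> 1 + q"
proof -
  have "1 / (1 + q) \<le> exp (- (q / (1 + q)))"
    using exp_ge_add_one_self[of "- (q / (1 + q))"] assms by (simp add: field_simps)
  then show ?thesis using assms by (simp add: exp_minus field_simps)
qed

context coordinates
begin

lemma rescale:
  assumes "0 < L"
  shows "(cmod (dot u (\<lambda>k. complex_of_real (1 / sqrt L) * w k)))\<^sup>2 = (cmod (dot u w))\<^sup>2 / L"
    and "sqn (\<lambda>k. complex_of_real (1 / sqrt L) * w k) = sqn w / L"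
  using assms unfolding dot_scale_right sqn_def
  by (simp_all add: norm_mult norm_divide power_mult_distrib power_divide sum_divide_distrib)

text \<open>
A lower Chernoff bound.  The vectors are divided by \<open>sqrt L\<close> with \<open>L = 100 * n * R\<close>, which makes the
operator at least \<open>t0 = 99/100\<close>; the exponent \<open>50 * n\<close> then plays the role of the Laplace parameter
\<open>1 / (2 * R)\<close>.  The rate is the difference of \<open>(99/100)\<^sup>2 * (1 - exp (- 1/2))\<close>, from the recursion,
and about \<open>1/4\<close>, from the threshold.
\<close>

theorem sampled_frame_lower_tail:
  fixes v :: "'a \<Rightarrow> 'i \<Rightarrow> complex" and \<mu> R :: real
  assumes E: "finite E" "\<And>a. a \<in> E \<Longrightarrow> 0 \<le> \<rho> a" "sum \<rho> E = 1"
    and R: "\<And>a. a \<in> E \<Longrightarrow> sqn (v a) \<le> R" "0 < R" and "0 < n"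
    and \<mu>: "\<And>u. \<mu> * sqn u \<le> (\<Sum>a\<in>E. \<rho> a * (cmod (dot u (v a)))\<^sup>2)" "0 \<le> \<mu>" and "I \<noteq> {}"
  shows "sample_mean n E \<rho> (\<lambda>j. of_bool (\<exists>u. (\<Sum>l<n. (cmod (dot u (v (j l))))\<^sup>2) < n * \<mu> / 2 * sqn u))
       \<le> card I * exp (- (n * \<mu> / (8 * R)))"
proof -
  define L where "L = 100 * n * R"
  define c where "c = 1 / (100 * real n)"
  define w where "w a = (\<lambda>k. complex_of_real (1 / sqrt L) * v a k)" for a
  define s where "s = \<mu> / (200 * R)"
  have L: "0 < L" using assms by (simp add: L_def)
  have n: "1 \<le> real n" using \<open>0 < n\<close> by simp
  have \<mu>R: "\<mu> \<le> R"
  proof -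
    obtain k where k: "k \<in> I" using \<open>I \<noteq> {}\<close> by blast
    let ?e = "unit_vec_fun k :: 'i \<Rightarrow> complex"
    have e: "sqn ?e = 1" using dot_unit_vec_self[OF k] by (simp add: dot_self)
    have "\<mu> = \<mu> * sqn ?e" by (simp add: e)
    also have "\<dots> \<le> (\<Sum>a\<in>E. \<rho> a * (cmod (dot ?e (v a)))\<^sup>2)" by (rule \<mu>(1))
    also have "\<dots> \<le> (\<Sum>a\<in>E. \<rho> a * R)"
    proof (intro sum_mono mult_left_mono E(2))
      fix a assume "a \<in> E"
      then show "(cmod (dot ?e (v a)))\<^sup>2 \<le> R"
        using dot_Cauchy_Schwarz[of ?e "v a"] R(1)[of a] e by simp
    qed
    also have "\<dots> = R" using E(3) by (simp add: sum_distrib_right[symmetric])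
    finally show ?thesis .
  qed
  have s: "0 \<le> s" "s \<le> 1 / 200" using \<mu>R \<mu>(2) R(2) by (simp_all add: s_def field_simps)
  have c: "0 < c" "c \<le> 1 / 100" "n * c = 1 / 100" using n by (simp_all add: c_def field_simps)
  have "sample_mean n E \<rho> (\<lambda>j. of_bool (\<exists>u. (\<Sum>l<n. (cmod (dot u (w (j l))))\<^sup>2) < s * sqn u))
     \<le> card I * exp (- (n * (\<mu> / L) * (99/100) * ((99/100) / c * (1 - (1 - c / (99/100)) ^ (2 * (25 * n)))))) / (1 - s) ^ (2 * (25 * n))"
  proof (rule scaled_lower_tail[OF E])
    show "sqn (w a) \<le> c" if "a \<in> E" for a
      using R(1)[OF that] R(2) n unfolding w_def rescale(2)[OF L] by (simp add: L_def c_def field_simps)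
    show "\<mu> / L * sqn u \<le> (\<Sum>a\<in>E. \<rho> a * (cmod (dot u (w a)))\<^sup>2)" for u
      using divide_right_mono[OF \<mu>(1)[of u] less_imp_le[OF L]] unfolding w_def rescale(1)[OF L]
      by (simp add: sum_divide_distrib)
  qed (use c s \<mu> L in auto)
  also have "(\<lambda>j. of_bool (\<exists>u. (\<Sum>l<n. (cmod (dot u (w (j l))))\<^sup>2) < s * sqn u))
      = (\<lambda>j. of_bool (\<exists>u. (\<Sum>l<n. (cmod (dot u (v (j l))))\<^sup>2) < n * \<mu> / 2 * sqn u))"
  proof -
    have sL: "s * L = n * \<mu> / 2" using R(2) by (simp add: s_def L_def)
    have "(\<Sum>l<n. (cmod (dot u (w (j l))))\<^sup>2) < s * sqn u \<longleftrightarrow> (\<Sum>l<n. (cmod (dot u (v (j l))))\<^sup>2) < n * \<mu> / 2 * sqn u" for u j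
      unfolding w_def rescale(1)[OF L] sum_divide_distrib[symmetric] sL[symmetric]
      using L by (simp add: pos_divide_less_eq mult_ac)
    then show ?thesis by simp
  qed
  also have "card I * exp (- (n * (\<mu> / L) * (99/100) * ((99/100) / c * (1 - (1 - c / (99/100)) ^ (2 * (25 * n)))))) / (1 - s) ^ (2 * (25 * n))
      \<le> card I * exp (- (n * \<mu> / (8 * R)))"
  proof -
    let ?x = "n * \<mu> / R"
    have x: "0 \<le> ?x" using \<mu> R by simp
    have "(1 - c / (99/100)) ^ (2 * (25 * n)) \<le> 8 / 13"
    proof -
      have "(1 - c / (99/100)) ^ (2 * (25 * n)) \<le> exp (- (c / (99/100))) ^ (2 * (25 * n))"
        using c exp_ge_add_one_self[of "- (c / (99/100))"] by (intro power_mono) auto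
      also have "\<dots> = exp (- (50 * (n * c) / (99/100)))"
        by (simp add: exp_of_nat_mult[symmetric])
      also have "\<dots> \<le> exp (- (1/2))" using c by simp
      also have "\<dots> \<le> 8 / 13"
        using exp_lower_Taylor_quadratic[of "1/2 :: real"] by (simp add: exp_minus field_simps power2_eq_square)
      finally show ?thesis .
    qed
    then have g: "5 / 13 \<le> 1 - (1 - c / (99/100)) ^ (2 * (25 * n))" by simp
    have "n * (\<mu> / L) * (99/100) * ((99/100) / c) = ?x * (9801/10000)"
      using R n by (simp add: L_def c_def field_simps)
    then have eq: "n * (\<mu> / L) * (99/100) * ((99/100) / c * g) = ?x * (9801/10000) * g" for g
      by (simp only: mult.assoc[symmetric])
    have e1: "exp (- (n * (\<mu> / L) * (99/100) * ((99/100) / c * (1 - (1 - c / (99/100)) ^ (2 * (25 * n))))))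
      \<le> exp (- (?x * (9801/10000) * (5/13)))"
      unfolding eq exp_le_cancel_iff neg_le_iff_le
      by (intro mult_left_mono[OF g] mult_nonneg_nonneg[OF x]) simp
    have e2: "exp (- (?x * (50/199))) \<le> (1 - s) ^ (2 * (25 * n))"
    proof -
      have "1 / (1 - s) \<le> exp (s / (1 - s))"
        using exp_ge_add_one_self[of "s / (1 - s)"] s by (simp add: field_simps)
      also have "\<dots> \<le> exp (s * (200/199))"
      proof -
        have "s / (1 - s) \<le> s / (199/200)" using s by (intro divide_left_mono) auto
        then show ?thesis by simp
      qed
      finally have "exp (- (s * (200/199))) \<le> 1 - s"
        using s by (simp add: exp_minus field_simps)
      then have "exp (- (s * (200/199))) ^ (2 * (25 * n)) \<le> (1 - s) ^ (2 * (25 * n))"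
        by (intro power_mono) auto
      moreover have "exp (- (s * (200/199))) ^ (2 * (25 * n)) = exp (- (?x * (50/199)))"
        by (simp add: exp_of_nat_mult[symmetric] s_def)
      ultimately show ?thesis by simp
    qed
    have "exp (- (?x * (9801/10000) * (5/13))) / (1 - s) ^ (2 * (25 * n))
       \<le> exp (- (?x * (9801/10000) * (5/13))) / exp (- (?x * (50/199)))"
      using e2 s by (intro divide_left_mono mult_pos_pos) auto
    also have "\<dots> = exp (?x * (50/199) - ?x * (9801/10000) * (5/13))"
      by (simp add: exp_diff[symmetric])
    also have "\<dots> \<le> exp (- (n * \<mu> / (8 * R)))" 
    proof -
      have "?x * (50/199) - ?x * (9801/10000) * (5/13) = ?x * (50/199 - (9801/10000) * (5/13))"
        by (simp add: algebra_simps)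
      also have "\<dots> \<le> ?x * (- (1/8))" using x by (intro mult_left_mono) auto
      finally show ?thesis by simp
    qed
    finally have "exp (- (?x * (9801/10000) * (5/13))) / (1 - s) ^ (2 * (25 * n)) \<le> exp (- (n * \<mu> / (8 * R)))" .
    moreover have "exp (- (n * (\<mu> / L) * (99/100) * ((99/100) / c * (1 - (1 - c / (99/100)) ^ (2 * (25 * n)))))) / (1 - s) ^ (2 * (25 * n))
      \<le> exp (- (?x * (9801/10000) * (5/13))) / (1 - s) ^ (2 * (25 * n))"
      using e1 s by (intro divide_right_mono) auto
    ultimately show ?thesis
      unfolding times_divide_eq_right[symmetric] by (intro mult_left_mono) (rule order_trans, auto)
  qed
  finally show ?thesis .
qed

text \<open>
An upper Chernoff bound in which the total mean \<open>n * \<tau>\<close> of \<open>|v|\<^sup>2\<close>, in units of \<open>R\<close>, replaces the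
dimension.  After division by \<open>sqrt L\<close> with \<open>L = 4 * p * R\<close> the exponent \<open>p\<close> corresponds to the Laplace
parameter \<open>1 / (4 * R)\<close>, and \<open>p \<ge> S / R\<close> keeps the rescaled threshold \<open>S / L\<close> below \<open>1/4\<close>.  The summand
\<open>2 * n * \<mu>\<close> of the threshold compensates the exponential in the solution of the recursion.
\<close>

theorem sampled_frame_upper_tail:
  fixes v :: "'a \<Rightarrow> 'i \<Rightarrow> complex" and \<mu> \<tau> R z :: real
  assumes E: "finite E" "\<And>a. a \<in> E \<Longrightarrow> 0 \<le> \<rho> a" "sum \<rho> E = 1"
    and R: "\<And>a. a \<in> E \<Longrightarrow> sqn (v a) \<le> R" "0 < R"
    and \<mu>: "\<And>u. (\<Sum>a\<in>E. \<rho> a * (cmod (dot u (v a)))\<^sup>2) \<le> \<mu> * sqn u" "0 \<le> \<mu>"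
    and \<tau>: "(\<Sum>a\<in>E. \<rho> a * sqn (v a)) \<le> \<tau>" "0 \<le> \<tau>" and "0 < z"
  shows "sample_mean n E \<rho> (\<lambda>j. of_bool (\<exists>u. (2 * real n * \<mu> + z * R) * sqn u < (\<Sum>l<n. (cmod (dot u (v (j l))))\<^sup>2)))
       \<le> n * \<tau> / R / (exp (z / 5) - 1)"
proof -
  define S where "S = 2 * real n * \<mu> + z * R"
  define p where "p = nat \<lceil>S / R\<rceil>"
  define L where "L = 4 * p * R"
  define c where "c = 1 / (4 * real p)"
  define w where "w a = (\<lambda>k. complex_of_real (1 / sqrt L) * v a k)" for a
  have "0 < z * R" using assms by simp
  then have S: "0 < S" using \<mu>(2) unfolding S_def by (intro add_nonneg_pos) auto
  have p: "S / R \<le> p" "0 < p" using S R(2) by (simp_all add: p_def)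
  then have L: "0 < L" using R by (simp add: L_def)
  have c: "0 < c" using p by (simp add: c_def)
  let ?G = "(5/16) * (4 * real p)"
  let ?s = "S / L"
  have s: "0 < ?s" "?s \<le> 1 / 4" using S L p R by (simp_all add: L_def field_simps)
  have "sample_mean n E \<rho> (\<lambda>j. of_bool (\<exists>u. ?s * sqn u < (\<Sum>l<n. (cmod (dot u (w (j l))))\<^sup>2)))
     \<le> n * (\<tau> / L) * ?G * exp (n * (\<mu> / L) * ?G) / ((1 + ?s) ^ p - 1)"
  proof (rule scaled_upper_tail[OF E])
    show "sqn (w a) \<le> c" if "a \<in> E" for a
      using R(1)[OF that] R(2) p unfolding w_def rescale(2)[OF L] by (simp add: L_def c_def field_simps)
    show "(\<Sum>a\<in>E. \<rho> a * (cmod (dot u (w a)))\<^sup>2) \<le> \<mu> / L * sqn u" for u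
      using divide_right_mono[OF \<mu>(1)[of u] less_imp_le[OF L]] unfolding w_def rescale(1)[OF L]
      by (simp add: sum_divide_distrib)
    show "(\<Sum>a\<in>E. \<rho> a * sqn (w a)) \<le> \<tau> / L"
      using divide_right_mono[OF \<tau>(1) less_imp_le[OF L]] unfolding w_def rescale(2)[OF L]
      by (simp add: sum_divide_distrib)
    have "(1 + c) ^ p \<le> exp c ^ p"
      using c by (intro power_mono exp_ge_add_one_self) auto
    also have "\<dots> = exp (1/4)" using p by (simp add: exp_of_nat_mult[symmetric] c_def)
    also have "\<dots> \<le> 1 + 5/16" using exp_bound[of "1/4 :: real"] by (simp add: power2_eq_square)
    finally show "((1 + c) ^ p - 1) / c \<le> ?G" using p c by (simp add: c_def field_simps)
  qed (use c s \<mu> \<tau> L p in auto)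
  also have "(\<lambda>j. of_bool (\<exists>u. ?s * sqn u < (\<Sum>l<n. (cmod (dot u (w (j l))))\<^sup>2)))
      = (\<lambda>j. of_bool (\<exists>u. S * sqn u < (\<Sum>l<n. (cmod (dot u (v (j l))))\<^sup>2)))"
    unfolding w_def rescale(1)[OF L] sum_divide_distrib[symmetric] using L by (simp add: divide_less_cancel)
  also have "n * (\<tau> / L) * ?G * exp (n * (\<mu> / L) * ?G) / ((1 + ?s) ^ p - 1) \<le> n * \<tau> / R / (exp (z / 5) - 1)"
  proof -
    let ?y = "exp (2/5 * (n * \<mu> / R))"
    have y1: "1 \<le> ?y" using \<mu> R by simp
    have z1: "1 < exp (z / 5)" using \<open>0 < z\<close> by simp
    have "n * (\<mu> / L) * ?G = 5/16 * (n * \<mu> / R)" using p R by (simp add: L_def field_simps)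
    also have "\<dots> \<le> 2/5 * (n * \<mu> / R)" using \<mu> R by (intro mult_right_mono) auto
    finally have a: "exp (n * (\<mu> / L) * ?G) \<le> ?y" by simp
    have b: "n * (\<tau> / L) * ?G = 5/16 * (n * \<tau> / R)" using p R by (simp add: L_def field_simps)
    have d: "?y * (exp (z / 5) - 1) \<le> (1 + ?s) ^ p - 1"
    proof -
      have "exp (?s / (1 + ?s)) \<le> 1 + ?s" by (rule exp_le_one_plus[OF s(1)])
      moreover have "?s / (5/4) \<le> ?s / (1 + ?s)" using s by (intro divide_left_mono) auto
      ultimately have "exp (?s * (4/5)) \<le> 1 + ?s"
        by (smt (verit) exp_le_cancel_iff divide_divide_eq_right times_divide_eq_right)
      then have "exp (?s * (4/5)) ^ p \<le> (1 + ?s) ^ p" by (intro power_mono) auto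
      moreover have "exp (?s * (4/5)) ^ p = ?y * exp (z / 5)"
        using p R by (simp add: exp_of_nat_mult[symmetric] exp_add[symmetric] L_def S_def field_simps)
      ultimately have "?y * exp (z / 5) \<le> (1 + ?s) ^ p" by simp
      then show ?thesis using y1 unfolding right_diff_distrib by linarith
    qed
    have "n * (\<tau> / L) * ?G * exp (n * (\<mu> / L) * ?G) / ((1 + ?s) ^ p - 1)
       \<le> (n * \<tau> / R) * ?y / (?y * (exp (z / 5) - 1))"
    proof (rule frac_le)
      have "5/16 * (n * \<tau> / R) \<le> 1 * (n * \<tau> / R)" using \<tau> R by (intro mult_right_mono) auto
      then show "n * (\<tau> / L) * ?G * exp (n * (\<mu> / L) * ?G) \<le> (n * \<tau> / R) * ?y"
        unfolding b using a \<tau> R by (intro mult_mono) auto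
    qed (use d z1 \<tau> R in auto)
    also have "\<dots> = n * \<tau> / R / (exp (z / 5) - 1)" by simp
    finally show ?thesis .
  qed
  finally show ?thesis unfolding S_def .
qed

end

section \<open>Stability of weighted least squares\<close>

lemma mult_mat_vec_index:
  assumes "M \<in> carrier_mat r m" "dim_vec a = m" "i < r"
  shows "(M *\<^sub>v a) $ i = (\<Sum>j<m. M $$ (i, j) * a $ j)"
  using assms by (auto simp: scalar_prod_def lessThan_atLeast0 intro!: sum.cong)

lemma adjoint_weight_apply:
  assumes "dim_vec y = n" "j < card I"
  shows "(mat_adjoint (system_matrix I b n xs) *\<^sub>v (weight_matrix n w *\<^sub>v y)) $ j
       = (\<Sum>i<n. cnj (b (sorted_list_of_set I ! j) (xs i)) * (of_real (w i) * y $ i))"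
proof -
  let ?L = "system_matrix I b n xs" and ?W = "weight_matrix n w"
  have L: "?L \<in> carrier_mat n (card I)" by (simp add: system_matrix_def)
  have W: "?W \<in> carrier_mat n n" by (simp add: weight_matrix_def)
  have LA: "mat_adjoint ?L \<in> carrier_mat (card I) n" 
    unfolding mat_adjoint_def using L by (intro carrier_matI) auto
  have Wy: "(?W *\<^sub>v y) $ i = of_real (w i) * y $ i" if "i < n" for i
  proof -
    have "(?W *\<^sub>v y) $ i = (\<Sum>k<n. (if k = i then of_real (w i) * y $ k else 0))"
      unfolding mult_mat_vec_index[OF W assms(1) that]
      using that by (intro sum.cong) (auto simp: weight_matrix_def mat_diag_def)
    then show ?thesis using that by simp
  qed
  have entry: "mat_adjoint ?L $$ (j, i) = cnj (b (sorted_list_of_set I ! j) (xs i))" if "i < n" for i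
    using assms(2) that by (simp add: mat_adjoint_def mat_of_rows_index system_matrix_def)
  have d: "dim_vec (?W *\<^sub>v y) = n" using W by simp
  have "(mat_adjoint ?L *\<^sub>v (?W *\<^sub>v y)) $ j = (\<Sum>i<n. mat_adjoint ?L $$ (j, i) * (?W *\<^sub>v y) $ i)"
    by (rule mult_mat_vec_index[OF LA d assms(2)])
  also have "\<dots> = (\<Sum>i<n. cnj (b (sorted_list_of_set I ! j) (xs i)) * (of_real (w i) * y $ i))"
    by (intro sum.cong) (auto simp only: Wy entry lessThan_iff)
  finally show ?thesis .
qed

lemma system_matrix_apply:
  assumes "dim_vec a = card I" "i < n"
  shows "(system_matrix I b n xs *\<^sub>v a) $ i = (\<Sum>k<card I. b (sorted_list_of_set I ! k) (xs i) * a $ k)"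
proof -
  have L: "system_matrix I b n xs \<in> carrier_mat n (card I)" by (simp add: system_matrix_def)
  show ?thesis unfolding mult_mat_vec_index[OF L assms]
    using assms by (simp add: system_matrix_def)
qed

lemma invertible_mat_of_inverse_mult:
  assumes N: "N \<in> carrier_mat m (m::nat)" and inj: "\<And>a. a \<in> carrier_vec m \<Longrightarrow> N *\<^sub>v a = 0\<^sub>v m \<Longrightarrow> a = 0\<^sub>v m"
  shows "invertible_mat (N :: complex mat)"
    and "\<exists>B. mat_inverse N = Some B \<and> B \<in> carrier_mat m m \<and> N * B = 1\<^sub>m m \<and> B * N = 1\<^sub>m m"
proof -
  have "det N \<noteq> 0" using det_0_iff_vec_prod_zero_field[OF N] inj by blast
  then have "N \<in> Units (ring_mat TYPE(complex) m ())"
    by (rule det_non_zero_imp_unit[OF N])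
  then obtain B where B: "mat_inverse N = Some B"
    using mat_inverse(1)[OF N, where b = "()"] by (cases "mat_inverse N") auto
  then have *: "N * B = 1\<^sub>m m \<and> B * N = 1\<^sub>m m \<and> B \<in> carrier_mat m m"
    by (rule mat_inverse(2)[OF N])
  with B show "\<exists>B. mat_inverse N = Some B \<and> B \<in> carrier_mat m m \<and> N * B = 1\<^sub>m m \<and> B * N = 1\<^sub>m m"
    by blast
  show "invertible_mat N"
    unfolding invertible_mat_def inverts_mat_def using * N by (intro conjI exI[of _ B]) auto
qed

text \<open>
The vector of differences \<open>a - c\<close> solves the normal equations with the residual of \<open>c\<close> as data.
Testing them with the solution itself and completing the square shows that the fitted function has
no more weighted energy than the data; the assumed lower bound turns this into a bound on the
coefficients.  With zero data it gives injectivity, hence invertibility.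
\<close>

theorem wls_stable:
  fixes b :: "nat \<Rightarrow> 'a \<Rightarrow> complex"
  assumes I: "finite I" and w: "\<And>i. i < n \<Longrightarrow> 0 \<le> w i" and \<gamma>: "0 < \<gamma>"
    and lower: "\<And>u. \<gamma> * (\<Sum>k\<in>I. (cmod (u k))\<^sup>2) \<le> (\<Sum>i<n. w i * (cmod (\<Sum>k\<in>I. u k * b k (xs i)))\<^sup>2)"
  shows "wls_well_defined I b n xs w"
    and "\<exists>a. wls I b n xs w f = (\<lambda>y. \<Sum>k\<in>I. a k * b k y) \<and>
          (\<forall>c. \<gamma> * (\<Sum>k\<in>I. (cmod (c k - a k))\<^sup>2) \<le> (\<Sum>i<n. w i * (cmod (f (xs i) - (\<Sum>k\<in>I. c k * b k (xs i))))\<^sup>2))"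
proof -
  let ?m = "card I"
  let ?s = "\<lambda>j. sorted_list_of_set I ! j"
  let ?L = "system_matrix I b n xs" and ?W = "weight_matrix n w"
  let ?N = "normal_matrix I b n xs w"
  have L: "?L \<in> carrier_mat n ?m" by (simp add: system_matrix_def)
  have W: "?W \<in> carrier_mat n n" by (simp add: weight_matrix_def)
  have LA: "mat_adjoint ?L \<in> carrier_mat ?m n" 
    unfolding mat_adjoint_def using L by (intro carrier_matI) auto
  have N: "?N \<in> carrier_mat ?m ?m" unfolding normal_matrix_def using L W LA by simp
  have bij: "bij_betw ?s {..<?m} I"
    using bij_betw_nth[of "sorted_list_of_set I"] I by (simp add: lessThan_atLeast0)
  have reindex: "(\<Sum>k\<in>I. h k) = (\<Sum>j<?m. h (?s j))" for h :: "nat \<Rightarrow> 'c::comm_monoid_add"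
    by (rule sum.reindex_bij_betw[OF bij, symmetric])
  define pos where "pos = the_inv_into {..<?m} ?s"
  have pos: "pos (?s j) = j" if "j < ?m" for j
    unfolding pos_def using that bij by (intro the_inv_into_f_f) (auto simp: bij_betw_def)
  have energy: "(\<Sum>i<n. w i * (cmod (\<Sum>k\<in>I. u k * b k (xs i)))\<^sup>2)
      \<le> (\<Sum>i<n. w i * (cmod (g i))\<^sup>2)"
    if normal: "\<And>j. j < ?m \<Longrightarrow> (\<Sum>i<n. cnj (b (?s j) (xs i)) * (of_real (w i) * (\<Sum>k\<in>I. u k * b k (xs i))))
         = (\<Sum>i<n. cnj (b (?s j) (xs i)) * (of_real (w i) * g i))" for u g
  proof -
    let ?h = "\<lambda>i. \<Sum>k\<in>I. u k * b k (xs i)"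
    have expand: "(\<Sum>i<n. of_real (w i) * (cnj (?h i) * q i))
        = (\<Sum>j<?m. cnj (u (?s j)) * (\<Sum>i<n. cnj (b (?s j) (xs i)) * (of_real (w i) * q i)))" for q
      unfolding sum_distrib_left
      by (subst sum.swap) (simp add: reindex sum_distrib_left sum_distrib_right mult_ac)
    have "(\<Sum>i<n. of_real (w i) * (cnj (?h i) * ?h i)) = (\<Sum>j<?m. cnj (u (?s j)) * (\<Sum>i<n. cnj (b (?s j) (xs i)) * (of_real (w i) * ?h i)))"
      by (rule expand)
    also have "\<dots> = (\<Sum>j<?m. cnj (u (?s j)) * (\<Sum>i<n. cnj (b (?s j) (xs i)) * (of_real (w i) * g i)))"
      by (intro sum.cong) (simp_all add: normal)
    also have "\<dots> = (\<Sum>i<n. of_real (w i) * (cnj (?h i) * g i))"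
      by (rule expand[symmetric])
    finally have "(\<Sum>i<n. of_real (w i) * (cnj (?h i) * ?h i)) = (\<Sum>i<n. of_real (w i) * (cnj (?h i) * g i))" .
    then have "Re (\<Sum>i<n. of_real (w i) * (cnj (?h i) * ?h i)) = Re (\<Sum>i<n. of_real (w i) * (cnj (?h i) * g i))"
      by (rule arg_cong)
    moreover have "Re (cnj (?h i) * ?h i) = (cmod (?h i))\<^sup>2" for i
      by (metis Re_complex_of_real complex_norm_square mult.commute of_real_power)
    ultimately have eq: "(\<Sum>i<n. w i * (cmod (?h i))\<^sup>2) = (\<Sum>i<n. w i * Re (cnj (?h i) * g i))"
      by (simp del: complex_cnj_mult add: mult.assoc)
    have "w i * (cmod (?h i))\<^sup>2 \<le> 2 * (w i * (cmod (?h i))\<^sup>2) + w i * (cmod (g i))\<^sup>2 - 2 * (w i * Re (cnj (?h i) * g i))" if "i < n" for i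
    proof -
      have "Re (cnj (?h i) * g i) \<le> cmod (?h i) * cmod (g i)"
        using complex_Re_le_cmod[of "cnj (?h i) * g i"] unfolding norm_mult complex_mod_cnj .
      then have "2 * Re (cnj (?h i) * g i) \<le> (cmod (?h i))\<^sup>2 + (cmod (g i))\<^sup>2"
        using sum_squares_bound[of "cmod (?h i)" "cmod (g i)"] by linarith
      from mult_left_mono[OF this w[OF that]] show ?thesis by (simp add: algebra_simps)
    qed
    then have "(\<Sum>i<n. w i * (cmod (?h i))\<^sup>2) \<le> (\<Sum>i<n. 2 * (w i * (cmod (?h i))\<^sup>2) + w i * (cmod (g i))\<^sup>2 - 2 * (w i * Re (cnj (?h i) * g i)))"
      by (intro sum_mono) auto
    also have "\<dots> = 2 * (\<Sum>i<n. w i * (cmod (?h i))\<^sup>2) + (\<Sum>i<n. w i * (cmod (g i))\<^sup>2) - 2 * (\<Sum>i<n. w i * Re (cnj (?h i) * g i))"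
      by (simp only: sum.distrib sum_subtractf sum_distrib_left)
    finally show ?thesis using eq by linarith
  qed
  have Nv: "(?N *\<^sub>v a) $ j = (\<Sum>i<n. cnj (b (?s j) (xs i)) * (of_real (w i) * (\<Sum>k\<in>I. a $ (pos k) * b k (xs i))))"
    if a: "a \<in> carrier_vec ?m" and j: "j < ?m" for a j
  proof -
    have "?N *\<^sub>v a = mat_adjoint ?L *\<^sub>v (?W *\<^sub>v (?L *\<^sub>v a))"
      unfolding normal_matrix_def assoc_mult_mat_vec[OF mult_carrier_mat[OF LA W] L a]
        assoc_mult_mat_vec[OF LA W mult_mat_vec_carrier[OF L a]] ..
    moreover have "dim_vec (?L *\<^sub>v a) = n" using L by simp
    ultimately show ?thesis
      using a j by (simp add: adjoint_weight_apply system_matrix_apply reindex pos mult.commute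
          del: index_mult_mat_vec)
  qed
  have inj: "a = 0\<^sub>v ?m" if a: "a \<in> carrier_vec ?m" "?N *\<^sub>v a = 0\<^sub>v ?m" for a
  proof -
    let ?u = "\<lambda>k. a $ pos k"
    have "(\<Sum>i<n. w i * (cmod (\<Sum>k\<in>I. ?u k * b k (xs i)))\<^sup>2) \<le> (\<Sum>i<n. w i * (cmod 0)\<^sup>2)"
      by (rule energy[of ?u "\<lambda>_. 0"]) (use Nv[OF a(1)] a(2) in simp)
    then have "\<gamma> * (\<Sum>k\<in>I. (cmod (?u k))\<^sup>2) \<le> 0" using lower[of ?u] by simp
    then have "(\<Sum>k\<in>I. (cmod (?u k))\<^sup>2) \<le> 0" using \<gamma> by (simp add: mult_le_0_iff)
    then have "(\<Sum>k\<in>I. (cmod (?u k))\<^sup>2) = 0" by (intro antisym sum_nonneg) auto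
    then have "(cmod (?u k))\<^sup>2 = 0" if "k \<in> I" for k
      using that I by (simp add: sum_nonneg_eq_0_iff)
    then have "a $ j = 0" if "j < ?m" for j
      using pos[OF that] bij that by (metis bij_betwE lessThan_iff norm_eq_zero zero_eq_power2)
    then show ?thesis using a(1) by (intro eq_vecI) auto
  qed
  show "wls_well_defined I b n xs w"
    unfolding wls_well_defined_def by (rule invertible_mat_of_inverse_mult(1)[OF N inj])
  obtain B where B: "mat_inverse ?N = Some B" "B \<in> carrier_mat ?m ?m" "?N * B = 1\<^sub>m ?m"
    using invertible_mat_of_inverse_mult(2)[OF N inj] by blast
  define y where "y = Matrix.vec n (\<lambda>i. f (xs i))"
  define a where "a = wls_coeffs I b n xs w f"
  have y: "y \<in> carrier_vec n" by (simp add: y_def)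
  have a_eq: "a = B *\<^sub>v (mat_adjoint ?L *\<^sub>v (?W *\<^sub>v y))"
    unfolding a_def wls_coeffs_def y_def[symmetric] B(1) option.sel
      assoc_mult_mat_vec[OF mult_carrier_mat[OF B(2) LA] W y]
      assoc_mult_mat_vec[OF B(2) LA mult_mat_vec_carrier[OF W y]] ..
  have a: "a \<in> carrier_vec ?m" unfolding a_eq
    by (rule mult_mat_vec_carrier[OF B(2) mult_mat_vec_carrier[OF LA mult_mat_vec_carrier[OF W y]]])
  have Na: "?N *\<^sub>v a = mat_adjoint ?L *\<^sub>v (?W *\<^sub>v y)"
  proof -
    have "mat_adjoint ?L *\<^sub>v (?W *\<^sub>v y) \<in> carrier_vec ?m"
      by (rule mult_mat_vec_carrier[OF LA mult_mat_vec_carrier[OF W y]])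
    then show ?thesis unfolding a_eq
      using assoc_mult_mat_vec[OF N B(2)] B(3) by (metis one_mult_mat_vec)
  qed
  let ?a = "\<lambda>k. a $ pos k"
  show "\<exists>a. wls I b n xs w f = (\<lambda>y. \<Sum>k\<in>I. a k * b k y) \<and>
          (\<forall>c. \<gamma> * (\<Sum>k\<in>I. (cmod (c k - a k))\<^sup>2) \<le> (\<Sum>i<n. w i * (cmod (f (xs i) - (\<Sum>k\<in>I. c k * b k (xs i))))\<^sup>2))"
  proof (intro exI[of _ ?a] conjI allI)
    show "wls I b n xs w f = (\<lambda>y. \<Sum>k\<in>I. ?a k * b k y)"
      unfolding wls_def a_def[symmetric] reindex by (simp add: pos)
    fix c :: "nat \<Rightarrow> complex"
    let ?u = "\<lambda>k. ?a k - c k" and ?g = "\<lambda>i. f (xs i) - (\<Sum>k\<in>I. c k * b k (xs i))"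
    have "(\<Sum>i<n. w i * (cmod (\<Sum>k\<in>I. ?u k * b k (xs i)))\<^sup>2) \<le> (\<Sum>i<n. w i * (cmod (?g i))\<^sup>2)"
    proof (rule energy)
      fix j assume j: "j < ?m"
      have "(\<Sum>i<n. cnj (b (?s j) (xs i)) * (of_real (w i) * (\<Sum>k\<in>I. ?a k * b k (xs i))))
          = (\<Sum>i<n. cnj (b (?s j) (xs i)) * (of_real (w i) * f (xs i)))"
        using Nv[OF a j] Na adjoint_weight_apply[of y n j I b xs w] y j by (simp add: y_def)
      then show "(\<Sum>i<n. cnj (b (?s j) (xs i)) * (of_real (w i) * (\<Sum>k\<in>I. ?u k * b k (xs i))))
          = (\<Sum>i<n. cnj (b (?s j) (xs i)) * (of_real (w i) * ?g i))"
        by (simp add: left_diff_distrib right_diff_distrib sum_subtractf)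
    qed
    then show "\<gamma> * (\<Sum>k\<in>I. (cmod (c k - ?a k))\<^sup>2) \<le> (\<Sum>i<n. w i * (cmod (?g i))\<^sup>2)"
      using lower[of ?u] by (simp add: norm_minus_commute)
  qed
qed

section \<open>Spectral energies in the reproducing kernel space\<close>

context rkhs
begin

lemma diff_mem: "f \<in> H \<Longrightarrow> g \<in> H \<Longrightarrow> (\<lambda>x. f x - g x) \<in> H"
  using add_mem[OF _ scale_mem[of g "- 1"], of f] by simp

lemma sum_mem: "(\<And>k. k \<in> F \<Longrightarrow> g k \<in> H) \<Longrightarrow> (\<lambda>x. \<Sum>k\<in>F. c k * g k x) \<in> H"
  by (induction F rule: infinite_finite_induct) (auto simp: zero_mem intro!: add_mem scale_mem)

lemma ip_zero: "h \<in> H \<Longrightarrow> ip (\<lambda>x. 0) h = 0"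
  using ip_scale[OF zero_mem, of h 0] by simp

lemma ip_diff: "f \<in> H \<Longrightarrow> g \<in> H \<Longrightarrow> h \<in> H \<Longrightarrow> ip (\<lambda>x. f x - g x) h = ip f h - ip g h"
  using ip_add[OF _ scale_mem[of g "- 1"], of f h] ip_scale[of g h "- 1"] by simp

lemma ip_sum:
  "(\<And>k. k \<in> F \<Longrightarrow> g k \<in> H) \<Longrightarrow> h \<in> H \<Longrightarrow> ip (\<lambda>x. \<Sum>k\<in>F. c k * g k x) h = (\<Sum>k\<in>F. c k * ip (g k) h)"
  by (induction F rule: infinite_finite_induct)
     (auto simp: ip_zero ip_add ip_scale scale_mem sum_mem)

lemma ip_scale_right: "f \<in> H \<Longrightarrow> h \<in> H \<Longrightarrow> ip h (\<lambda>x. c * f x) = cnj c * ip h f"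
  by (subst ip_cnj[OF scale_mem]) (auto simp: ip_scale ip_cnj[of h f])

lemma ip_self: "f \<in> H \<Longrightarrow> ip f f = of_real (Re (ip f f))"
  using ip_cnj[of f f] by (simp add: complex_eq_iff)

lemma ip_Cauchy_Schwarz:
  assumes "f \<in> H" "g \<in> H"
  shows "(cmod (ip f g))\<^sup>2 \<le> Re (ip f f) * Re (ip g g)"
proof (cases "ip g g = 0")
  case True
  then have "g = (\<lambda>x. 0)" using assms ip_definite by blast
  then have "ip f g = 0" using ip_zero[OF assms(1)] ip_cnj[OF assms(1) zero_mem] assms
    by (metis complex_cnj_zero_iff)
  then show ?thesis using ip_nonneg assms by simp
next
  case False
  define b where "b = Re (ip g g)"
  have gg: "ip g g = of_real b" using ip_self[OF assms(2)] by (simp add: b_def)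
  then have "b \<noteq> 0" using False by auto
  then have b: "0 < b" using ip_nonneg[OF assms(2)] by (simp add: b_def less_le)
  define c where "c = ip f g / of_real b"
  let ?r = "\<lambda>x. f x - c * g x"
  have r: "?r \<in> H" using assms by (intro diff_mem scale_mem)
  have cg: "(\<lambda>x. c * g x) \<in> H" using assms by (intro scale_mem)
  have rg: "ip ?r g = 0" 
    unfolding ip_diff[OF assms(1) cg assms(2)] ip_scale[OF assms(2,2)] gg using b by (simp add: c_def)
  then have rcg: "ip ?r (\<lambda>x. c * g x) = 0" using ip_scale_right[OF assms(2) r] by simp
  then have "ip (\<lambda>x. c * g x) ?r = 0" using ip_cnj[OF r cg] by simp
  then have "ip ?r ?r = ip f ?r" using ip_diff[OF assms(1) cg r] by simp
  also have "\<dots> = cnj (ip f f) - cnj (c * ip g f)"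
    using ip_cnj[OF r assms(1)] ip_diff[OF assms(1) cg assms(1)] ip_scale[OF assms(2,1)] by simp
  also have "cnj (c * ip g f) = of_real ((cmod (ip f g))\<^sup>2 / b)"
    using complex_norm_square[of "ip f g"] ip_cnj[OF assms] by (simp add: c_def mult.commute)
  finally have "Re (ip ?r ?r) = Re (ip f f) - (cmod (ip f g))\<^sup>2 / b" by simp
  then have "(cmod (ip f g))\<^sup>2 / b \<le> Re (ip f f)" using ip_nonneg[OF r] by simp
  then show ?thesis using b by (simp add: b_def[symmetric] pos_divide_le_eq)
qed

lemma cmod_ip_le: 
  assumes "f \<in> H" "g \<in> H"
  shows "cmod (ip f g) \<le> hnorm ip f * hnorm ip g"
proof -
  have "cmod (ip f g) = sqrt ((cmod (ip f g))\<^sup>2)" by simp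
  also have "\<dots> \<le> sqrt (Re (ip f f) * Re (ip g g))" using ip_Cauchy_Schwarz[OF assms] by (rule real_sqrt_le_mono)
  finally show ?thesis by (simp add: hnorm_def real_sqrt_mult)
qed

lemma point_evaluation_bound:
  assumes "f \<in> H" "x \<in> D"
  shows "(cmod (f x))\<^sup>2 \<le> Re (ip f f) * Re (K x x)"
proof -
  have "ip (kernel_section D K x) (kernel_section D K x) = K x x"
    using reproducing[OF section_mem[OF assms(2)] assms(2)] assms(2) by (simp add: kernel_section_def)
  then show ?thesis
    using ip_Cauchy_Schwarz[OF assms(1) section_mem[OF assms(2)]] reproducing[OF assms] by simp
qed

end

locale rkhs_embedding = rkhs D K H ip
  for D :: "'a set" and K :: "'a \<Rightarrow> 'a \<Rightarrow> complex" and H :: "('a \<Rightarrow> complex) set"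
    and ip :: "('a \<Rightarrow> complex) \<Rightarrow> ('a \<Rightarrow> complex) \<Rightarrow> complex" +
  fixes \<nu> :: "'a measure" and S :: "('a \<Rightarrow> complex) \<Rightarrow> 'a \<Rightarrow> complex"
    and lam :: "nat \<Rightarrow> real" and e :: "nat \<Rightarrow> 'a \<Rightarrow> complex"
  assumes space_\<nu>: "space \<nu> = D" and measurable_H: "H \<subseteq> borel_measurable \<nu>"
    and finite_trace: "integrable \<nu> (\<lambda>y. Re (K y y))"
    and adjoint: "embedding_adjoint \<nu> H ip S"
    and eigen: "eigensystem H ip S lam e"
begin

lemma e_mem: "e k \<in> H" and lam_nonneg: "0 \<le> lam k" and decseq_lam: "decseq lam"
  using eigen by (auto simp: eigensystem_def)

lemma e_orthonormal: "0 < lam j \<Longrightarrow> 0 < lam k \<Longrightarrow> ip (e j) (e k) = (if j = k then 1 else 0)"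
  using eigen by (auto simp: eigensystem_def)

lemma H_square_integrable:
  assumes "f \<in> H"
  shows "f \<in> square_integrable \<nu>"
proof -
  have f: "f \<in> borel_measurable \<nu>" using assms measurable_H by blast
  have "integrable \<nu> (\<lambda>x. (cmod (f x))\<^sup>2)"
  proof (rule Bochner_Integration.integrable_bound)
    show "integrable \<nu> (\<lambda>y. Re (ip f f) * Re (K y y))" using finite_trace by simp
    show "(\<lambda>x. (cmod (f x))\<^sup>2) \<in> borel_measurable \<nu>" using f by measurable
    show "AE x in \<nu>. norm ((cmod (f x))\<^sup>2) \<le> norm (Re (ip f f) * Re (K x x))"
      using point_evaluation_bound[OF assms] 
      by (intro AE_I2) (metis abs_ge_self abs_of_nonneg order_trans real_norm_def space_\<nu> zero_le_power2)
  qed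
  then show ?thesis using f by (simp add: square_integrable_def)
qed

lemma S_mem: "f \<in> H \<Longrightarrow> S f \<in> H"
  and ip_S: "f \<in> H \<Longrightarrow> h \<in> H \<Longrightarrow> ip (S f) h = l2_inner \<nu> f h"
  using adjoint H_square_integrable by (auto simp: embedding_adjoint_def)

lemma l2_norm_sq_eq:
  assumes "f \<in> H"
  shows "l2_norm_sq \<nu> f = ennreal (Re (ip (S f) f))"
proof -
  have int: "integrable \<nu> (\<lambda>x. (cmod (f x))\<^sup>2)"
    using H_square_integrable[OF assms] by (simp add: square_integrable_def)
  have "l2_norm_sq \<nu> f = ennreal (\<integral>x. (cmod (f x))\<^sup>2 \<partial>\<nu>)"
    unfolding l2_norm_sq_def by (rule nn_integral_eq_integral[OF int]) simp
  also have "(\<integral>x. (cmod (f x))\<^sup>2 \<partial>\<nu>) = Re (l2_inner \<nu> f f)"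
    unfolding l2_inner_def complex_norm_square[symmetric]
    by (subst integral_complex_of_real) simp
  finally show ?thesis using ip_S[OF assms assms] by simp
qed

definition partial_sum where
  "partial_sum f N = (\<lambda>x. \<Sum>k<N. of_real (lam k) * ip f (e k) * e k x)"

lemma partial_sum_mem: "partial_sum f N \<in> H"
  unfolding partial_sum_def by (intro sum_mem e_mem)

lemma partial_sum_tendsto:
  assumes "f \<in> H" "h \<in> H"
  shows "(\<lambda>N. ip (partial_sum f N) h) \<longlonglongrightarrow> ip (S f) h"
proof -
  have "(\<lambda>N. hnorm ip (\<lambda>x. S f x - partial_sum f N x)) \<longlonglongrightarrow> 0"
    using eigen assms(1) by (simp add: eigensystem_def partial_sum_def)
  then have "(\<lambda>N. hnorm ip (\<lambda>x. S f x - partial_sum f N x) * hnorm ip h) \<longlonglongrightarrow> 0"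
    by (auto intro: tendsto_eq_intros)
  then have "(\<lambda>N. ip (S f) h - ip (partial_sum f N) h) \<longlonglongrightarrow> 0"
  proof (rule Lim_null_comparison[rotated], intro always_eventually allI)
    fix N
    show "norm (ip (S f) h - ip (partial_sum f N) h) \<le> hnorm ip (\<lambda>x. S f x - partial_sum f N x) * hnorm ip h"
      using cmod_ip_le[OF diff_mem[OF S_mem[OF assms(1)] partial_sum_mem] assms(2)]
        ip_diff[OF S_mem[OF assms(1)] partial_sum_mem assms(2)] by simp
  qed
  then have "(\<lambda>N. ip (S f) h - (ip (S f) h - ip (partial_sum f N) h)) \<longlonglongrightarrow> ip (S f) h - 0"
    by (intro tendsto_intros)
  then show ?thesis by simp
qed

text \<open>
The squared norm in \<open>L\<^sub>2\<close> is \<open>\<langle>S f, f\<rangle>\<close>, and the spectral series for \<open>S f\<close> can be tested with \<open>f\<close>.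
\<close>

lemma spectral_energy_tendsto:
  assumes "f \<in> H"
  shows "(\<lambda>N. \<Sum>k<N. lam k * (cmod (ip f (e k)))\<^sup>2) \<longlonglongrightarrow> Re (ip (S f) f)"
proof -
  have "ip (partial_sum f N) f = of_real (\<Sum>k<N. lam k * (cmod (ip f (e k)))\<^sup>2)" for N
  proof -
    have "ip (partial_sum f N) f = (\<Sum>k<N. of_real (lam k) * ip f (e k) * ip (e k) f)"
      unfolding partial_sum_def by (intro ip_sum e_mem assms)
    also have "\<dots> = (\<Sum>k<N. of_real (lam k * (cmod (ip f (e k)))\<^sup>2))"
      using complex_norm_square ip_cnj[OF assms e_mem] by (intro sum.cong) (simp_all add: mult.assoc)
    finally show ?thesis by simp
  qed
  then show ?thesis using tendsto_Re[OF partial_sum_tendsto[OF assms assms]] by simp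
qed

lemma ip_S_e:
  assumes "f \<in> H" "0 < lam k"
  shows "ip (S f) (e k) = of_real (lam k) * ip f (e k)"
proof -
  have "ip (partial_sum f N) (e k) = of_real (lam k) * ip f (e k)" if "k < N" for N
  proof -
    have "ip (partial_sum f N) (e k) = (\<Sum>i<N. of_real (lam i) * ip f (e i) * ip (e i) (e k))"
      unfolding partial_sum_def by (intro ip_sum e_mem)
    also have "\<dots> = (\<Sum>i<N. if i = k then of_real (lam k) * ip f (e k) else 0)"
    proof (rule sum.cong)
      fix i
      show "of_real (lam i) * ip f (e i) * ip (e i) (e k) = (if i = k then of_real (lam k) * ip f (e k) else 0)"
        using e_orthonormal[of i k] assms(2) lam_nonneg[of i] by (cases "lam i = 0") auto
    qed simp
    finally show ?thesis using that by simp
  qed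
  then have "eventually (\<lambda>N. ip (partial_sum f N) (e k) = of_real (lam k) * ip f (e k)) sequentially"
    by (intro eventually_mono[OF eventually_gt_at_top[of k]])
  then have "(\<lambda>N. ip (partial_sum f N) (e k)) \<longlonglongrightarrow> of_real (lam k) * ip f (e k)"
    by (rule tendsto_eventually)
  with partial_sum_tendsto[OF assms(1) e_mem] show ?thesis by (rule LIMSEQ_unique)
qed

lemma ip_combination:
  assumes "finite F" "F \<subseteq> {k. 0 < lam k}" "0 < lam j"
  shows "ip (\<lambda>x. \<Sum>k\<in>F. c k * e k x) (e j) = (if j \<in> F then c j else 0)"
proof -
  have "ip (\<lambda>x. \<Sum>k\<in>F. c k * e k x) (e j) = (\<Sum>k\<in>F. c k * ip (e k) (e j))"
    by (intro ip_sum e_mem)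
  also have "\<dots> = (\<Sum>k\<in>F. if k = j then c j else 0)"
    using assms(2,3) by (intro sum.cong) (auto simp: e_orthonormal)
  finally show ?thesis using assms(1) by simp
qed

lemma Bessel:
  assumes "f \<in> H" "finite F" "F \<subseteq> {k. 0 < lam k}"
  shows "(\<Sum>k\<in>F. (cmod (ip f (e k)))\<^sup>2) \<le> Re (ip f f)"
proof -
  let ?p = "\<lambda>x. \<Sum>k\<in>F. ip f (e k) * e k x"
  let ?s = "\<Sum>k\<in>F. (cmod (ip f (e k)))\<^sup>2"
  have p: "?p \<in> H" by (intro sum_mem e_mem)
  have exp: "ip ?p h = (\<Sum>k\<in>F. ip f (e k) * ip (e k) h)" if "h \<in> H" for h
    using that by (intro ip_sum e_mem)
  have pf: "ip ?p f = of_real ?s"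
    unfolding exp[OF assms(1)] of_real_sum
    using complex_norm_square ip_cnj[OF assms(1) e_mem] by (intro sum.cong) simp_all
  have "ip ?p ?p = (\<Sum>k\<in>F. ip f (e k) * cnj (ip ?p (e k)))"
    unfolding exp[OF p] using ip_cnj[OF p e_mem] by simp
  also have "\<dots> = of_real ?s"
    unfolding of_real_sum complex_norm_square
    using assms(3) ip_combination[OF assms(2,3)] by (intro sum.cong) auto
  finally have pp: "ip ?p ?p = of_real ?s" .
  have "?s\<^sup>2 \<le> Re (ip f f) * ?s"
    using ip_Cauchy_Schwarz[OF p assms(1)] 
    unfolding pf pp Re_complex_of_real norm_of_real power2_abs by (simp only: mult.commute)
  moreover have "0 \<le> ?s" by (intro sum_nonneg) simp
  ultimately show ?thesis
    using ip_nonneg[OF assms(1)] by (cases "?s = 0") (auto simp: power2_eq_square)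
qed

lemma l2_norm_sq_combination:
  assumes "finite F" "F \<subseteq> {k. 0 < lam k}"
  shows "(\<lambda>x. \<Sum>k\<in>F. c k * e k x) \<in> H"
    and "l2_norm_sq \<nu> (\<lambda>x. \<Sum>k\<in>F. c k * e k x) = ennreal (\<Sum>k\<in>F. lam k * (cmod (c k))\<^sup>2)"
proof -
  let ?f = "\<lambda>x. \<Sum>k\<in>F. c k * e k x"
  show f: "?f \<in> H" by (intro sum_mem e_mem)
  have summand: "lam k * (cmod (ip ?f (e k)))\<^sup>2 = (if k \<in> F then lam k * (cmod (c k))\<^sup>2 else 0)" for k
    using ip_combination[OF assms, of k c] lam_nonneg[of k] assms(2) by (cases "lam k = 0") auto
  obtain N0 where N0: "F \<subseteq> {..<N0}" using assms(1) finite_nat_bounded by blast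
  have "(\<Sum>k<N. lam k * (cmod (ip ?f (e k)))\<^sup>2) = (\<Sum>k\<in>F. lam k * (cmod (c k))\<^sup>2)" if "N0 \<le> N" for N
  proof -
    have "F \<subseteq> {..<N}" using N0 that by auto
    then show ?thesis unfolding summand by (simp add: sum.inter_restrict[symmetric] Int_absorb1)
  qed
  then have "eventually (\<lambda>N. (\<Sum>k<N. lam k * (cmod (ip ?f (e k)))\<^sup>2) = (\<Sum>k\<in>F. lam k * (cmod (c k))\<^sup>2)) sequentially"
    by (intro eventually_mono[OF eventually_ge_at_top[of N0]])
  then have "(\<lambda>N. \<Sum>k<N. lam k * (cmod (ip ?f (e k)))\<^sup>2) \<longlonglongrightarrow> (\<Sum>k\<in>F. lam k * (cmod (c k))\<^sup>2)"
    by (rule tendsto_eventually)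
  from LIMSEQ_unique[OF spectral_energy_tendsto[OF f] this]
  show "l2_norm_sq \<nu> ?f = ennreal (\<Sum>k\<in>F. lam k * (cmod (c k))\<^sup>2)"
    using l2_norm_sq_eq[OF f] by simp
qed

text \<open>
For the error \<open>h\<close> of an approximation of \<open>f\<close> from the span over \<open>I\<close>: the coefficients outside \<open>I\<close> are
those of \<open>f\<close>, which contribute at most \<open>\<Lambda>\<close> by Bessel's inequality.
\<close>

lemma l2_norm_sq_le_split:
  assumes "f \<in> H" "Re (ip f f) \<le> 1" "h \<in> H" "finite I" "I \<subseteq> {k. 0 < lam k}"
    and tail: "\<And>k. k \<notin> I \<Longrightarrow> 0 < lam k \<Longrightarrow> ip h (e k) = ip f (e k)"
    and \<Lambda>: "\<And>k. k \<notin> I \<Longrightarrow> lam k \<le> \<Lambda>" "0 \<le> \<Lambda>"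
  shows "l2_norm_sq \<nu> h \<le> ennreal (\<Lambda> + (\<Sum>k\<in>I. lam k * (cmod (ip h (e k)))\<^sup>2))"
proof -
  have "(\<Sum>k<N. lam k * (cmod (ip h (e k)))\<^sup>2) \<le> \<Lambda> + (\<Sum>k\<in>I. lam k * (cmod (ip h (e k)))\<^sup>2)" for N
  proof -
    let ?F = "{k \<in> {..<N}. k \<notin> I \<and> 0 < lam k}"
    let ?q = "\<lambda>k. lam k * (cmod (ip h (e k)))\<^sup>2"
    have q0: "0 \<le> ?q k" for k using lam_nonneg by simp
    have "(\<Sum>k<N. ?q k) = (\<Sum>k\<in>{k \<in> {..<N}. 0 < lam k}. ?q k)"
      using lam_nonneg by (intro sum.mono_neutral_right) (auto simp: less_le)
    also have "\<dots> \<le> (\<Sum>k\<in>?F \<union> I. ?q k)"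
      using assms(4) q0 by (intro sum_mono2) auto
    also have "\<dots> = (\<Sum>k\<in>?F. ?q k) + (\<Sum>k\<in>I. ?q k)"
      using assms(4) by (intro sum.union_disjoint) auto
    also have "(\<Sum>k\<in>?F. ?q k) \<le> (\<Sum>k\<in>?F. \<Lambda> * (cmod (ip f (e k)))\<^sup>2)"
      using tail \<Lambda>(1) by (intro sum_mono) (auto intro!: mult_right_mono)
    also have "\<dots> \<le> \<Lambda> * 1"
    proof -
      have "(\<Sum>k\<in>?F. (cmod (ip f (e k)))\<^sup>2) \<le> Re (ip f f)"
        by (rule Bessel[OF assms(1)]) auto
      then show ?thesis
        unfolding sum_distrib_left[symmetric] using assms(2) \<Lambda>(2) by (intro mult_left_mono) linarith+
    qed
    finally show ?thesis by simp
  qed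
  then have "Re (ip (S h) h) \<le> \<Lambda> + (\<Sum>k\<in>I. lam k * (cmod (ip h (e k)))\<^sup>2)"
    by (intro LIMSEQ_le_const2[OF spectral_energy_tendsto[OF assms(3)]]) auto
  then show ?thesis unfolding l2_norm_sq_eq[OF assms(3)] by (rule ennreal_leI)
qed

end

section \<open>Sampling from a discrete Marcinkiewicz--Zygmund rule\<close>

lemma wls_cong:
  assumes "\<And>l. l < n \<Longrightarrow> xs l = xs' l" "\<And>l. l < n \<Longrightarrow> w l = w' l"
  shows "wls_well_defined I b n xs w = wls_well_defined I b n xs' w'"
    and "wls I b n xs w = wls I b n xs' w'"
proof -
  have L: "system_matrix I b n xs = system_matrix I b n xs'"
    unfolding system_matrix_def by (rule cong_mat) (auto simp: assms)
  have W: "weight_matrix n w = weight_matrix n w'"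
    unfolding weight_matrix_def mat_diag_def by (rule cong_mat) (auto simp: assms)
  have N: "normal_matrix I b n xs w = normal_matrix I b n xs' w'"
    unfolding normal_matrix_def L W ..
  show "wls_well_defined I b n xs w = wls_well_defined I b n xs' w'"
    unfolding wls_well_defined_def N ..
  have "Matrix.vec n (\<lambda>i. f (xs i)) = Matrix.vec n (\<lambda>i. f (xs' i))" for f :: "_ \<Rightarrow> complex"
    by (rule eq_vecI) (auto simp: assms)
  then show "wls I b n xs w = wls I b n xs' w'"
    unfolding wls_def wls_coeffs_def N L W by presburger
qed

text \<open>
Only finitely many values of the sample matter, so the event is a finite disjoint union of
cylinders.
\<close>

lemma measure_iid_sample:
  fixes J :: "nat \<Rightarrow> 'w \<Rightarrow> 'b"
  assumes \<Omega>: "prob_space \<Omega>" and indep: "prob_space.indep_vars \<Omega> (\<lambda>_. count_space E) J {..<n}"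
    and E: "finite E" and "0 < n"
    and law: "\<And>l i. l < n \<Longrightarrow> i \<in> E \<Longrightarrow> measure \<Omega> {s \<in> space \<Omega>. J l s = i} = \<rho> i"
    and local: "\<And>j j'. (\<And>l. l < n \<Longrightarrow> j l = j' l) \<Longrightarrow> \<Phi> j = \<Phi> j'"
  shows "measure \<Omega> {s \<in> space \<Omega>. \<Phi> (\<lambda>l. J l s)} = sample_mean n E \<rho> (\<lambda>j. of_bool (\<Phi> j))"
proof -
  interpret prob_space \<Omega> by fact
  let ?P = "PiE {..<n} (\<lambda>_. E)"
  define cell where "cell j = (\<Inter>l\<in>{..<n}. J l -` {j l} \<inter> space \<Omega>)" for j
  have rv: "J l \<in> measurable \<Omega> (count_space E)" if "l < n" for l
    using indep that unfolding indep_vars_def by auto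
  have Ji: "J l s \<in> E" if "l < n" "s \<in> space \<Omega>" for l s
    using measurable_space[OF rv[OF that(1)] that(2)] by simp
  have cell_iff: "s \<in> cell j \<longleftrightarrow> s \<in> space \<Omega> \<and> (\<forall>l<n. J l s = j l)" for s j
    using \<open>0 < n\<close> by (auto simp: cell_def)
  have cell_sets: "cell j \<in> sets \<Omega>" if "j \<in> ?P" for j
    unfolding cell_def using that \<open>0 < n\<close>
    by (intro sets.finite_INT) (auto intro!: measurable_sets[OF rv] simp: PiE_iff)
  have cell_prob: "measure \<Omega> (cell j) = (\<Prod>l<n. \<rho> (j l))" if j: "j \<in> ?P" for j
  proof -
    have "measure \<Omega> (cell j) = (\<Prod>l\<in>{..<n}. measure \<Omega> (J l -` {j l} \<inter> space \<Omega>))"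
      unfolding cell_def using \<open>0 < n\<close> j
      by (intro indep_varsD[OF indep]) (auto simp: PiE_iff)
    also have "\<dots> = (\<Prod>l<n. \<rho> (j l))"
    proof (rule prod.cong)
      fix l assume l: "l \<in> {..<n}"
      have "J l -` {j l} \<inter> space \<Omega> = {s \<in> space \<Omega>. J l s = j l}" by auto
      then show "measure \<Omega> (J l -` {j l} \<inter> space \<Omega>) = \<rho> (j l)"
        using law[of l "j l"] l j by (auto simp: PiE_iff)
    qed simp
    finally show ?thesis .
  qed
  have fin: "finite ?P" using E by (intro finite_PiE) auto
  let ?G = "{j \<in> ?P. \<Phi> j}"
  have "{s \<in> space \<Omega>. \<Phi> (\<lambda>l. J l s)} = (\<Union>j\<in>?G. cell j)"
  proof (rule equalityI; rule subsetI)
    fix s assume s: "s \<in> {s \<in> space \<Omega>. \<Phi> (\<lambda>l. J l s)}"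
    let ?j = "restrict (\<lambda>l. J l s) {..<n}"
    have "\<Phi> ?j" using s local[of "\<lambda>l. J l s" ?j] by simp
    moreover have "?j \<in> ?P" using s Ji by auto
    moreover have "s \<in> cell ?j" using s by (simp add: cell_iff)
    ultimately show "s \<in> (\<Union>j\<in>?G. cell j)" by blast
  next
    fix s assume "s \<in> (\<Union>j\<in>?G. cell j)"
    then obtain j where "\<Phi> j" "s \<in> space \<Omega>" "\<forall>l<n. J l s = j l" by (auto simp: cell_iff)
    then show "s \<in> {s \<in> space \<Omega>. \<Phi> (\<lambda>l. J l s)}" using local[of "\<lambda>l. J l s" j] by simp
  qed
  also have "measure \<Omega> \<dots> = (\<Sum>j\<in>?G. measure \<Omega> (cell j))"
  proof (rule finite_measure_finite_Union)
    show "disjoint_family_on cell ?G"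
    proof (clarsimp simp: disjoint_family_on_def)
      fix j j' assume "j \<in> ?P" "j' \<in> ?P" "j \<noteq> j'"
      then obtain l where "l < n" "j l \<noteq> j' l" by (metis PiE_ext lessThan_iff)
      then show "cell j \<inter> cell j' = {}" by (auto simp: cell_iff)
    qed
  qed (use fin cell_sets in auto)
  also have "\<dots> = (\<Sum>j\<in>?G. \<Prod>l<n. \<rho> (j l))" by (intro sum.cong) (auto simp: cell_prob)
  also have "\<dots> = sample_mean n E \<rho> (\<lambda>j. of_bool (\<Phi> j))"
    unfolding sample_mean_def using fin by (intro sum.mono_neutral_cong_left) auto
  finally show ?thesis .
qed

lemma measure_iid_sample_ge:
  fixes J :: "nat \<Rightarrow> 'w \<Rightarrow> 'b"
  assumes \<Omega>: "prob_space \<Omega>" and indep: "prob_space.indep_vars \<Omega> (\<lambda>_. count_space E) J {..<n}"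
    and E: "finite E" "\<And>a. a \<in> E \<Longrightarrow> 0 \<le> \<rho> a" "sum \<rho> E = 1" and "0 < n"
    and law: "\<And>l i. l < n \<Longrightarrow> i \<in> E \<Longrightarrow> measure \<Omega> {s \<in> space \<Omega>. J l s = i} = \<rho> i"
    and local: "\<And>j j'. (\<And>l. l < n \<Longrightarrow> j l = j' l) \<Longrightarrow> \<Phi> j = \<Phi> j'"
    and bad: "\<And>j. j \<in> PiE {..<n} (\<lambda>_. E) \<Longrightarrow> \<not> bad1 j \<Longrightarrow> \<not> bad2 j \<Longrightarrow> \<Phi> j"
  shows "1 - sample_mean n E \<rho> (\<lambda>j. of_bool (bad1 j)) - sample_mean n E \<rho> (\<lambda>j. of_bool (bad2 j))
       \<le> measure \<Omega> {s \<in> space \<Omega>. \<Phi> (\<lambda>l. J l s)}"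
proof -
  have "1 = sample_mean n E \<rho> (\<lambda>j. 1)" using sample_mean_const[OF E(1,3)] by simp
  also have "\<dots> \<le> sample_mean n E \<rho> (\<lambda>j. of_bool (\<Phi> j) + (of_bool (bad1 j) + of_bool (bad2 j)))"
    using bad by (intro sample_mean_mono[OF E(2)]) (auto simp: of_bool_def)
  also have "\<dots> = measure \<Omega> {s \<in> space \<Omega>. \<Phi> (\<lambda>l. J l s)}
      + (sample_mean n E \<rho> (\<lambda>j. of_bool (bad1 j)) + sample_mean n E \<rho> (\<lambda>j. of_bool (bad2 j)))"
    unfolding sample_mean_add
    by (subst measure_iid_sample[OF \<Omega> indep E(1) \<open>0 < n\<close> law local]) auto
  finally show ?thesis by simp
qed

context rkhs_embedding
begin

lemma l2_inner_eta:
  assumes "f \<in> H" "0 < lam k"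
  shows "l2_inner \<nu> f (eta lam e k) = of_real (sqrt (lam k)) * ip f (e k)"
proof -
  have eta: "eta lam e k = (\<lambda>x. of_real (1 / sqrt (lam k)) * e k x)"
    by (simp add: eta_def)
  have "l2_inner \<nu> f (eta lam e k) = ip (S f) (eta lam e k)"
    unfolding eta by (rule ip_S[OF assms(1) scale_mem[OF e_mem], symmetric])
  also have "\<dots> = of_real (1 / sqrt (lam k)) * (of_real (lam k) * ip f (e k))"
    unfolding eta ip_scale_right[OF e_mem S_mem[OF assms(1)]] ip_S_e[OF assms] by simp
  also have "\<dots> = of_real (1 / sqrt (lam k) * lam k) * ip f (e k)" by simp
  also have "1 / sqrt (lam k) * lam k = sqrt (lam k)"
    using assms(2) by (simp add: real_div_sqrt)
  finally show ?thesis .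
qed

lemma l2_projection_eq:
  assumes "f \<in> H" "F \<subseteq> {k. 0 < lam k}"
  shows "l2_projection \<nu> F (eta lam e) f = (\<lambda>y. \<Sum>k\<in>F. ip f (e k) * e k y)"
  unfolding l2_projection_def
proof (intro ext sum.cong refl)
  fix y k assume "k \<in> F"
  then have k: "0 < lam k" using assms(2) by auto
  then show "l2_inner \<nu> f (eta lam e k) * eta lam e k y = ip f (e k) * e k y"
    unfolding l2_inner_eta[OF assms(1) k] by (simp add: eta_def)
qed

lemma l2_norm_sq_eta_combination:
  assumes "finite F" "F \<subseteq> {k. 0 < lam k}"
  shows "l2_norm_sq \<nu> (\<lambda>x. \<Sum>k\<in>F. c k * eta lam e k x) = ennreal (\<Sum>k\<in>F. (cmod (c k))\<^sup>2)"
proof -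
  have "(\<lambda>x. \<Sum>k\<in>F. c k * eta lam e k x) = (\<lambda>x. \<Sum>k\<in>F. c k / of_real (sqrt (lam k)) * e k x)"
    by (simp add: eta_def)
  moreover have "lam k * (cmod (c k / of_real (sqrt (lam k))))\<^sup>2 = (cmod (c k))\<^sup>2" if "k \<in> F" for k
    using that assms(2) by (auto simp: norm_divide power_divide)
  ultimately show ?thesis using l2_norm_sq_combination(2)[OF assms, of "\<lambda>k. c k / of_real (sqrt (lam k))"]
    by simp
qed

end

locale mz_sampling = rkhs_embedding D K H ip \<nu> S lam e
  for D :: "'a set" and K H ip \<nu> S lam and e :: "nat \<Rightarrow> 'a \<Rightarrow> complex" +
  fixes I IMZ :: "nat set" and M :: nat and x :: "nat \<Rightarrow> 'a" and \<omega> :: "nat \<Rightarrow> real" and A B :: real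
  assumes finite_IMZ: "finite IMZ" and IMZ_pos: "IMZ \<subseteq> {k. 0 < lam k}"
    and x_mem: "\<And>i. i \<in> {1..M} \<Longrightarrow> x i \<in> D"
    and \<omega>_nonneg: "\<And>i. i \<in> {1..M} \<Longrightarrow> 0 \<le> \<omega> i" and sum_\<omega>: "(\<Sum>i=1..M. \<omega> i) = 1"
    and A_pos: "0 < A" and A_le_B: "A \<le> B"
    and MZ: "\<And>f. f \<in> fun_span IMZ (eta lam e) \<Longrightarrow>
           ennreal A * l2_norm_sq \<nu> f \<le> ennreal (\<Sum>i=1..M. \<omega> i * (cmod (f (x i)))\<^sup>2) \<and>
           ennreal (\<Sum>i=1..M. \<omega> i * (cmod (f (x i)))\<^sup>2) \<le> ennreal B * l2_norm_sq \<nu> f"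
    and I_subset: "I \<subseteq> IMZ" and I_nonempty: "I \<noteq> {}"
begin

abbreviation \<eta> where "\<eta> \<equiv> eta lam e"
abbreviation \<rho> where "\<rho> \<equiv> sampling_density M x \<omega> lam e I IMZ"
definition weight where "weight i = \<omega> i / \<rho> i"

lemma B_pos: "0 < B" using A_pos A_le_B by simp

lemma finite_I: "finite I" and I_pos: "I \<subseteq> {k. 0 < lam k}"
  using I_subset finite_IMZ IMZ_pos by (auto intro: finite_subset)

lemma MZ_frame:
  assumes "F \<subseteq> IMZ"
  shows "A * (\<Sum>k\<in>F. (cmod (c k))\<^sup>2) \<le> (\<Sum>i=1..M. \<omega> i * (cmod (\<Sum>k\<in>F. c k * \<eta> k (x i)))\<^sup>2)"
    and "(\<Sum>i=1..M. \<omega> i * (cmod (\<Sum>k\<in>F. c k * \<eta> k (x i)))\<^sup>2) \<le> B * (\<Sum>k\<in>F. (cmod (c k))\<^sup>2)"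
proof -
  \<comment> \<open>coefficients on a subset are extended by zero\<close>
  let ?c = "\<lambda>k. if k \<in> F then c k else 0"
  let ?f = "\<lambda>y. \<Sum>k\<in>IMZ. ?c k * \<eta> k y"
  have f: "?f = (\<lambda>y. \<Sum>k\<in>F. c k * \<eta> k y)"
    using assms finite_IMZ by (intro ext sum.mono_neutral_cong_right) auto
  have "?f \<in> fun_span IMZ \<eta>" by (auto simp: fun_span_def)
  then have "(\<lambda>y. \<Sum>k\<in>F. c k * \<eta> k y) \<in> fun_span IMZ \<eta>" unfolding f .
  note mz = MZ[OF this]
  have n: "l2_norm_sq \<nu> (\<lambda>y. \<Sum>k\<in>F. c k * \<eta> k y) = ennreal (\<Sum>k\<in>F. (cmod (c k))\<^sup>2)"
  proof -
    have "(\<Sum>k\<in>IMZ. (cmod (?c k))\<^sup>2) = (\<Sum>k\<in>F. (cmod (c k))\<^sup>2)"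
      using assms finite_IMZ by (intro sum.mono_neutral_cong_right) auto
    then show ?thesis using l2_norm_sq_eta_combination[OF finite_IMZ IMZ_pos, of ?c] unfolding f by simp
  qed
  have nn: "0 \<le> (\<Sum>i=1..M. \<omega> i * (cmod (\<Sum>k\<in>F. c k * \<eta> k (x i)))\<^sup>2)" "0 \<le> (\<Sum>k\<in>F. (cmod (c k))\<^sup>2)"
    using \<omega>_nonneg by (auto intro!: sum_nonneg)
  show "A * (\<Sum>k\<in>F. (cmod (c k))\<^sup>2) \<le> (\<Sum>i=1..M. \<omega> i * (cmod (\<Sum>k\<in>F. c k * \<eta> k (x i)))\<^sup>2)"
    using mz A_pos nn unfolding n by (simp add: ennreal_mult[symmetric])
  show "(\<Sum>i=1..M. \<omega> i * (cmod (\<Sum>k\<in>F. c k * \<eta> k (x i)))\<^sup>2) \<le> B * (\<Sum>k\<in>F. (cmod (c k))\<^sup>2)"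
    using mz B_pos nn unfolding n by (simp add: ennreal_mult[symmetric])
qed

lemma MZ_single:
  assumes "k \<in> IMZ"
  shows "A \<le> (\<Sum>i=1..M. \<omega> i * (cmod (\<eta> k (x i)))\<^sup>2)" "(\<Sum>i=1..M. \<omega> i * (cmod (\<eta> k (x i)))\<^sup>2) \<le> B"
  using MZ_frame[of "{k}" "\<lambda>_. 1"] assms by simp_all

definition head_energy where "head_energy i = (\<Sum>k\<in>I. (cmod (\<eta> k (x i)))\<^sup>2)"
definition tail_energy where "tail_energy i = (\<Sum>k\<in>IMZ - I. (cmod (e k (x i)))\<^sup>2)"
definition total_head where "total_head = (\<Sum>j=1..M. \<omega> j * head_energy j)"
definition total_tail where "total_tail = (\<Sum>j=1..M. \<omega> j * tail_energy j)"

lemma \<rho>_eq: "\<rho> i = \<omega> i * head_energy i / (3 * total_head)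
     + (if I = IMZ then \<omega> i / 3 else \<omega> i * tail_energy i / (3 * total_tail)) + \<omega> i / 3"
  unfolding sampling_density_def head_energy_def tail_energy_def total_head_def total_tail_def ..

lemma total_head_bounds: "0 < total_head" "total_head \<le> B * card I"
proof -
  have eq: "total_head = (\<Sum>k\<in>I. \<Sum>i=1..M. \<omega> i * (cmod (\<eta> k (x i)))\<^sup>2)"
    unfolding total_head_def head_energy_def sum_distrib_left by (rule sum.swap)
  have "0 < (\<Sum>i=1..M. \<omega> i * (cmod (\<eta> k (x i)))\<^sup>2)" if "k \<in> I" for k
    using MZ_single(1)[of k] that I_subset A_pos by (meson less_le_trans subsetD)
  then show "0 < total_head" unfolding eq by (rule sum_pos[OF finite_I I_nonempty])
  have "total_head \<le> (\<Sum>k\<in>I. B)" unfolding eq using MZ_single(2) I_subset by (intro sum_mono) auto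
  then show "total_head \<le> B * card I" by (simp add: mult.commute)
qed

lemma e_eta: "0 < lam k \<Longrightarrow> e k y = of_real (sqrt (lam k)) * \<eta> k y"
  by (simp add: eta_def)

lemma total_tail_bounds: "I \<noteq> IMZ \<Longrightarrow> 0 < total_tail" "total_tail \<le> B * (\<Sum>k\<in>IMZ - I. lam k)"
proof -
  have "(cmod (e k (x i)))\<^sup>2 = lam k * (cmod (\<eta> k (x i)))\<^sup>2" if "k \<in> IMZ - I" for k i
    using that IMZ_pos by (subst e_eta) (auto simp: norm_mult power_mult_distrib)
  then have eq: "total_tail = (\<Sum>k\<in>IMZ - I. lam k * (\<Sum>i=1..M. \<omega> i * (cmod (\<eta> k (x i)))\<^sup>2))"
    unfolding total_tail_def tail_energy_def sum_distrib_left
    by (subst sum.swap) (intro sum.cong, auto simp: mult_ac)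
  have pos: "0 < lam k * (\<Sum>i=1..M. \<omega> i * (cmod (\<eta> k (x i)))\<^sup>2)" if "k \<in> IMZ - I" for k
    using MZ_single(1)[of k] that IMZ_pos A_pos by (intro mult_pos_pos) auto
  show "0 < total_tail" if "I \<noteq> IMZ" unfolding eq by (rule sum_pos[OF _ _ pos]) (use finite_IMZ that I_subset in auto)
  show "total_tail \<le> B * (\<Sum>k\<in>IMZ - I. lam k)"
  proof -
    have "total_tail \<le> (\<Sum>k\<in>IMZ - I. lam k * B)"
      unfolding eq by (intro sum_mono mult_left_mono MZ_single(2) lam_nonneg) auto
    then show ?thesis by (simp only: sum_distrib_left mult.commute[of B])
  qed
qed

text \<open>
Each of the three summands of the density is dominated by the whole.
\<close>

lemma density:
  assumes "i \<in> {1..M}"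
  shows "0 \<le> \<rho> i" "\<omega> i \<le> 3 * \<rho> i" "\<omega> i * head_energy i \<le> 3 * total_head * \<rho> i"
    "I \<noteq> IMZ \<Longrightarrow> \<omega> i * tail_energy i \<le> 3 * total_tail * \<rho> i"
proof -
  have w: "0 \<le> \<omega> i" using \<omega>_nonneg assms by simp
  have y: "0 \<le> \<omega> i * head_energy i" using w by (simp add: head_energy_def sum_nonneg)
  have z: "0 \<le> \<omega> i * tail_energy i" using w by (simp add: tail_energy_def sum_nonneg)
  let ?m = "if I = IMZ then \<omega> i / 3 else \<omega> i * tail_energy i / (3 * total_tail)"
  have m: "0 \<le> ?m" using w z total_tail_bounds(1) by (cases "I = IMZ") simp_all
  have yq: "0 \<le> \<omega> i * head_energy i / (3 * total_head)" using y total_head_bounds(1) by simp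
  show "0 \<le> \<rho> i" unfolding \<rho>_eq using w m yq by linarith
  have "\<omega> i / 3 \<le> \<rho> i" unfolding \<rho>_eq using m yq by linarith
  then show "\<omega> i \<le> 3 * \<rho> i" by simp
  have "\<omega> i * head_energy i / (3 * total_head) \<le> \<rho> i" unfolding \<rho>_eq using w m by linarith
  then show "\<omega> i * head_energy i \<le> 3 * total_head * \<rho> i" using total_head_bounds(1) by (simp add: pos_divide_le_eq mult.commute)
  show "\<omega> i * tail_energy i \<le> 3 * total_tail * \<rho> i" if "I \<noteq> IMZ"
  proof -
    have "\<omega> i * tail_energy i / (3 * total_tail) \<le> \<rho> i" unfolding \<rho>_eq using w yq that by simp
    then show ?thesis using total_tail_bounds(1)[OF that] by (simp add: pos_divide_le_eq mult.commute)
  qed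
qed

lemma sum_\<rho>: "(\<Sum>i=1..M. \<rho> i) = 1"
proof -
  have 1: "(\<Sum>i=1..M. \<omega> i * head_energy i / (3 * total_head)) = 1 / 3"
    unfolding sum_divide_distrib[symmetric] total_head_def[symmetric] using total_head_bounds(1) by simp
  have 2: "(\<Sum>i=1..M. if I = IMZ then \<omega> i / 3 else \<omega> i * tail_energy i / (3 * total_tail)) = 1 / 3"
  proof (cases "I = IMZ")
    case True
    show ?thesis unfolding if_P[OF True] sum_divide_distrib[symmetric] sum_\<omega> ..
  next
    case False
    then show ?thesis
      unfolding if_not_P[OF False] sum_divide_distrib[symmetric] total_tail_def[symmetric]
      using total_tail_bounds(1) by simp
  qed
  have 3: "(\<Sum>i=1..M. \<omega> i / 3) = 1 / 3" by (simp only: sum_divide_distrib[symmetric] sum_\<omega>)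
  show ?thesis unfolding \<rho>_eq sum.distrib 1 2 3 by simp
qed

lemma weight:
  assumes "i \<in> {1..M}"
  shows "0 \<le> weight i" "weight i \<le> 3" "weight i * head_energy i \<le> 3 * total_head"
    "I \<noteq> IMZ \<Longrightarrow> weight i * tail_energy i \<le> 3 * total_tail" "\<rho> i * weight i = \<omega> i"
proof -
  note d = density[OF assms]
  have w: "0 \<le> \<omega> i" using \<omega>_nonneg assms by simp
  show "0 \<le> weight i" using w d by (simp add: weight_def)
  show "\<rho> i * weight i = \<omega> i" using d w by (cases "\<rho> i = 0") (auto simp: weight_def)
  \<comment> \<open>a vanishing density forces \<open>\<omega> i = 0\<close>, and then the weight is \<open>0 / 0 = 0\<close>\<close>
  show "weight i \<le> 3" using d by (cases "\<rho> i = 0") (auto simp: weight_def pos_divide_le_eq less_le)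
  show "weight i * head_energy i \<le> 3 * total_head"
    using d total_head_bounds by (cases "\<rho> i = 0") (auto simp: weight_def pos_divide_le_eq less_le)
  show "weight i * tail_energy i \<le> 3 * total_tail" if "I \<noteq> IMZ"
    using d(1) d(4)[OF that] total_tail_bounds(1)[OF that] by (cases "\<rho> i = 0") (auto simp: weight_def pos_divide_le_eq less_le)
qed

definition bad_frame :: "nat \<Rightarrow> (nat \<Rightarrow> nat) \<Rightarrow> bool" where
  "bad_frame n j \<longleftrightarrow> (\<exists>u. (\<Sum>l<n. weight (j l) * (cmod (\<Sum>k\<in>I. u k * \<eta> k (x (j l))))\<^sup>2) < n * A / 2 * (\<Sum>k\<in>I. (cmod (u k))\<^sup>2))"

definition bad_tail :: "real \<Rightarrow> nat \<Rightarrow> (nat \<Rightarrow> nat) \<Rightarrow> bool" where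
  "bad_tail s n j \<longleftrightarrow> (\<exists>u. s * (\<Sum>k\<in>IMZ - I. (cmod (u k))\<^sup>2) < (\<Sum>l<n. weight (j l) * (cmod (\<Sum>k\<in>IMZ - I. u k * e k (x (j l))))\<^sup>2))"

lemma dot_sampling_vector:
  assumes "0 \<le> c" "finite F"
  shows "(cmod (coordinates.dot F u (\<lambda>k. of_real (sqrt c) * cnj (b k))))\<^sup>2 = c * (cmod (\<Sum>k\<in>F. u k * b k))\<^sup>2"
    and "coordinates.sqn F (\<lambda>k. of_real (sqrt c) * cnj (b k)) = c * (\<Sum>k\<in>F. (cmod (b k))\<^sup>2)"
proof -
  interpret coordinates F using assms(2) by unfold_locales
  have "dot u (\<lambda>k. of_real (sqrt c) * cnj (b k)) = of_real (sqrt c) * (\<Sum>k\<in>F. u k * b k)"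
    unfolding dot_scale_right by (simp add: dot_def)
  then show "(cmod (dot u (\<lambda>k. of_real (sqrt c) * cnj (b k))))\<^sup>2 = c * (cmod (\<Sum>k\<in>F. u k * b k))\<^sup>2"
    using assms(1) by (simp add: norm_mult power_mult_distrib)
  show "sqn (\<lambda>k. of_real (sqrt c) * cnj (b k)) = c * (\<Sum>k\<in>F. (cmod (b k))\<^sup>2)"
    using assms(1) by (simp add: sqn_def norm_mult power_mult_distrib sum_distrib_left)
qed

text \<open>
The sample vectors are \<open>sqrt (weight i)\<close> times the conjugated values of the \<open>\<eta>\<^sub>k\<close>: the factor
\<open>weight i\<close> undoes the density, so their mean frame operator is that of the rule itself.
\<close>

lemma prob_bad_frame:
  assumes "0 < n"
  shows "sample_mean n {1..M} \<rho> (\<lambda>j. of_bool (bad_frame n j)) \<le> card I * exp (- (n * A / (24 * B * card I)))"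
proof -
  interpret coordinates I using finite_I by unfold_locales
  let ?v = "\<lambda>i k. of_real (sqrt (weight i)) * cnj (\<eta> k (x i))"
  let ?R = "3 * B * card I"
  have N: "0 < card I" using finite_I I_nonempty by (simp add: card_gt_0_iff)
  have "sample_mean n {1..M} \<rho> (\<lambda>j. of_bool (bad_frame n j))
     = sample_mean n {1..M} \<rho> (\<lambda>j. of_bool (\<exists>u. (\<Sum>l<n. (cmod (dot u (?v (j l))))\<^sup>2) < n * A / 2 * sqn u))"
  proof (rule sample_mean_cong)
    fix j assume j: "j \<in> PiE {..<n} (\<lambda>_. {1..M})"
    have "(\<Sum>l<n. (cmod (dot u (?v (j l))))\<^sup>2) = (\<Sum>l<n. weight (j l) * (cmod (\<Sum>k\<in>I. u k * \<eta> k (x (j l))))\<^sup>2)" for u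
      using j weight(1) by (intro sum.cong dot_sampling_vector finite_I) (auto simp: PiE_iff)
    then show "of_bool (bad_frame n j) = (of_bool (\<exists>u. (\<Sum>l<n. (cmod (dot u (?v (j l))))\<^sup>2) < n * A / 2 * sqn u) :: real)"
      by (simp add: bad_frame_def sqn_def)
  qed
  also have "\<dots> \<le> card I * exp (- (n * A / (8 * ?R)))"
  proof (rule sampled_frame_lower_tail)
    show "sqn (?v i) \<le> ?R" if "i \<in> {1..M}" for i
      using weight(3)[OF that] total_head_bounds(2) dot_sampling_vector(2)[OF weight(1)[OF that] finite_I, of "\<lambda>k. \<eta> k (x i)"]
      by (simp add: head_energy_def mult.assoc)
    show "A * sqn u \<le> (\<Sum>i\<in>{1..M}. \<rho> i * (cmod (dot u (?v i)))\<^sup>2)" for u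
    proof -
      have "(\<Sum>i\<in>{1..M}. \<rho> i * (cmod (dot u (?v i)))\<^sup>2) = (\<Sum>i=1..M. \<omega> i * (cmod (\<Sum>k\<in>I. u k * \<eta> k (x i)))\<^sup>2)"
        using weight dot_sampling_vector(1)[OF _ finite_I]
        by (intro sum.cong) (auto simp: mult.assoc[symmetric])
      then show ?thesis using MZ_frame(1)[OF I_subset, of u] by (simp add: sqn_def)
    qed
  qed (use assms density(1) sum_\<rho> A_pos B_pos N I_nonempty in auto)
  finally show ?thesis by (simp add: mult_ac)
qed

text \<open>
The density bounds the squared norms of the sample vectors by three times their mean
\<open>total_tail\<close>.  In units of this bound the total mean is \<open>n / 3\<close>, whatever the size of \<open>IMZ - I\<close>.
\<close>

lemma prob_bad_tail:
  assumes \<Lambda>: "\<And>k. k \<notin> I \<Longrightarrow> lam k \<le> \<Lambda>" "0 \<le> \<Lambda>" and "0 < z"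
  shows "sample_mean n {1..M} \<rho> (\<lambda>j. of_bool (bad_tail (2 * n * (B * \<Lambda>) + z * (3 * total_tail)) n j))
     \<le> n / 3 / (exp (z / 5) - 1)"
proof (cases "I = IMZ")
  case True
  then have empty: "IMZ - I = {}" by simp
  have "\<not> bad_tail s n j" for s j unfolding bad_tail_def empty by simp
  then show ?thesis using \<open>0 < z\<close> by (simp add: sample_mean_def)
next
  case False
  have fin: "finite (IMZ - I)" using finite_IMZ by simp
  interpret coordinates "IMZ - I" using fin by unfold_locales
  let ?v = "\<lambda>i k. of_real (sqrt (weight i)) * cnj (e k (x i))"
  let ?s = "2 * real n * (B * \<Lambda>) + z * (3 * total_tail)"
  have Zp: "0 < total_tail" by (rule total_tail_bounds(1)[OF False])
  have "sample_mean n {1..M} \<rho> (\<lambda>j. of_bool (bad_tail ?s n j))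
     = sample_mean n {1..M} \<rho> (\<lambda>j. of_bool (\<exists>u. ?s * sqn u < (\<Sum>l<n. (cmod (dot u (?v (j l))))\<^sup>2)))"
  proof (rule sample_mean_cong)
    fix j assume j: "j \<in> PiE {..<n} (\<lambda>_. {1..M})"
    have "(\<Sum>l<n. (cmod (dot u (?v (j l))))\<^sup>2) = (\<Sum>l<n. weight (j l) * (cmod (\<Sum>k\<in>IMZ - I. u k * e k (x (j l))))\<^sup>2)" for u
      using j weight(1) by (intro sum.cong dot_sampling_vector fin) (auto simp: PiE_iff)
    then show "of_bool (bad_tail ?s n j) = (of_bool (\<exists>u. ?s * sqn u < (\<Sum>l<n. (cmod (dot u (?v (j l))))\<^sup>2)) :: real)"
      by (simp add: bad_tail_def sqn_def)
  qed
  also have "\<dots> \<le> n * total_tail / (3 * total_tail) / (exp (z / 5) - 1)"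
  proof (rule sampled_frame_upper_tail)
    have sq: "sqn (?v i) = weight i * tail_energy i" if "i \<in> {1..M}" for i
      using dot_sampling_vector(2)[OF weight(1)[OF that] fin, of "\<lambda>k. e k (x i)"] by (simp add: tail_energy_def)
    show "sqn (?v i) \<le> 3 * total_tail" if "i \<in> {1..M}" for i
      unfolding sq[OF that] by (rule weight(4)[OF that False])
    have "(\<Sum>i\<in>{1..M}. \<rho> i * sqn (?v i)) = (\<Sum>i\<in>{1..M}. \<omega> i * tail_energy i)"
      using weight(5) by (intro sum.cong) (auto simp: sq mult.assoc[symmetric])
    then show "(\<Sum>i\<in>{1..M}. \<rho> i * sqn (?v i)) \<le> total_tail" by (simp add: total_tail_def)
    show "(\<Sum>i\<in>{1..M}. \<rho> i * (cmod (dot u (?v i)))\<^sup>2) \<le> B * \<Lambda> * sqn u" for u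
    proof -
      let ?c = "\<lambda>k. u k * of_real (sqrt (lam k))"
      have lp: "0 < lam k" if "k \<in> IMZ - I" for k using that IMZ_pos by auto
      have "(\<Sum>k\<in>IMZ - I. u k * e k (x i)) = (\<Sum>k\<in>IMZ - I. ?c k * \<eta> k (x i))" for i
        using lp by (intro sum.cong) (auto simp: e_eta)
      then have "(\<Sum>i\<in>{1..M}. \<rho> i * (cmod (dot u (?v i)))\<^sup>2) = (\<Sum>i=1..M. \<omega> i * (cmod (\<Sum>k\<in>IMZ - I. ?c k * \<eta> k (x i)))\<^sup>2)"
        using weight dot_sampling_vector(1)[OF _ fin]
        by (intro sum.cong) (auto simp: mult.assoc[symmetric])
      also have "\<dots> \<le> B * (\<Sum>k\<in>IMZ - I. (cmod (?c k))\<^sup>2)"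
        by (rule MZ_frame(2)) auto
      also have "(\<Sum>k\<in>IMZ - I. (cmod (?c k))\<^sup>2) \<le> (\<Sum>k\<in>IMZ - I. \<Lambda> * (cmod (u k))\<^sup>2)"
      proof (rule sum_mono)
        fix k assume k: "k \<in> IMZ - I"
        have "(cmod (?c k))\<^sup>2 = lam k * (cmod (u k))\<^sup>2"
          using lam_nonneg[of k] by (simp add: norm_mult power_mult_distrib)
        then show "(cmod (?c k))\<^sup>2 \<le> \<Lambda> * (cmod (u k))\<^sup>2"
          using \<Lambda>(1)[of k] k by (simp add: mult_right_mono)
      qed
      finally show ?thesis using B_pos by (simp add: sqn_def sum_distrib_left mult_ac)
    qed
  qed (use density(1) sum_\<rho> B_pos \<Lambda> Zp \<open>0 < z\<close> in auto)
  also have "n * total_tail / (3 * total_tail) = n / 3" using Zp by simp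
  finally show ?thesis .
qed

text \<open>
The factor \<open>2\<close> from splitting the residual into two parts and the factor \<open>2 / (n * A)\<close> from
stability give \<open>4 / (n * A)\<close>; in the second part each of the \<open>n\<close> weights contributes another \<open>3\<close>.
\<close>

lemma wls_error_bound:
  assumes n: "0 < n" and j: "\<And>l. l < n \<Longrightarrow> j l \<in> {1..M}"
    and good: "\<not> bad_frame n j" "\<not> bad_tail s n j" and s: "0 \<le> s"
    and \<Lambda>: "\<And>k. k \<notin> I \<Longrightarrow> lam k \<le> \<Lambda>" "0 \<le> \<Lambda>"
    and q: "0 \<le> q" "\<And>f y. f \<in> unit_ball H ip \<Longrightarrow> y \<in> D \<Longrightarrow> (cmod (f y - l2_projection \<nu> IMZ \<eta> f y))\<^sup>2 \<le> q"
    and f: "f \<in> unit_ball H ip"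
  shows "l2_norm_sq \<nu> (\<lambda>y. f y - wls I \<eta> n (\<lambda>l. x (j l)) (\<lambda>l. weight (j l)) f y)
       \<le> ennreal (\<Lambda> + 4 / (n * A) * s + 12 / A * q)"
proof -
  have fH: "f \<in> H" and f1: "Re (ip f f) \<le> 1" using f by (auto simp: unit_ball_def hnorm_def)
  let ?X = "\<lambda>l. x (j l)" and ?w = "\<lambda>l. weight (j l)"
  let ?T = "IMZ - I"
  have w: "0 \<le> ?w l" "?w l \<le> 3" if "l < n" for l using weight[OF j[OF that]] by auto
  have \<gamma>: "0 < n * A / 2" using n A_pos by simp
  have low: "n * A / 2 * (\<Sum>k\<in>I. (cmod (u k))\<^sup>2) \<le> (\<Sum>l<n. ?w l * (cmod (\<Sum>k\<in>I. u k * \<eta> k (?X l)))\<^sup>2)" for u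
    using good(1) by (auto simp: bad_frame_def not_less)
  obtain a where a: "wls I \<eta> n ?X ?w f = (\<lambda>y. \<Sum>k\<in>I. a k * \<eta> k y)"
    and stab: "\<And>c. n * A / 2 * (\<Sum>k\<in>I. (cmod (c k - a k))\<^sup>2) \<le> (\<Sum>l<n. ?w l * (cmod (f (?X l) - (\<Sum>k\<in>I. c k * \<eta> k (?X l))))\<^sup>2)"
    using wls_stable(2)[where xs = ?X and w = ?w and b = \<eta>, OF finite_I w(1) \<gamma> low] by blast
  define c where "c k = of_real (sqrt (lam k)) * ip f (e k)" for k
  define g1 where "g1 y = (\<Sum>k\<in>?T. ip f (e k) * e k y)" for y
  define g2 where "g2 y = f y - l2_projection \<nu> IMZ \<eta> f y" for y
  have lp: "0 < lam k" if "k \<in> I" for k using that I_pos by auto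
  have split: "f y - (\<Sum>k\<in>I. c k * \<eta> k y) = g1 y + g2 y" for y
  proof -
    have "(\<Sum>k\<in>I. c k * \<eta> k y) = (\<Sum>k\<in>I. ip f (e k) * e k y)"
      using lp by (intro sum.cong) (auto simp: c_def e_eta)
    moreover have "(\<Sum>k\<in>IMZ. ip f (e k) * e k y) = (\<Sum>k\<in>?T. ip f (e k) * e k y) + (\<Sum>k\<in>I. ip f (e k) * e k y)"
      using finite_IMZ I_subset by (metis sum.subset_diff)
    ultimately show ?thesis by (simp add: g1_def g2_def l2_projection_eq[OF fH IMZ_pos])
  qed
  have e1: "(\<Sum>l<n. ?w l * (cmod (g1 (?X l)))\<^sup>2) \<le> s"
  proof -
    have "(\<Sum>l<n. ?w l * (cmod (g1 (?X l)))\<^sup>2) \<le> s * (\<Sum>k\<in>?T. (cmod (ip f (e k)))\<^sup>2)"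
      using good(2) unfolding bad_tail_def g1_def by (simp add: not_less)
    also have "\<dots> \<le> s * 1"
    proof (rule mult_left_mono[OF _ s])
      have "(\<Sum>k\<in>?T. (cmod (ip f (e k)))\<^sup>2) \<le> Re (ip f f)"
        using finite_IMZ IMZ_pos by (intro Bessel[OF fH]) auto
      then show "(\<Sum>k\<in>?T. (cmod (ip f (e k)))\<^sup>2) \<le> 1" using f1 by linarith
    qed
    finally show ?thesis by simp
  qed
  have e2: "(\<Sum>l<n. ?w l * (cmod (g2 (?X l)))\<^sup>2) \<le> n * (3 * q)"
  proof -
    have "(\<Sum>l<n. ?w l * (cmod (g2 (?X l)))\<^sup>2) \<le> (\<Sum>l<n. 3 * q)"
      unfolding g2_def using q w x_mem j f by (intro sum_mono mult_mono) auto
    then show ?thesis by simp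
  qed
  have "(\<Sum>l<n. ?w l * (cmod (g1 (?X l) + g2 (?X l)))\<^sup>2)
     \<le> (\<Sum>l<n. 2 * (?w l * (cmod (g1 (?X l)))\<^sup>2) + 2 * (?w l * (cmod (g2 (?X l)))\<^sup>2))"
  proof (rule sum_mono)
    fix l assume "l \<in> {..<n}"
    then have "0 \<le> ?w l" using w by simp
    moreover have "(cmod (g1 (?X l) + g2 (?X l)))\<^sup>2 \<le> 2 * (cmod (g1 (?X l)))\<^sup>2 + 2 * (cmod (g2 (?X l)))\<^sup>2"
    proof -
      have "(cmod (g1 (?X l) + g2 (?X l)))\<^sup>2 \<le> (cmod (g1 (?X l)) + cmod (g2 (?X l)))\<^sup>2"
        by (intro power_mono norm_triangle_ineq) simp
      then show ?thesis
        using sum_squares_bound[of "cmod (g1 (?X l))" "cmod (g2 (?X l))"] by (simp add: power2_sum)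
    qed
    ultimately have "?w l * (cmod (g1 (?X l) + g2 (?X l)))\<^sup>2 \<le> ?w l * (2 * (cmod (g1 (?X l)))\<^sup>2 + 2 * (cmod (g2 (?X l)))\<^sup>2)"
      by (intro mult_left_mono) auto
    then show "?w l * (cmod (g1 (?X l) + g2 (?X l)))\<^sup>2 \<le> 2 * (?w l * (cmod (g1 (?X l)))\<^sup>2) + 2 * (?w l * (cmod (g2 (?X l)))\<^sup>2)"
      by (simp add: algebra_simps)
  qed
  also have "\<dots> \<le> 2 * s + 2 * (n * (3 * q))"
    unfolding sum.distrib sum_distrib_left[symmetric] using e1 e2 by linarith
  finally have "n * A / 2 * (\<Sum>k\<in>I. (cmod (c k - a k))\<^sup>2) \<le> 2 * s + 2 * (n * (3 * q))"
    using stab[of c] by (simp add: split)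
  then have coeff: "(\<Sum>k\<in>I. (cmod (c k - a k))\<^sup>2) \<le> 4 / (n * A) * s + 12 / A * q"
    using n A_pos by (simp add: field_simps)
  let ?h = "\<lambda>y. f y - wls I \<eta> n ?X ?w f y"
  let ?p = "\<lambda>y. \<Sum>k\<in>I. a k / of_real (sqrt (lam k)) * e k y"
  have h: "?h = (\<lambda>y. f y - ?p y)" by (simp add: a eta_def)
  have p: "?p \<in> H" by (intro sum_mem e_mem)
  have hH: "?h \<in> H" unfolding h by (intro diff_mem fH p)
  have ip_h: "ip ?h (e k) = ip f (e k) - (if k \<in> I then a k / of_real (sqrt (lam k)) else 0)" if "0 < lam k" for k
    unfolding h ip_diff[OF fH p e_mem] ip_combination[OF finite_I I_pos that] ..
  have "l2_norm_sq \<nu> ?h \<le> ennreal (\<Lambda> + (\<Sum>k\<in>I. lam k * (cmod (ip ?h (e k)))\<^sup>2))"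
    by (rule l2_norm_sq_le_split[OF fH f1 hH finite_I I_pos _ \<Lambda>]) (simp_all add: ip_h)
  also have "(\<Sum>k\<in>I. lam k * (cmod (ip ?h (e k)))\<^sup>2) = (\<Sum>k\<in>I. (cmod (c k - a k))\<^sup>2)"
  proof (rule sum.cong)
    fix k assume k: "k \<in> I"
    have l: "0 < lam k" using lp[OF k] .
    have "c k - a k = of_real (sqrt (lam k)) * ip ?h (e k)"
      using k l by (simp add: ip_h[OF l] c_def right_diff_distrib)
    then show "lam k * (cmod (ip ?h (e k)))\<^sup>2 = (cmod (c k - a k))\<^sup>2"
      using l by (simp add: norm_mult power_mult_distrib)
  qed simp
  also have "ennreal (\<Lambda> + (\<Sum>k\<in>I. (cmod (c k - a k))\<^sup>2)) \<le> ennreal (\<Lambda> + 4 / (n * A) * s + 12 / A * q)"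
    using coeff by (intro ennreal_leI) simp
  finally show ?thesis .
qed

lemma wls_well_defined_good:
  assumes "0 < n" "\<And>l. l < n \<Longrightarrow> j l \<in> {1..M}" "\<not> bad_frame n j"
  shows "wls_well_defined I \<eta> n (\<lambda>l. x (j l)) (\<lambda>l. weight (j l))"
proof (rule wls_stable(1)[OF finite_I])
  show "0 \<le> weight (j l)" if "l < n" for l using weight(1)[OF assms(2)[OF that]] .
  show "0 < n * A / 2" using assms A_pos by simp
  show "n * A / 2 * (\<Sum>k\<in>I. (cmod (u k))\<^sup>2) \<le> (\<Sum>l<n. weight (j l) * (cmod (\<Sum>k\<in>I. u k * \<eta> k (x (j l))))\<^sup>2)" for u
    using assms(3) by (auto simp: bad_frame_def not_less)
qed

end

section \<open>The error bound\<close>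

context mz_sampling
begin

lemma sup_bound_finite:
  assumes Q: "(SUP f\<in>unit_ball H ip. (sup_norm D (\<lambda>y. f y - l2_projection \<nu> IMZ \<eta> f y))\<^sup>2) \<le> ennreal q"
    and "0 \<le> q" "f \<in> unit_ball H ip" "y \<in> D"
  shows "(cmod (f y - l2_projection \<nu> IMZ \<eta> f y))\<^sup>2 \<le> q"
proof -
  let ?g = "\<lambda>y. f y - l2_projection \<nu> IMZ \<eta> f y"
  have "ennreal ((cmod (?g y))\<^sup>2) = (ennreal (cmod (?g y)))\<^sup>2" by (simp add: ennreal_power)
  also have "\<dots> \<le> (sup_norm D ?g)\<^sup>2"
    unfolding sup_norm_def using assms(4) by (intro power_mono SUP_upper) auto
  also have "\<dots> \<le> (SUP f\<in>unit_ball H ip. (sup_norm D (\<lambda>y. f y - l2_projection \<nu> IMZ \<eta> f y))\<^sup>2)"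
    using assms(3) by (rule SUP_upper)
  also note Q
  finally show ?thesis using assms(2) by simp
qed

lemma sup_eigenvalue:
  obtains \<Lambda> where "0 \<le> \<Lambda>" "(SUP k\<in>- I. ennreal (lam k)) = ennreal \<Lambda>" "\<And>k. k \<notin> I \<Longrightarrow> lam k \<le> \<Lambda>"
proof -
  let ?S = "SUP k\<in>- I. ennreal (lam k)"
  have "?S \<le> ennreal (lam 0)"
    using decseq_lam by (intro SUP_least ennreal_leI) (auto simp: decseq_def)
  then have "?S < top_class.top" using ennreal_less_top le_less_trans by blast
  then have eq: "?S = ennreal (enn2real ?S)" by simp
  show ?thesis
  proof
    show "0 \<le> enn2real ?S" by simp
    show "?S = ennreal (enn2real ?S)" by (rule eq)
    fix k assume "k \<notin> I"
    then have "ennreal (lam k) \<le> ennreal (enn2real ?S)" unfolding eq[symmetric] by (intro SUP_upper) auto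
    then show "lam k \<le> enn2real ?S" by simp
  qed
qed

text \<open>
Here the constant \<open>36\<close> is used.  It makes the exponent of the lower tail at least
\<open>3/2 * (ln |I| + t)\<close>, and with \<open>z = 21 * r * (ln |I| + t)\<close> it turns the deviation term of the upper
tail into at most \<open>7 * r / |I|\<close> times the sum of the eigenvalues, while \<open>n \<le> |I| powr r\<close> makes its
probability at most \<open>exp (- t)\<close>.
\<close>

lemma sample_size_bounds:
  assumes N: "3 \<le> card I" and t: "0 < t" and r: "1 \<le> r"
    and n: "36 * B / A * real (card I) * (ln (real (card I)) + t) \<le> real n" 
    and n_le: "real n \<le> real (card I) powr r"
  shows "0 < n"
    and "real (card I) * exp (- (n * A / (24 * B * card I))) \<le> exp (- t)"
    and "n / 3 / (exp (21 * r * (ln (real (card I)) + t) / 5) - 1) \<le> exp (- t)"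
    and "4 / (n * A) * (2 * real n * (B * \<Lambda>) + 21 * r * (ln (real (card I)) + t) * (3 * total_tail))
         \<le> 8 * B / A * \<Lambda> + 7 * r / card I * (\<Sum>k\<in>IMZ - I. lam k)"
proof -
  let ?N = "real (card I)"
  define u where "u = ln ?N + t"
  have N1: "1 < ?N" using N by simp
  have l: "0 < ln ?N" using N1 by simp
  have u: "0 < u" unfolding u_def using l t by simp
  note BA = A_pos B_pos
  have n36: "36 * B / A * ?N * u \<le> n" using n by (simp add: u_def)
  have "0 < 36 * B / A * ?N * u" using BA N1 u by simp
  then have npos: "0 < real n" using n36 by linarith
  then show "0 < n" by simp
  have "3 / 2 * u \<le> n * A / (24 * B * ?N)"
    using n36 BA N1 by (simp add: field_simps)
  then have "u \<le> n * A / (24 * B * ?N)" using u by linarith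
  then have "exp (- (n * A / (24 * B * ?N))) \<le> exp (- u)" by simp
  then have "?N * exp (- (n * A / (24 * B * ?N))) \<le> ?N * exp (- u)" using N1 by (intro mult_left_mono) auto
  also have "?N * exp (- u) = exp (- t)" using N1 by (simp add: u_def exp_diff exp_minus field_simps)
  finally show "?N * exp (- (n * A / (24 * B * card I))) \<le> exp (- t)" .
  show "n / 3 / (exp (21 * r * (ln ?N + t) / 5) - 1) \<le> exp (- t)"
  proof -
    define X where "X = exp (r * ln ?N + t)"
    have X1: "3 \<le> X"
    proof -
      have "ln ?N \<le> r * ln ?N + t" 
      proof -
        have "1 * ln ?N \<le> r * ln ?N" using r l by (intro mult_right_mono) auto
        then show ?thesis using t by linarith
      qed
      then have "exp (ln ?N) \<le> X" by (simp add: X_def)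
      then show ?thesis using N by simp
    qed
    have "2 * (r * ln ?N + t) \<le> 21 * r * (ln ?N + t) / 5"
    proof -
      have "t \<le> r * t" using mult_right_mono[OF r less_imp_le[OF t]] by (simp only: mult_1)
      moreover have "0 \<le> r * ln ?N" using r l by simp
      moreover have "2 * (a + t) \<le> 21 / 5 * a + 21 / 5 * b" if "t \<le> b" "0 \<le> a" for a b
        using that t by (simp add: field_simps)
      ultimately have "2 * (r * ln ?N + t) \<le> 21 / 5 * (r * ln ?N) + 21 / 5 * (r * t)"
        by blast
      also have "\<dots> = 21 * r * (ln ?N + t) / 5" by (simp add: algebra_simps)
      finally show ?thesis .
    qed
    then have "X * X \<le> exp (21 * r * (ln ?N + t) / 5)"
      unfolding X_def exp_add[symmetric] by simp
    moreover have "X * 3 \<le> X * X" using X1 by (intro mult_left_mono) auto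
    ultimately have ge: "X \<le> exp (21 * r * (ln ?N + t) / 5) - 1" using X1 by linarith
    have "n / 3 \<le> X * exp (- t)"
    proof -
      have "X * exp (- t) = ?N powr r"
        using N1 by (simp add: X_def exp_add[symmetric] powr_def)
      then show ?thesis using n_le npos by simp
    qed
    also have "\<dots> \<le> (exp (21 * r * (ln ?N + t) / 5) - 1) * exp (- t)"
      using ge by (intro mult_right_mono) auto
    finally have le: "n / 3 \<le> exp (- t) * (exp (21 * r * (ln ?N + t) / 5) - 1)"
      by (simp add: mult.commute)
    have pos: "0 < exp (21 * r * (ln ?N + t) / 5) - 1" using ge X1 by linarith
    show ?thesis unfolding pos_divide_le_eq[OF pos] by (rule le)
  qed
  show "4 / (n * A) * (2 * real n * (B * \<Lambda>) + 21 * r * (ln ?N + t) * (3 * total_tail))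
         \<le> 8 * B / A * \<Lambda> + 7 * r / ?N * (\<Sum>k\<in>IMZ - I. lam k)"
  proof -
    let ?s = "\<Sum>k\<in>IMZ - I. lam k"
    have s0: "0 \<le> ?s" using lam_nonneg by (intro sum_nonneg) auto
    have "4 / (n * A) * (21 * r * u * (3 * total_tail)) \<le> 4 / (n * A) * (21 * r * u * (3 * (B * ?s)))"
      using total_tail_bounds(2) npos BA r u by (intro mult_left_mono) auto
    also have "\<dots> = 7 * r * ?s * (36 * B / A * u) / n"
      using npos BA by (simp add: field_simps)
    also have "\<dots> \<le> 7 * r * ?s * (36 * B / A * u) / (36 * B / A * ?N * u)"
      using n36 npos BA N1 u r s0 by (intro divide_left_mono) auto
    also have "\<dots> = 7 * r / ?N * ?s" using BA N1 u by (simp add: field_simps)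
    finally have 1: "4 / (n * A) * (21 * r * u * (3 * total_tail)) \<le> 7 * r / ?N * ?s" .
    have 2: "4 / (n * A) * (2 * real n * (B * \<Lambda>)) = 8 * B / A * \<Lambda>"
      using npos BA by (simp add: field_simps)
    show ?thesis
      unfolding distrib_left[of "4 / (real n * A)"] 2 u_def[symmetric] by (intro add_left_mono 1)
  qed
qed

lemma good_sample:
  assumes N: "3 \<le> card I" and t: "0 < t" and r: "1 \<le> r"
    and n: "36 * B / A * real (card I) * (ln (real (card I)) + t) \<le> real n" 
    and n_le: "real n \<le> real (card I) powr r"
    and \<Lambda>: "0 \<le> \<Lambda>" "(SUP k\<in>- I. ennreal (lam k)) = ennreal \<Lambda>" "\<And>k. k \<notin> I \<Longrightarrow> lam k \<le> \<Lambda>"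
    and j: "\<And>l. l < n \<Longrightarrow> j l \<in> {1..M}"
    and good: "\<not> bad_frame n j"
      "\<not> bad_tail (2 * real n * (B * \<Lambda>) + 21 * r * (ln (real (card I)) + t) * (3 * total_tail)) n j"
  shows "wls_well_defined I \<eta> n (\<lambda>l. x (j l)) (\<lambda>l. \<omega> (j l) / \<rho> (j l))"
    and "(SUP f\<in>unit_ball H ip. l2_norm_sq \<nu> (\<lambda>y. f y - wls I \<eta> n (\<lambda>l. x (j l)) (\<lambda>l. \<omega> (j l) / \<rho> (j l)) f y))
           \<le> ennreal (9 * B / A) * (SUP k\<in>- I. ennreal (lam k))
             + ennreal (7 * r / real (card I) * (\<Sum>k\<in>IMZ - I. lam k))
             + ennreal (12 / A) *
               (SUP f\<in>unit_ball H ip.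
                  (sup_norm D (\<lambda>y. f y - l2_projection \<nu> IMZ \<eta> f y))\<^sup>2)" (is "_ \<le> ?rhs")
proof -
  note sz = sample_size_bounds[OF N t r n n_le]
  show "wls_well_defined I \<eta> n (\<lambda>l. x (j l)) (\<lambda>l. \<omega> (j l) / \<rho> (j l))"
    using wls_well_defined_good[OF sz(1) j good(1)] by (simp add: weight_def)
  let ?Q = "SUP f\<in>unit_ball H ip. (sup_norm D (\<lambda>y. f y - l2_projection \<nu> IMZ \<eta> f y))\<^sup>2"
  let ?s = "2 * real n * (B * \<Lambda>) + 21 * r * (ln (real (card I)) + t) * (3 * total_tail)"
  show "(SUP f\<in>unit_ball H ip. l2_norm_sq \<nu> (\<lambda>y. f y - wls I \<eta> n (\<lambda>l. x (j l)) (\<lambda>l. \<omega> (j l) / \<rho> (j l)) f y)) \<le> ?rhs"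
  proof (cases "?Q = top_class.top")
    case True
    have "ennreal (12 / A) * top_class.top = top_class.top" using A_pos by (simp add: ennreal_mult_top)
    then show ?thesis unfolding True by simp
  next
    case False
    then obtain q where q: "0 \<le> q" "?Q = ennreal q" by (cases ?Q) auto
    have s: "0 \<le> ?s"
    proof -
      have "0 \<le> total_tail" unfolding total_tail_def tail_energy_def using \<omega>_nonneg by (intro sum_nonneg mult_nonneg_nonneg) auto
      moreover have "0 \<le> ln (real (card I)) + t" using N t by simp
      ultimately show ?thesis using B_pos \<Lambda>(1) r N t by (intro add_nonneg_nonneg mult_nonneg_nonneg) auto
    qed
    have b: "0 \<le> 7 * r / real (card I) * (\<Sum>k\<in>IMZ - I. lam k)"
      using r lam_nonneg by (intro mult_nonneg_nonneg sum_nonneg) auto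
    have le: "\<Lambda> + 4 / (n * A) * ?s + 12 / A * q
        \<le> 9 * B / A * \<Lambda> + 7 * r / real (card I) * (\<Sum>k\<in>IMZ - I. lam k) + 12 / A * q"
    proof -
      have "1 * \<Lambda> \<le> B / A * \<Lambda>" using A_pos A_le_B \<Lambda>(1) by (intro mult_right_mono) auto
      moreover have "9 * B / A * \<Lambda> = B / A * \<Lambda> + 8 * B / A * \<Lambda>" by (simp add: field_simps)
      ultimately show ?thesis using sz(4)[of \<Lambda>] by linarith
    qed
    have rhs: "?rhs = ennreal (9 * B / A * \<Lambda> + 7 * r / real (card I) * (\<Sum>k\<in>IMZ - I. lam k) + 12 / A * q)"
      unfolding q(2) \<Lambda>(2) using A_pos B_pos q(1) \<Lambda>(1) b
      by (simp add: ennreal_mult[symmetric] ennreal_plus[symmetric] del: ennreal_plus)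
    have each: "l2_norm_sq \<nu> (\<lambda>y. f y - wls I \<eta> n (\<lambda>l. x (j l)) (\<lambda>l. \<omega> (j l) / \<rho> (j l)) f y)
        \<le> ennreal (\<Lambda> + 4 / (n * A) * ?s + 12 / A * q)" if f: "f \<in> unit_ball H ip" for f
      using wls_error_bound[OF sz(1) j good s \<Lambda>(3,1) q(1) sup_bound_finite[OF eq_refl[OF q(2)] q(1)] f]
      by (simp add: weight_def)
    show ?thesis
      unfolding rhs by (rule SUP_least) (rule order_trans[OF each ennreal_leI[OF le]])
  qed
qed

end

theorem theorem4p6:
  fixes D :: "'a::euclidean_space set"
    and \<nu> :: "'a measure"
    and K :: "'a \<Rightarrow> 'a \<Rightarrow> complex"
    and H :: "('a \<Rightarrow> complex) set"
    and ip :: "('a \<Rightarrow> complex) \<Rightarrow> ('a \<Rightarrow> complex) \<Rightarrow> complex"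
    and S :: "('a \<Rightarrow> complex) \<Rightarrow> ('a \<Rightarrow> complex)"
    and lam :: "nat \<Rightarrow> real"
    and e :: "nat \<Rightarrow> 'a \<Rightarrow> complex"
    and I IMZ :: "nat set"
    and M n :: nat
    and x :: "nat \<Rightarrow> 'a"
    and \<omega> :: "nat \<Rightarrow> real"
    and A B t r :: real
    and \<Omega> :: "'w measure"
    and J :: "nat \<Rightarrow> 'w \<Rightarrow> nat"
  assumes "sigma_finite_measure \<nu>" and "space \<nu> = D"
    and "rkhs D K H ip" and "h_separable H ip"
    and "bdd_above ((\<lambda>y. Re (K y y)) ` D)"
    and "H \<subseteq> borel_measurable \<nu>"
    and "integrable \<nu> (\<lambda>y. Re (K y y))"
    and "embedding_adjoint \<nu> H ip S"
    and "eigensystem H ip S lam e"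
    and "finite IMZ" and "IMZ \<subseteq> {k. 0 < lam k}"
    and "\<forall>i\<in>{1..M}. x i \<in> D"
    and "\<forall>i\<in>{1..M}. 0 \<le> \<omega> i" and "(\<Sum>i=1..M. \<omega> i) = 1"
    and "0 < A" and "A \<le> B"
    and "\<forall>f\<in>fun_span IMZ (eta lam e).
           ennreal A * l2_norm_sq \<nu> f \<le> ennreal (\<Sum>i=1..M. \<omega> i * (cmod (f (x i)))\<^sup>2) \<and>
           ennreal (\<Sum>i=1..M. \<omega> i * (cmod (f (x i)))\<^sup>2) \<le> ennreal B * l2_norm_sq \<nu> f"
    and "I \<subseteq> IMZ" and "3 \<le> card I"
    and "0 < t" and "1 \<le> r"
    and "int n = \<lceil>36 * B / A * real (card I) * (ln (real (card I)) + t)\<rceil>"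
    and "real n \<le> real (card I) powr r"
    and "prob_space \<Omega>"
    and "prob_space.indep_vars \<Omega> (\<lambda>_. count_space {1..M}) J {..<n}"
    and "\<forall>l<n. \<forall>i\<in>{1..M}.
           measure \<Omega> {s \<in> space \<Omega>. J l s = i} = sampling_density M x \<omega> lam e I IMZ i"
  shows
    "measure \<Omega> {s \<in> space \<Omega>.
       (let X = (\<lambda>l. x (J l s));
            w = (\<lambda>l. \<omega> (J l s) / sampling_density M x \<omega> lam e I IMZ (J l s))
        in wls_well_defined I (eta lam e) n X w \<and>
           (SUP f\<in>unit_ball H ip. l2_norm_sq \<nu> (\<lambda>y. f y - wls I (eta lam e) n X w f y))
           \<le> ennreal (9 * B / A) * (SUP k\<in>- I. ennreal (lam k))
             + ennreal (7 * r / real (card I) * (\<Sum>k\<in>IMZ - I. lam k))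
             + ennreal (12 / A) *
               (SUP f\<in>unit_ball H ip.
                  (sup_norm D (\<lambda>y. f y - l2_projection \<nu> IMZ (eta lam e) f y))\<^sup>2))}
     > 1 - 4 * exp (- t)"
proof -
  define success where "success j \<longleftrightarrow>
       (let X = (\<lambda>l. x (j l));
            w = (\<lambda>l. \<omega> (j l) / sampling_density M x \<omega> lam e I IMZ (j l))
        in wls_well_defined I (eta lam e) n X w \<and>
           (SUP f\<in>unit_ball H ip. l2_norm_sq \<nu> (\<lambda>y. f y - wls I (eta lam e) n X w f y))
           \<le> ennreal (9 * B / A) * (SUP k\<in>- I. ennreal (lam k))
             + ennreal (7 * r / real (card I) * (\<Sum>k\<in>IMZ - I. lam k))
             + ennreal (12 / A) *
               (SUP f\<in>unit_ball H ip.
                  (sup_norm D (\<lambda>y. f y - l2_projection \<nu> IMZ (eta lam e) f y))\<^sup>2))" for j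
  interpret rkhs D K H ip by fact
  interpret mz_sampling D K H ip \<nu> S lam e I IMZ M x \<omega> A B
  proof unfold_locales
    show "x i \<in> D" if "i \<in> {1..M}" for i using assms(12) that by blast
    show "0 \<le> \<omega> i" if "i \<in> {1..M}" for i using assms(13) that by blast
    show "ennreal A * l2_norm_sq \<nu> f \<le> ennreal (\<Sum>i=1..M. \<omega> i * (cmod (f (x i)))\<^sup>2) \<and>
           ennreal (\<Sum>i=1..M. \<omega> i * (cmod (f (x i)))\<^sup>2) \<le> ennreal B * l2_norm_sq \<nu> f"
      if "f \<in> fun_span IMZ (eta lam e)" for f using assms(17) that by blast
    show "I \<noteq> {}" using assms(19) by auto
  qed (rule assms)+
  have n: "36 * B / A * real (card I) * (ln (real (card I)) + t) \<le> real n"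
    using assms(22) by linarith
  note N = \<open>3 \<le> card I\<close> and n_le = \<open>real n \<le> real (card I) powr r\<close>
  note sz = sample_size_bounds[OF N \<open>0 < t\<close> \<open>1 \<le> r\<close> n n_le]
  obtain \<Lambda> where \<Lambda>: "0 \<le> \<Lambda>" "(SUP k\<in>- I. ennreal (lam k)) = ennreal \<Lambda>" "\<And>k. k \<notin> I \<Longrightarrow> lam k \<le> \<Lambda>"
    using sup_eigenvalue by blast
  let ?z = "21 * r * (ln (real (card I)) + t)"
  have z: "0 < ?z"
  proof -
    have "0 < ln (real (card I)) + t" using N \<open>0 < t\<close> by (intro add_nonneg_pos) auto
    then show ?thesis using \<open>1 \<le> r\<close> by simp
  qed
  let ?s = "2 * real n * (B * \<Lambda>) + ?z * (3 * total_tail)"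
  \<comment> \<open>union bound over two exceptional events, each of probability at most \<open>exp (- t)\<close>\<close>
  have "1 - sample_mean n {1..M} \<rho> (\<lambda>j. of_bool (bad_frame n j)) - sample_mean n {1..M} \<rho> (\<lambda>j. of_bool (bad_tail ?s n j))
      \<le> measure \<Omega> {s \<in> space \<Omega>. success (\<lambda>l. J l s)}"
  proof (rule measure_iid_sample_ge[OF \<open>prob_space \<Omega>\<close> assms(25)])
    show "success j = success j'" if "\<And>l. l < n \<Longrightarrow> j l = j' l" for j j'
      unfolding success_def Let_def
      using wls_cong[of n "\<lambda>l. x (j l)" "\<lambda>l. x (j' l)" "\<lambda>l. \<omega> (j l) / \<rho> (j l)" "\<lambda>l. \<omega> (j' l) / \<rho> (j' l)" I \<eta>] that
      by simp
    show "success j" if "j \<in> PiE {..<n} (\<lambda>_. {1..M})" "\<not> bad_frame n j" "\<not> bad_tail ?s n j" for j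
      unfolding success_def Let_def
      using good_sample[OF N \<open>0 < t\<close> \<open>1 \<le> r\<close> n n_le \<Lambda> _ that(2,3)] that(1) by (auto simp: PiE_iff)
  qed (use assms(26) density(1) sum_\<rho> sz(1) in auto)
  moreover have "sample_mean n {1..M} \<rho> (\<lambda>j. of_bool (bad_frame n j)) \<le> exp (- t)"
    using prob_bad_frame[OF sz(1)] sz(2) by linarith
  moreover have "sample_mean n {1..M} \<rho> (\<lambda>j. of_bool (bad_tail ?s n j)) \<le> exp (- t)"
    using prob_bad_tail[OF \<Lambda>(3,1) z, of n] sz(3) by linarith
  ultimately have "1 - 2 * exp (- t) \<le> measure \<Omega> {s \<in> space \<Omega>. success (\<lambda>l. J l s)}" by linarith
  moreover have "0 < exp (- t)" by simp
  ultimately have "1 - 4 * exp (- t) < measure \<Omega> {s \<in> space \<Omega>. success (\<lambda>l. J l s)}" by linarith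
  then show ?thesis unfolding success_def .
qed

end
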